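(* If $\rho$ is an $\alpha$-super log-concave measure on $E$, then it satisfies the logarithmic Sobolev inequality $$\rho(f^2\log f^2)\le\frac{2}{\alpha}\,\rho(|\nabla f|_H^2)$$ for any smooth, cylindrical function $f$ on $E$ with $\rho(f^2)=1$.
   Context: $E$ is a separable Fréchet space and $H$ is a separable Hilbert space continuously and densely injected into $E$; $H$ is identified with its continuous dual, so that $E^\star\subset H\subset E$. A sequence $(\tilde e_i)_{i\ge1}$ is chosen from $E^\star$ such that its image $(e_i)_{i\ge1}$ under the injection $E^\star\hookrightarrow H$ is a complete orthonormal basis of $H$. Define $\pi_n(x)=\sum_{i\le n}\langle x,\tilde e_i\rangle e_i$ for $x\in E$. Finite-dimensional notions: on a Euclidean space $F$ with norm $|\cdot|$, a function $\theta:F\to[0,\infty)$ is log-concave if $\theta(sx+ty)\ge\theta(x)^s\theta(y)^t$ for all $x,y\in F$ and $s,t\ge0$ with $s+t=1$. A (positive) measure on $F$ is log-concave if any of its convolutions with log-concave continuous functions of compact support has a log-concave density with respect to Lebesgue measure. A (positive) measure $\nu$ on $F$ is $\alpha$-super log-concave, where $\alpha\ge0$, if the measure $e^{\frac{\alpha}{2}|x|^2}\nu(dx)$ is log-concave. A Radon measure $\rho$ on $E$ is called $\alpha$-super log-concave if (1) $\lim_n\pi_n(x)=x$ for $\rho$-almost every $x$, and (2) for every $n\ge1$ the image measure $\pi_n(\rho)$ is $\alpha$-super log-concave on the Euclidean space spanned by $\{e_1,\dots,e_n\}$. A smooth cylindrical function is one of the form $f(x)=\varphi(\langle x,l_1\rangle,\dots,\langle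 x,l_k\rangle)$ with $l_i\in E^\star$ and $\varphi$ smooth on $\mathbb{R}^k$; $\nabla f(x)=\sum_i\partial_i\varphi(\langle x,l_1\rangle,\dots,\langle x,l_k\rangle)\,l_i\in H$ is its gradient along $H$ (using $E^\star\subset H$), and $|\cdot|_H$ is the norm of $H$. $\rho(f)=\int f\,d\rho$.
   Formalization: The measure ρ is taken to be a probability measure (for total mass below 1 a constant f violates the inequality; mass above 1 follows by normalising), and α is taken to be strictly positive so that 2/α makes sense. *)

theory Defs
  imports "HOL-Probability.Probability"
begin

subsection \<open>Frechet spaces and their continuous duals\<close>

(* The topology of a Frechet space is induced by some complete translation-invariant metric.
   Here dist is any such metric, and only the topology it induces matters below. Continuity of
   addition follows from translation invariance. *)
class frechet_space = real_vector + complete_space +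
  assumes dist_translate: "dist (x + z) (y + z) = dist x y"
    and tendsto_scaleR_Pair:
      "LIM p (nhds (c::real) \<times>\<^sub>F nhds x). fst p *\<^sub>R snd p :> nhds (c *\<^sub>R x)"
    and locally_convex: "\<And>U. open U \<Longrightarrow> 0 \<in> U \<Longrightarrow>
          \<exists>C. open C \<and> 0 \<in> C \<and> C \<subseteq> U \<and>
              (\<forall>x\<in>C. \<forall>y\<in>C. \<forall>s\<ge>0. \<forall>t\<ge>0. s + t = 1 \<longrightarrow> s *\<^sub>R x + t *\<^sub>R y \<in> C)"

instance banach \<subseteq> frechet_space
proof
  fix x y z :: 'a
  show "dist (x + z) (y + z) = dist x y"
    by simp
  show "LIM p (nhds c \<times>\<^sub>F nhds x). fst p *\<^sub>R snd p :> nhds (c *\<^sub>R x)" for c :: real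
    by (intro tendsto_scaleR filterlim_fst filterlim_snd)
  fix U :: "'a set"
  assume "open U" "0 \<in> U"
  then obtain e where e: "e > 0" "ball 0 e \<subseteq> U"
    using open_contains_ball by blast
  have "\<forall>x\<in>ball 0 e. \<forall>y\<in>ball 0 e. \<forall>s\<ge>0. \<forall>t\<ge>0.
          s + t = 1 \<longrightarrow> s *\<^sub>R x + t *\<^sub>R y \<in> ball (0::'a) e"
    using convex_ball[of "0::'a" e] unfolding convex_def by blast
  with e show "\<exists>C. open C \<and> 0 \<in> C \<and> C \<subseteq> U \<and>
      (\<forall>x\<in>C. \<forall>y\<in>C. \<forall>s\<ge>0. \<forall>t\<ge>0. s + t = 1 \<longrightarrow> s *\<^sub>R x + t *\<^sub>R y \<in> C)"
    by (intro exI[of _ "ball 0 e"]) auto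
qed

definition continuous_dual :: "('e::{real_vector,topological_space} \<Rightarrow> real) set" where
  "continuous_dual = {l. linear l \<and> continuous_on UNIV l}"

definition dense_injection :: "('h::real_inner \<Rightarrow> 'e::frechet_space) \<Rightarrow> bool" where
  "dense_injection \<iota> \<longleftrightarrow>
     linear \<iota> \<and> continuous_on UNIV \<iota> \<and> inj \<iota> \<and> closure (range \<iota>) = UNIV"

(* The map E* -> H: restrict l to H along \<iota>, then identify H with its dual (Riesz). *)
definition dual_to_H :: "('h::real_inner \<Rightarrow> 'e::frechet_space) \<Rightarrow> ('e \<Rightarrow> real) \<Rightarrow> 'h" where
  "dual_to_H \<iota> l = (THE h. \<forall>v. l (\<iota> v) = inner h v)"

definition complete_orthonormal :: "(nat \<Rightarrow> 'h::real_inner) \<Rightarrow> bool" where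
  "complete_orthonormal e \<longleftrightarrow>
     (\<forall>i k. inner (e i) (e k) = (if i = k then 1 else 0)) \<and> closure (span (range e)) = UNIV"

(* Sequences are indexed from 0, so that the first n members are those with i < n.
   This is pi_n regarded as a map into H; pi_n as a map into E is \<iota> \<circ> proj_H \<iota> et n. *)
definition proj_H ::
  "('h::real_inner \<Rightarrow> 'e::frechet_space) \<Rightarrow> (nat \<Rightarrow> 'e \<Rightarrow> real) \<Rightarrow> nat \<Rightarrow> 'e \<Rightarrow> 'h" where
  "proj_H \<iota> et n x = (\<Sum>i<n. et i x *\<^sub>R dual_to_H \<iota> (et i))"


subsection \<open>Log-concavity on finite-dimensional Euclidean spaces\<close>

(* A Euclidean space F is given by a finite orthonormal set B in an ambient inner product space,
   F = span B. Measures on F live on the Borel sigma-algebra of F. *)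

abbreviation borel_span :: "'h::real_inner set \<Rightarrow> 'h measure" where
  "borel_span B \<equiv> restrict_space borel (span B)"

(* Same construction as that of lborel on euclidean_space types. *)
definition lborel_span :: "'h::real_inner set \<Rightarrow> 'h measure" where
  "lborel_span B = distr (\<Pi>\<^sub>M b\<in>B. lborel) (borel_span B) (\<lambda>c. \<Sum>b\<in>B. c b *\<^sub>R b)"

(* powr sets 0 powr 0 = 0 rather than 1; with s = 0 or t = 0 the inequality holds under
   either convention. *)
definition log_concave_fun_on :: "'h::real_vector set \<Rightarrow> ('h \<Rightarrow> real) \<Rightarrow> bool" where
  "log_concave_fun_on F \<theta> \<longleftrightarrow>
     (\<forall>x\<in>F. 0 \<le> \<theta> x) \<and>
     (\<forall>x\<in>F. \<forall>y\<in>F. \<forall>s\<ge>0. \<forall>t\<ge>0. s + t = 1 \<longrightarrow>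
        \<theta> (s *\<^sub>R x + t *\<^sub>R y) \<ge> \<theta> x powr s * \<theta> y powr t)"

(* HOL-Probability's convolution is restricted to ordered_euclidean_space. *)
definition convolution_span :: "'h::real_inner set \<Rightarrow> 'h measure \<Rightarrow> 'h measure \<Rightarrow> 'h measure" where
  "convolution_span B M N = distr (M \<Otimes>\<^sub>M N) (borel_span B) (\<lambda>(x, y). x + y)"

definition log_concave_measure :: "'h::real_inner set \<Rightarrow> 'h measure \<Rightarrow> bool" where
  "log_concave_measure B \<nu> \<longleftrightarrow>
     sets \<nu> = sets (borel_span B) \<and>
     (\<forall>\<theta>. log_concave_fun_on (span B) \<theta> \<and> continuous_on (span B) \<theta> \<and>
          compact (closure {x \<in> span B. \<theta> x \<noteq> 0}) \<longrightarrow>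
        (\<exists>g. log_concave_fun_on (span B) g \<and> g \<in> borel_measurable (borel_span B) \<and>
             convolution_span B \<nu> (density (lborel_span B) (\<lambda>x. ennreal (\<theta> x)))
               = density (lborel_span B) (\<lambda>x. ennreal (g x))))"

definition super_log_concave_span :: "real \<Rightarrow> 'h::real_inner set \<Rightarrow> 'h measure \<Rightarrow> bool" where
  "super_log_concave_span \<alpha> B \<nu> \<longleftrightarrow>
     sets \<nu> = sets (borel_span B) \<and>
     log_concave_measure B (density \<nu> (\<lambda>x. ennreal (exp (\<alpha> / 2 * (norm x)\<^sup>2))))"


subsection \<open>Super log-concave measures on a Frechet space\<close>

definition radon_measure :: "'e::t2_space measure \<Rightarrow> bool" where
  "radon_measure \<rho> \<longleftrightarrow>
     sets \<rho> = sets borel \<and>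
     (\<forall>x. \<exists>U. open U \<and> x \<in> U \<and> emeasure \<rho> U < \<infinity>) \<and>
     (\<forall>A\<in>sets borel. emeasure \<rho> A = (SUP K\<in>{K. compact K \<and> K \<subseteq> A}. emeasure \<rho> K))"

definition super_log_concave ::
  "('h::real_inner \<Rightarrow> 'e::frechet_space) \<Rightarrow> (nat \<Rightarrow> 'e \<Rightarrow> real) \<Rightarrow> real \<Rightarrow> 'e measure \<Rightarrow> bool" where
  "super_log_concave \<iota> et \<alpha> \<rho> \<longleftrightarrow>
     radon_measure \<rho> \<and>
     (AE x in \<rho>. (\<lambda>n. \<iota> (proj_H \<iota> et n x)) \<longlonglongrightarrow> x) \<and>
     (\<forall>n\<ge>1. let B = (\<lambda>i. dual_to_H \<iota> (et i)) ` {..<n} in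
        super_log_concave_span \<alpha> B (distr \<rho> (borel_span B) (proj_H \<iota> et n)))"


subsection \<open>Smooth cylindrical functions\<close>

primrec times_cont_differentiable :: "nat \<Rightarrow> ('a::real_normed_vector \<Rightarrow> real) \<Rightarrow> bool" where
  "times_cont_differentiable 0 \<phi> \<longleftrightarrow> continuous_on UNIV \<phi>"
| "times_cont_differentiable (Suc m) \<phi> \<longleftrightarrow>
     (\<forall>y. \<phi> differentiable at y) \<and>
     (\<forall>v. times_cont_differentiable m (\<lambda>y. frechet_derivative \<phi> (at y) v))"

definition smooth :: "('a::real_normed_vector \<Rightarrow> real) \<Rightarrow> bool" where
  "smooth \<phi> \<longleftrightarrow> (\<forall>m. times_cont_differentiable m \<phi>)"

definition cylindrical :: "(real ^ 'k \<Rightarrow> real) \<Rightarrow> ('k \<Rightarrow> 'e \<Rightarrow> real) \<Rightarrow> 'e \<Rightarrow> real" where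
  "cylindrical \<phi> l x = \<phi> (\<chi> i. l i x)"

definition cylindrical_gradient ::
  "('h::real_inner \<Rightarrow> 'e::frechet_space) \<Rightarrow> (real ^ 'k \<Rightarrow> real) \<Rightarrow> ('k \<Rightarrow> 'e \<Rightarrow> real) \<Rightarrow> 'e \<Rightarrow> 'h" where
  "cylindrical_gradient \<iota> \<phi> l x =
     (\<Sum>i\<in>UNIV. frechet_derivative \<phi> (at (\<chi> i. l i x)) (axis i 1) *\<^sub>R dual_to_H \<iota> (l i))"


subsection \<open>Integrals with values in the extended reals\<close>

(* The Bochner integral is 0 for non-integrable functions, so the inequality would be wrong
   where the right-hand side is infinite. For finite M and g = f^2 log f^2 \<ge> -1/e the
   negative part has finite integral, so \<infinity> - \<infinity> does not occur. *)
definition ext_integral :: "'a measure \<Rightarrow> ('a \<Rightarrow> real) \<Rightarrow> ereal" where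
  "ext_integral M g =
     enn2ereal (\<integral>\<^sup>+ x. ennreal (g x) \<partial>M) - enn2ereal (\<integral>\<^sup>+ x. ennreal (- g x) \<partial>M)"

end

theory Submission
  imports Defs
begin

text \<open>
The inequality is the infinitesimal form of the Prekopa--Leindler inequality, by an argument of
Bobkov and Ledoux. Prekopa--Leindler (\<open>prekopa_leindler\<close>) says that, for \<open>t + s = 1\<close> and nonnegative
functions on \<open>\<real>\<^sup>n\<close> with \<open>u(x)\<^sup>t v(y)\<^sup>s \<le> w(t x + s y)\<close>, one has \<open>(\<integral>u)\<^sup>t (\<integral>v)\<^sup>s \<le> \<integral>w\<close>. Lebesgue measure
may be replaced by a log-concave measure: a mollified one has a log-concave density, which is absorbed
into the three functions, and the mollification is then removed
(\<open>prekopa_leindler_log_concave_measure\<close>). For an \<open>\<alpha>\<close>-super log-concave measure the Gaussian factors are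
absorbed too, and since \<open>t|x|\<^sup>2 + s|y|\<^sup>2 - |t x + s y|\<^sup>2 = t s |x - y|\<^sup>2\<close> the hypothesis is relaxed by the
factor \<open>exp (- \<alpha> t s |x - y|\<^sup>2 / 2)\<close> (\<open>prekopa_leindler_super_log_concave\<close>).

Take \<open>u = exp (g / t)\<close> and \<open>v = 1\<close>. With \<open>z = t x + s y\<close> and \<open>h = x - y\<close>, an admissible \<open>w(z)\<close> is any
function above \<open>exp (g (z + s h) - \<alpha> t s |h|\<^sup>2 / 2)\<close> for all \<open>h\<close>, and completing the square in the first
order expansion of \<open>g\<close> shows that \<open>w = exp (g + s (|\<nabla>g|\<^sup>2 / (2 \<alpha> t) + \<delta>))\<close> will do for small \<open>s\<close>
(\<open>sup_convolution_bound\<close>). Hence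

  \<open>(\<integral>exp (g / t))\<^sup>t \<le> \<integral>exp (g + s (|\<nabla>g|\<^sup>2 / (2 \<alpha> t) + \<delta>))\<close>,

an inequality without any dimension-dependent constant. It is applied to the images of \<open>\<rho>\<close> under the
projections \<open>\<pi>\<^sub>n\<close> and, because \<open>\<pi>\<^sub>n x \<longlonglongrightarrow> x\<close> almost everywhere, passes to \<open>\<rho>\<close> itself
(\<open>exp_prekopa_leindler_cylindrical\<close>). The two sides agree at \<open>s = 0\<close>, so their derivatives there are
ordered (\<open>entropy_le_of_power_means\<close>); this reads

  \<open>\<rho>(g exp g) - \<rho>(exp g) ln \<rho>(exp g) \<le> \<rho>(|\<nabla>g|\<^sup>2 exp g) / (2 \<alpha>)\<close>,

which is the logarithmic Sobolev inequality for \<open>f\<^sup>2 = exp g\<close>. It is used with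
\<open>g = ln ((\<phi> \<chi>)\<^sup>2 + \<epsilon>)\<close>, where the cutoff \<open>\<chi>\<close> and the constant \<open>\<epsilon>\<close> make \<open>g\<close> and \<open>\<nabla>g\<close> bounded and
\<open>\<nabla>g\<close> uniformly continuous; they are removed by Fatou's lemma for the entropy and dominated convergence
for the energy (\<open>log_sobolev_finite_energy\<close>). If the energy is infinite there is nothing to prove.
\<close>

section \<open>Prekopa--Leindler on the line\<close>

lemma emeasure_lborel_affine_image:
  fixes K :: "real set"
  assumes "compact K" "0 < t"
  shows "emeasure lborel ((\<lambda>x. c + t * x) ` K) = ennreal t * emeasure lborel K"
proof -
  have cpt: "compact ((\<lambda>x. c + t * x) ` K)"
    by (intro compact_continuous_image continuous_intros assms)
  then have [measurable]: "(\<lambda>x. c + t * x) ` K \<in> sets borel"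
    by (simp add: borel_compact)
  have "emeasure lborel ((\<lambda>x. c + t * x) ` K) = (\<integral>\<^sup>+x. indicator ((\<lambda>x. c + t * x) ` K) x \<partial>lborel)"
    by simp
  also have "\<dots> = ennreal \<bar>t\<bar> * (\<integral>\<^sup>+x. indicator ((\<lambda>x. c + t * x) ` K) (c + t * x) \<partial>lborel)"
    using assms by (intro nn_integral_real_affine) auto
  also have "(\<lambda>x. indicator ((\<lambda>x. c + t * x) ` K) (c + t * x)) = (indicator K :: real \<Rightarrow> ennreal)"
    using assms by (auto simp: indicator_def fun_eq_iff)
  finally show ?thesis
    using assms by (simp add: borel_compact)
qed

text \<open>
Inner regularity is known for finite measures, hence the restriction of Lebesgue measure to \<open>A\<close>. The
compact set must be nonempty so that it has a maximum and a minimum.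
\<close>

lemma lborel_inner_compact:
  fixes A :: "real set"
  assumes A: "A \<in> sets borel" "A \<noteq> {}" "emeasure lborel A < \<infinity>" and e: "0 < e"
  obtains K where "compact K" "K \<subseteq> A" "K \<noteq> {}" "emeasure lborel A \<le> emeasure lborel K + ennreal e"
proof -
  let ?M = "density lborel (indicator A)"
  have M: "emeasure ?M X = emeasure lborel X" if "X \<in> sets borel" "X \<subseteq> A" for X
  proof -
    have "emeasure ?M X = (\<integral>\<^sup>+x. indicator A x * indicator X x \<partial>lborel)"
      using that A by (intro emeasure_density) auto
    also have "(\<lambda>x. indicator A x * indicator X x) = (indicator X :: real \<Rightarrow> ennreal)"
      using that by (auto simp: indicator_def fun_eq_iff)
    finally show ?thesis
      using that by simp
  qed
  have fin: "emeasure ?M (space ?M) \<noteq> \<infinity>"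
  proof -
    have "emeasure ?M (space ?M) = (\<integral>\<^sup>+x. indicator A x * indicator UNIV x \<partial>lborel)"
      using A by (subst emeasure_density) auto
    then show ?thesis using A by simp
  qed
  have "emeasure ?M A = (SUP K \<in> {K. K \<subseteq> A \<and> compact K}. emeasure ?M K)"
    using fin A by (intro inner_regular) auto
  then have sup: "emeasure lborel A = (SUP K \<in> {K. K \<subseteq> A \<and> compact K}. emeasure lborel K)"
    unfolding M[OF A(1) order_refl]
    by (rule trans, intro SUP_cong refl M) (auto intro: borel_compact)
  show thesis
  proof (cases "emeasure lborel A = 0")
    case True
    obtain a where "a \<in> A" using A by auto
    with True show thesis by (intro that[of "{a}"]) auto
  next
    case False
    have "emeasure lborel A - ennreal e < emeasure lborel A"
      using A(3) False e by (intro ennreal_between) (auto simp: zero_less_iff_neq_zero)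
    then obtain K where K: "K \<subseteq> A" "compact K" "emeasure lborel A - ennreal e < emeasure lborel K"
      unfolding sup less_SUP_iff by auto
    moreover have "K \<noteq> {}" using K by auto
    moreover have "emeasure lborel A \<le> emeasure lborel K + ennreal e"
      using K(3) by (metis add.commute ennreal_minus_le_iff ennreal_neq_top less_imp_le)
    ultimately show thesis by (intro that)
  qed
qed

text \<open>
For compact \<open>K\<close> and \<open>L\<close> the set \<open>t K + s L\<close> contains a translate of \<open>t K\<close> ending at
\<open>t max K + s min L\<close> and a translate of \<open>s L\<close> starting there, and these overlap in one point only. The
measurable superset \<open>C\<close> avoids the question whether \<open>t A + s B\<close> is measurable.
\<close>

lemma brunn_minkowski_real:
  fixes A B C :: "real set"
  assumes A: "A \<in> sets borel" "A \<noteq> {}" "emeasure lborel A < \<infinity>"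
    and B: "B \<in> sets borel" "B \<noteq> {}" "emeasure lborel B < \<infinity>"
    and C: "C \<in> sets borel" "\<And>x y. x \<in> A \<Longrightarrow> y \<in> B \<Longrightarrow> t * x + s * y \<in> C"
    and ts: "0 < t" "0 < s" "t + s = 1"
  shows "ennreal t * emeasure lborel A + ennreal s * emeasure lborel B \<le> emeasure lborel C"
proof (rule ennreal_le_epsilon)
  fix e :: real assume "0 < e"
  obtain K where K: "compact K" "K \<subseteq> A" "K \<noteq> {}" "emeasure lborel A \<le> emeasure lborel K + ennreal e"
    using lborel_inner_compact[OF A \<open>0 < e\<close>] .
  obtain L where L: "compact L" "L \<subseteq> B" "L \<noteq> {}" "emeasure lborel B \<le> emeasure lborel L + ennreal e"
    using lborel_inner_compact[OF B \<open>0 < e\<close>] .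
  obtain k where k: "k \<in> K" "\<And>x. x \<in> K \<Longrightarrow> x \<le> k"
    using compact_attains_sup[OF K(1,3)] by blast
  obtain m where m: "m \<in> L" "\<And>x. x \<in> L \<Longrightarrow> m \<le> x"
    using compact_attains_inf[OF L(1,3)] by blast
  define P where "P = (\<lambda>x. s * m + t * x) ` K"
  define Q where "Q = (\<lambda>x. t * k + s * x) ` L"
  have [measurable]: "P \<in> sets borel" "Q \<in> sets borel"
    unfolding P_def Q_def
    by (auto intro!: borel_compact compact_continuous_image continuous_intros K L)
  have "P \<subseteq> C" "Q \<subseteq> C"
    using C(2)[of _ m] C(2)[of k] k(1) m(1) K(2) L(2) unfolding P_def Q_def
    by (auto simp: add.commute[of "s * m"])
  have "x \<le> t * k + s * m" if "x \<in> P" for x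
    using that k ts by (auto simp: P_def)
  moreover have "t * k + s * m \<le> x" if "x \<in> Q" for x
    using that m ts by (auto simp: Q_def)
  ultimately have disj: "P \<inter> (Q - {t * k + s * m}) = {}"
    by (force simp: antisym)
  have "ennreal t * emeasure lborel K + ennreal s * emeasure lborel L = emeasure lborel P + emeasure lborel Q"
    unfolding P_def Q_def using K L ts by (simp add: emeasure_lborel_affine_image)
  also have "emeasure lborel Q = emeasure lborel (Q - {t * k + s * m})"
    by (rule emeasure_Diff_null_set[symmetric]) auto
  also have "emeasure lborel P + emeasure lborel (Q - {t * k + s * m})
      = emeasure lborel (P \<union> (Q - {t * k + s * m}))"
    using disj by (intro plus_emeasure) auto
  also have "\<dots> \<le> emeasure lborel C"
    using C(1) \<open>P \<subseteq> C\<close> \<open>Q \<subseteq> C\<close> by (intro emeasure_mono) auto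
  finally have *: "ennreal t * emeasure lborel K + ennreal s * emeasure lborel L \<le> emeasure lborel C" .
  have "ennreal t * emeasure lborel A + ennreal s * emeasure lborel B
      \<le> ennreal t * (emeasure lborel K + ennreal e) + ennreal s * (emeasure lborel L + ennreal e)"
    using K L by (intro add_mono mult_left_mono) auto
  also have "\<dots> = (ennreal t * emeasure lborel K + ennreal s * emeasure lborel L) + ennreal (t + s) * ennreal e"
    using ts(1,2) by (simp only: ennreal_plus less_imp_le distrib_left distrib_right ac_simps)
  also have "\<dots> \<le> emeasure lborel C + ennreal e"
    using * ts by (simp add: add_right_mono)
  finally show "ennreal t * emeasure lborel A + ennreal s * emeasure lborel B \<le> emeasure lborel C + ennreal e" .
qed

text \<open>
Truncating at height 1 is what the proof of Prekopa--Leindler needs: there the functions \<open>u\<close> and \<open>v\<close>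
are normalized to have supremum 1, and the level sets are compared only below that height.
\<close>

lemma nn_integral_layer_cake:
  fixes u :: "'a \<Rightarrow> real"
  assumes "sigma_finite_measure M" and [measurable]: "u \<in> borel_measurable M"
    and u: "\<And>x. x \<in> space M \<Longrightarrow> 0 \<le> u x" 
  shows "(\<integral>\<^sup>+x. ennreal (min (u x) 1) \<partial>M)
    = (\<integral>\<^sup>+a. indicator {0<..<1} a * emeasure M {x \<in> space M. a < u x} \<partial>lborel)"
proof -
  interpret sigma_finite_measure M by fact
  interpret P: pair_sigma_finite M lborel ..
  have "(\<integral>\<^sup>+x. ennreal (min (u x) 1) \<partial>M) = (\<integral>\<^sup>+x. \<integral>\<^sup>+a. indicator {0<..<1} a * indicator {..<u x} a \<partial>lborel \<partial>M)"
  proof (rule nn_integral_cong)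
    fix x assume "x \<in> space M"
    have "(\<lambda>a. indicator {0<..<1} a * indicator {..<u x} a) = (indicator {0<..<min (u x) 1} :: real \<Rightarrow> ennreal)"
      by (auto simp: indicator_def fun_eq_iff)
    then show "ennreal (min (u x) 1) = (\<integral>\<^sup>+a. indicator {0<..<1} a * indicator {..<u x} a \<partial>lborel)"
      using u[OF \<open>x \<in> space M\<close>] by simp
  qed
  also have "\<dots> = (\<integral>\<^sup>+a. \<integral>\<^sup>+x. indicator {0<..<1} a * indicator {..<u x} a \<partial>M \<partial>lborel)"
  proof (rule P.Fubini'[symmetric])
    have "(\<lambda>(x, a). indicator {0<..<1} a * indicator {..<u x} a :: ennreal)
        = (\<lambda>p. indicator {p. 0 < snd p \<and> snd p < 1 \<and> snd p < u (fst p)} p)"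
      by (auto simp: indicator_def fun_eq_iff)
    also have "\<dots> \<in> borel_measurable (M \<Otimes>\<^sub>M lborel)"
      by measurable
    finally show "(\<lambda>(x, a). indicator {0<..<1} a * indicator {..<u x} a :: ennreal) \<in> borel_measurable (M \<Otimes>\<^sub>M lborel)" .
  qed
  also have "\<dots> = (\<integral>\<^sup>+a. indicator {0<..<1} a * emeasure M {x \<in> space M. a < u x} \<partial>lborel)"
  proof (rule nn_integral_cong)
    fix a :: real
    have "(\<integral>\<^sup>+x. indicator {0<..<1} a * indicator {..<u x} a \<partial>M)
        = (\<integral>\<^sup>+x. indicator {0<..<1} a * indicator {x \<in> space M. a < u x} x \<partial>M)"
      by (intro nn_integral_cong) (auto simp: indicator_def)
    then show "(\<integral>\<^sup>+x. indicator {0<..<1} a * indicator {..<u x} a \<partial>M)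
        = indicator {0<..<1} a * emeasure M {x \<in> space M. a < u x}"
      by (simp add: nn_integral_cmult)
  qed
  finally show ?thesis .
qed

lemma weighted_AM_GM:
  fixes a b :: real
  assumes "0 < t" "0 < s" "t + s = 1" "0 \<le> a" "0 \<le> b"
  shows "a powr t * b powr s \<le> t * a + s * b"
  using Youngs_inequality_0[of t s a b] assms by (cases "a = 0 \<or> b = 0") auto

text \<open>
After dividing \<open>u\<close> and \<open>v\<close> by their suprema all their level sets at heights below 1 are nonempty, so
that Brunn--Minkowski compares them with those of \<open>w\<close>. Integrating over the heights gives the
inequality with the arithmetic mean on the left, which is stronger than the geometric one.
\<close>
lemma prekopa_leindler_real:
  fixes u v w :: "real \<Rightarrow> real"
  assumes u: "integrable lborel u" "\<And>x. 0 \<le> u x" "\<And>x. u x \<le> M"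
    and v: "integrable lborel v" "\<And>x. 0 \<le> v x" "\<And>x. v x \<le> M"
    and w: "integrable lborel w" "\<And>x. 0 \<le> w x"
    and le: "\<And>x y. u x powr t * v y powr s \<le> w (t * x + s * y)"
    and ts: "0 < t" "0 < s" "t + s = 1"
  shows "(\<integral>x. u x \<partial>lborel) powr t * (\<integral>x. v x \<partial>lborel) powr s \<le> (\<integral>x. w x \<partial>lborel)"
proof (cases "(\<forall>x. u x = 0) \<or> (\<forall>x. v x = 0)")
  case True
  then have "(\<integral>x. u x \<partial>lborel) = 0 \<or> (\<integral>x. v x \<partial>lborel) = 0" by auto
  then show ?thesis using ts w by auto
next
  case False
  have [measurable]: "u \<in> borel_measurable borel" "v \<in> borel_measurable borel" "w \<in> borel_measurable borel"
    using u v w by (auto dest: borel_measurable_integrable)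
  have bdd: "bdd_above (range u)" "bdd_above (range v)"
    using bdd_aboveI2[of UNIV u M] bdd_aboveI2[of UNIV v M] u v by auto
  define a where "a = (SUP x. u x)"
  define b where "b = (SUP x. v x)"
  have ua: "u x \<le> a" and vb: "v x \<le> b" for x
    unfolding a_def b_def by (auto intro: cSUP_upper bdd)
  obtain x0 y0 where "u x0 \<noteq> 0" "v y0 \<noteq> 0" using False by auto
  then have "0 < u x0" "0 < v y0" using u(2)[of x0] v(2)[of y0] by auto
  then have ab: "0 < a" "0 < b" using ua[of x0] vb[of y0] by auto
  define c where "c = a powr t * b powr s"
  have "0 < c" using ab by (simp add: c_def)
  have fin: "emeasure lborel {x. r < f x} < \<infinity>" if "integrable lborel f" "\<And>x. 0 \<le> f x" "0 < r" for f and r :: real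
  proof -
    have [measurable]: "f \<in> borel_measurable borel" using that by (auto dest: borel_measurable_integrable)
    have "emeasure lborel {x. r < f x} \<le> emeasure lborel {x \<in> space lborel. 1 \<le> ennreal (1 / r) * ennreal (f x)}"
      using that by (intro emeasure_mono) (auto simp: ennreal_mult''[symmetric] field_simps ennreal_le_iff simp flip: ennreal_1)
    also have "\<dots> \<le> ennreal (1/r) * (\<integral>\<^sup>+x. ennreal (f x) * indicator UNIV x \<partial>lborel)"
      using nn_integral_Markov_inequality[of f "space lborel" lborel "ennreal (1/r)"] by simp
    also have "\<dots> < \<infinity>"
      using that by (simp add: nn_integral_eq_integral ennreal_mult_less_top)
    finally show ?thesis .
  qed
  \<comment> \<open>If both normalized functions exceed \<open>r\<close>, then so does the one above their weighted geometric mean.\<close>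
  have key: "ennreal t * emeasure lborel {x. r < u x / a} + ennreal s * emeasure lborel {x. r < v x / b}
      \<le> emeasure lborel {x. r < w x / c}" if r: "0 < r" "r < 1" for r
  proof (rule brunn_minkowski_real)
    have "r * a < a" "r * b < b" using ab r by auto
    then obtain x y where "r * a < u x" "r * b < v y"
      unfolding a_def b_def by (auto simp: less_cSUP_iff bdd)
    then show "{x. r < u x / a} \<noteq> {}" "{x. r < v x / b} \<noteq> {}"
      using ab by (auto simp: field_simps)
    show "emeasure lborel {x. r < u x / a} < \<infinity>" "emeasure lborel {x. r < v x / b} < \<infinity>"
      using fin[of u "r * a"] fin[of v "r * b"] u v ab r by (auto simp: field_simps)
    fix x y assume xy: "x \<in> {x. r < u x / a}" "y \<in> {x. r < v x / b}"
    have "r = r powr t * r powr s" using r ts by (simp flip: powr_add)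
    also have "\<dots> < (u x / a) powr t * (v y / b) powr s"
      using xy r ts by (intro mult_strict_mono' powr_less_mono2) auto
    also have "\<dots> = (u x powr t * v y powr s) / c"
      using u v ab by (simp add: c_def powr_divide)
    also have "\<dots> \<le> w (t * x + s * y) / c"
      using le \<open>0 < c\<close> by (simp add: divide_right_mono)
    finally show "t * x + s * y \<in> {x. r < w x / c}" by simp
  qed (use ts in auto)
  have "ennreal t * (\<integral>\<^sup>+x. ennreal (min (u x / a) 1) \<partial>lborel) + ennreal s * (\<integral>\<^sup>+x. ennreal (min (v x / b) 1) \<partial>lborel)
     = (\<integral>\<^sup>+r. indicator {0<..<1} r * (ennreal t * emeasure lborel {x. r < u x / a} + ennreal s * emeasure lborel {x. r < v x / b}) \<partial>lborel)"
    using u v ab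
    by (subst (1 2) nn_integral_layer_cake)
       (auto simp: lborel.sigma_finite_measure_axioms nn_integral_cmult[symmetric] nn_integral_add[symmetric]
         algebra_simps intro!: nn_integral_cong)
  also have "\<dots> \<le> (\<integral>\<^sup>+r. indicator {0<..<1} r * emeasure lborel {x. r < w x / c} \<partial>lborel)"
    using key by (intro nn_integral_mono) (auto simp: indicator_def)
  also have "\<dots> = (\<integral>\<^sup>+x. ennreal (min (w x / c) 1) \<partial>lborel)"
    using w \<open>0 < c\<close> by (subst nn_integral_layer_cake) (auto simp: lborel.sigma_finite_measure_axioms)
  also have "\<dots> \<le> (\<integral>\<^sup>+x. ennreal (w x / c) \<partial>lborel)"
    by (intro nn_integral_mono) (auto intro: ennreal_leI)
  also have "\<dots> = ennreal ((\<integral>x. w x \<partial>lborel) / c)"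
    using w \<open>0 < c\<close> by (subst nn_integral_eq_integral) auto
  also have "(\<integral>\<^sup>+x. ennreal (min (u x / a) 1) \<partial>lborel) = ennreal ((\<integral>x. u x \<partial>lborel) / a)"
    using u ua ab by (simp add: min_absorb1 nn_integral_eq_integral)
  also have "(\<integral>\<^sup>+x. ennreal (min (v x / b) 1) \<partial>lborel) = ennreal ((\<integral>x. v x \<partial>lborel) / b)"
    using v vb ab by (simp add: min_absorb1 nn_integral_eq_integral)
  finally have "t * ((\<integral>x. u x \<partial>lborel) / a) + s * ((\<integral>x. v x \<partial>lborel) / b) \<le> (\<integral>x. w x \<partial>lborel) / c"
    using ts u v w ab \<open>0 < c\<close>
    by (simp add: ennreal_mult'[symmetric] ennreal_plus[symmetric] integral_nonneg del: ennreal_plus)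
  moreover have "((\<integral>x. u x \<partial>lborel) / a) powr t * ((\<integral>x. v x \<partial>lborel) / b) powr s
      \<le> t * ((\<integral>x. u x \<partial>lborel) / a) + s * ((\<integral>x. v x \<partial>lborel) / b)"
    using ts u v ab by (intro weighted_AM_GM) (auto intro!: divide_nonneg_pos)
  moreover have "((\<integral>x. u x \<partial>lborel) / a) powr t * ((\<integral>x. v x \<partial>lborel) / b) powr s
      = ((\<integral>x. u x \<partial>lborel) powr t * (\<integral>x. v x \<partial>lborel) powr s) / c"
    using u v ab by (simp add: c_def powr_divide)
  ultimately have "((\<integral>x. u x \<partial>lborel) powr t * (\<integral>x. v x \<partial>lborel) powr s) / c \<le> (\<integral>x. w x \<partial>lborel) / c"
    by linarith
  then show ?thesis using \<open>0 < c\<close> by (simp add: divide_le_cancel)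
qed

section \<open>Prekopa--Leindler in finite dimension\<close>

interpretation lborel_product: product_sigma_finite "\<lambda>_. lborel :: real measure"
  by standard

lemma integrable_box_supported:
  fixes u :: "('i \<Rightarrow> real) \<Rightarrow> real"
  assumes "finite I" and [measurable]: "u \<in> borel_measurable (Pi\<^sub>M I (\<lambda>_. lborel))"
    and u: "\<And>x. x \<in> space (Pi\<^sub>M I (\<lambda>_. lborel)) \<Longrightarrow> \<bar>u x\<bar> \<le> M"
      "\<And>x. x \<in> space (Pi\<^sub>M I (\<lambda>_. lborel)) \<Longrightarrow> u x \<noteq> 0 \<Longrightarrow> \<forall>i\<in>I. \<bar>x i\<bar> \<le> R"
  shows "integrable (Pi\<^sub>M I (\<lambda>_. lborel)) u"
proof (rule Bochner_Integration.integrable_bound)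
  let ?Q = "Pi\<^sub>E I (\<lambda>_. {-R..R})"
  have "emeasure (Pi\<^sub>M I (\<lambda>_. lborel)) ?Q = (\<Prod>i\<in>I. emeasure lborel {-R..R})"
    using assms(1) by (intro lborel_product.emeasure_PiM) auto
  also have "\<dots> < \<infinity>"
    by (simp add: less_top[symmetric] ennreal_prod_eq_top power_eq_top_ennreal emeasure_lborel_Icc_eq)
  finally show "integrable (Pi\<^sub>M I (\<lambda>_. lborel)) (\<lambda>x. M * indicator ?Q x :: real)"
    using assms(1) by (intro integrable_mult_right) (auto intro!: integrable_real_indicator sets_PiM_I_finite)
  show "AE x in Pi\<^sub>M I (\<lambda>_. lborel). norm (u x) \<le> norm (M * indicator ?Q x :: real)"
  proof (rule AE_I2)
    fix x :: "'i \<Rightarrow> real" assume x: "x \<in> space (Pi\<^sub>M I (\<lambda>_. lborel))"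
    then have "x \<in> ?Q" if "u x \<noteq> 0"
      using u(2)[OF x that] by (auto simp: space_PiM PiE_iff abs_le_iff minus_le_iff)
    with u(1)[OF x] show "norm (u x) \<le> norm (M * indicator ?Q x :: real)"
      by (cases "u x = 0") (auto simp: indicator_def)
  qed
qed measurable

lemma slice_in_space:
  "x \<in> space (Pi\<^sub>M I (\<lambda>_. lborel)) \<Longrightarrow> x(i := y) \<in> space (Pi\<^sub>M (insert i I) (\<lambda>_. lborel))"
  by (auto simp: space_PiM PiE_def extensional_def)

text \<open>
The class of bounded measurable functions supported in a box is stable under integrating out one
coordinate. This is the reason for working with it in the induction on the dimension: for a merely
integrable function some slices need not be integrable.
\<close>

lemma slice_box_supported:
  fixes u :: "('i \<Rightarrow> real) \<Rightarrow> real"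
  assumes i: "i \<notin> I" and R: "0 \<le> R" and [measurable]: "u \<in> borel_measurable (Pi\<^sub>M (insert i I) (\<lambda>_. lborel))"
    and u: "\<And>x. x \<in> space (Pi\<^sub>M (insert i I) (\<lambda>_. lborel)) \<Longrightarrow> 0 \<le> u x \<and> u x \<le> M"
      "\<And>x. x \<in> space (Pi\<^sub>M (insert i I) (\<lambda>_. lborel)) \<Longrightarrow> u x \<noteq> 0 \<Longrightarrow> \<forall>j\<in>insert i I. \<bar>x j\<bar> \<le> R"
  defines "U \<equiv> \<lambda>x. \<integral>y. u (x(i := y)) \<partial>lborel"
  shows "U \<in> borel_measurable (Pi\<^sub>M I (\<lambda>_. lborel))"
    and "\<And>x. x \<in> space (Pi\<^sub>M I (\<lambda>_. lborel)) \<Longrightarrow> integrable lborel (\<lambda>y. u (x(i := y)))"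
    and "\<And>x. x \<in> space (Pi\<^sub>M I (\<lambda>_. lborel)) \<Longrightarrow> 0 \<le> U x \<and> U x \<le> 2 * R * M"
    and "\<And>x. x \<in> space (Pi\<^sub>M I (\<lambda>_. lborel)) \<Longrightarrow> U x \<noteq> 0 \<Longrightarrow> \<forall>j\<in>I. \<bar>x j\<bar> \<le> R"
proof -
  let ?S = "space (Pi\<^sub>M I (\<lambda>_. lborel)) :: ('i \<Rightarrow> real) set"
  show "U \<in> borel_measurable (Pi\<^sub>M I (\<lambda>_. lborel))"
    unfolding U_def
    by (rule lborel.borel_measurable_lebesgue_integral)
       (use measurable_comp[OF measurable_add_dim assms(3)] in \<open>simp add: comp_def split_beta'\<close>)
  fix x assume x: "x \<in> ?S"
  have [measurable]: "(\<lambda>y. u (x(i := y))) \<in> borel_measurable lborel"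
    using measurable_comp[OF measurable_component_update[OF x i] assms(3)] by (simp add: comp_def)
  have "0 \<le> M" using u(1)[OF slice_in_space[OF x]] by (meson order_trans)
  then have le: "u (x(i := y)) \<le> M * indicator {-R..R} y" for y
    using u(1)[OF slice_in_space[OF x]] u(2)[OF slice_in_space[OF x], of y]
    by (cases "u (x(i := y)) = 0") (auto simp: indicator_def abs_le_iff)
  have int: "integrable lborel (\<lambda>y. M * indicator {-R..R} y)"
    by (intro integrable_mult_right integrable_real_indicator) (auto simp: emeasure_lborel_Icc_eq)
  show int': "integrable lborel (\<lambda>y. u (x(i := y)))"
    using u(1)[OF slice_in_space[OF x]] le
    by (intro Bochner_Integration.integrable_bound[OF int]) (auto intro!: AE_I2 order_trans[OF le])
  have "U x \<le> (\<integral>y. M * indicator {-R..R} y \<partial>lborel)"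
    unfolding U_def using le by (intro integral_mono int int')
  then show "0 \<le> U x \<and> U x \<le> 2 * R * M"
    using u(1)[OF slice_in_space[OF x]] R unfolding U_def by (auto simp: mult.commute intro!: integral_nonneg)
  show "\<forall>j\<in>I. \<bar>x j\<bar> \<le> R" if "U x \<noteq> 0"
  proof (rule ccontr)
    assume "\<not> (\<forall>j\<in>I. \<bar>x j\<bar> \<le> R)"
    then obtain j where j: "j \<in> I" "\<not> \<bar>x j\<bar> \<le> R" by blast
    then have "j \<noteq> i" using i by blast
    with j have "u (x(i := y)) = 0" for y
      using u(2)[OF slice_in_space[OF x, of i y]] by (metis fun_upd_other insertI2)
    then have "U x = 0" unfolding U_def by simp
    with that show False by simp
  qed
qed

text \<open>
Induction on the dimension: the one-dimensional inequality, applied on each line in the direction of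
the new coordinate, says that the functions obtained by integrating out this coordinate satisfy the
hypothesis again.
\<close>

lemma prekopa_leindler_box:
  fixes u v w :: "('i \<Rightarrow> real) \<Rightarrow> real"
  assumes "finite I" and ts: "0 < t" "0 < s" "t + s = 1" and "0 \<le> R"
    and "u \<in> borel_measurable (Pi\<^sub>M I (\<lambda>_. lborel))"
    and "v \<in> borel_measurable (Pi\<^sub>M I (\<lambda>_. lborel))"
    and "w \<in> borel_measurable (Pi\<^sub>M I (\<lambda>_. lborel))"
    and "\<And>x. x \<in> space (Pi\<^sub>M I (\<lambda>_. lborel)) \<Longrightarrow> 0 \<le> u x \<and> u x \<le> M"
    and "\<And>x. x \<in> space (Pi\<^sub>M I (\<lambda>_. lborel)) \<Longrightarrow> 0 \<le> v x \<and> v x \<le> M"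
    and "\<And>x. x \<in> space (Pi\<^sub>M I (\<lambda>_. lborel)) \<Longrightarrow> 0 \<le> w x \<and> w x \<le> M"
    and "\<And>x. x \<in> space (Pi\<^sub>M I (\<lambda>_. lborel)) \<Longrightarrow> u x \<noteq> 0 \<Longrightarrow> \<forall>i\<in>I. \<bar>x i\<bar> \<le> R"
    and "\<And>x. x \<in> space (Pi\<^sub>M I (\<lambda>_. lborel)) \<Longrightarrow> v x \<noteq> 0 \<Longrightarrow> \<forall>i\<in>I. \<bar>x i\<bar> \<le> R"
    and "\<And>x. x \<in> space (Pi\<^sub>M I (\<lambda>_. lborel)) \<Longrightarrow> w x \<noteq> 0 \<Longrightarrow> \<forall>i\<in>I. \<bar>x i\<bar> \<le> R"
    and "\<And>x y. x \<in> space (Pi\<^sub>M I (\<lambda>_. lborel)) \<Longrightarrow> y \<in> space (Pi\<^sub>M I (\<lambda>_. lborel)) \<Longrightarrow>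
           u x powr t * v y powr s \<le> w (\<lambda>i\<in>I. t * x i + s * y i)"
  shows "(\<integral>x. u x \<partial>Pi\<^sub>M I (\<lambda>_. lborel)) powr t * (\<integral>x. v x \<partial>Pi\<^sub>M I (\<lambda>_. lborel)) powr s
    \<le> (\<integral>x. w x \<partial>Pi\<^sub>M I (\<lambda>_. lborel))"
  using assms(1,6-)
proof (induction I arbitrary: u v w M rule: finite_induct)
  case empty
  have *: "(\<lambda>_. undefined) \<in> space (Pi\<^sub>M {} (\<lambda>_. lborel :: real measure))"
    by (simp add: space_PiM)
  have "(\<integral>x. f x \<partial>Pi\<^sub>M {} (\<lambda>_. lborel)) = f (\<lambda>_. undefined)" for f :: "('i \<Rightarrow> real) \<Rightarrow> real"
    by (simp add: PiM_empty lebesgue_integral_count_space_finite)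
  with empty.prems(10)[OF * *] show ?case
    by (simp add: restrict_def)
next
  case (insert i I)
  let ?P = "\<lambda>I. Pi\<^sub>M I (\<lambda>_. lborel) :: ('i \<Rightarrow> real) measure"
  note slice = slice_box_supported[OF insert.hyps(2) \<open>0 \<le> R\<close>]
  note su = slice[OF insert.prems(1,4,7)]
    and sv = slice[OF insert.prems(2,5,8)]
    and sw = slice[OF insert.prems(3,6,9)]
  define U V W where "U = (\<lambda>x. \<integral>y. u (x(i := y)) \<partial>lborel)"
    and "V = (\<lambda>x. \<integral>y. v (x(i := y)) \<partial>lborel)" and "W = (\<lambda>x. \<integral>y. w (x(i := y)) \<partial>lborel)"
  note UVW = U_def V_def W_def
  have abs: "\<bar>u x\<bar> \<le> M" "\<bar>v x\<bar> \<le> M" "\<bar>w x\<bar> \<le> M" if "x \<in> space (?P (insert i I))" for x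
    using insert.prems(4-6)[OF that] by auto
  have fin: "finite (insert i I)" using insert.hyps by simp
  have int: "integrable (?P (insert i I)) u" "integrable (?P (insert i I)) v" "integrable (?P (insert i I)) w"
    by (rule integrable_box_supported[OF fin insert.prems(1) abs(1) insert.prems(7)]
        integrable_box_supported[OF fin insert.prems(2) abs(2) insert.prems(8)]
        integrable_box_supported[OF fin insert.prems(3) abs(3) insert.prems(9)]; assumption)+
  have "(\<integral>x. U x \<partial>?P I) powr t * (\<integral>x. V x \<partial>?P I) powr s \<le> (\<integral>x. W x \<partial>?P I)"
  proof (rule insert.IH)
    fix x y assume xy: "x \<in> space (?P I)" "y \<in> space (?P I)"
    let ?z = "\<lambda>j\<in>I. t * x j + s * y j"
    have z: "?z \<in> space (?P I)" by (simp add: space_PiM)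
    show "U x powr t * V y powr s \<le> W ?z"
      unfolding UVW
    proof (rule prekopa_leindler_real[OF _ _ _ _ _ _ _ _ _ ts])
      show "0 \<le> u (x(i := a))" "u (x(i := a)) \<le> M" "0 \<le> v (y(i := a))" "v (y(i := a)) \<le> M" 
        "0 \<le> w (?z(i := a))" for a
        using insert.prems(4)[OF slice_in_space[OF xy(1)], of a]
          insert.prems(5)[OF slice_in_space[OF xy(2)], of a]
          insert.prems(6)[OF slice_in_space[OF z], of a] by blast+
      fix a b
      have "(\<lambda>j\<in>insert i I. t * (x(i := a)) j + s * (y(i := b)) j) = ?z(i := t * a + s * b)"
        using insert.hyps by (auto simp: fun_eq_iff)
      with insert.prems(10)[OF slice_in_space[OF xy(1), of i a] slice_in_space[OF xy(2), of i b]]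
      show "u (x(i := a)) powr t * v (y(i := b)) powr s \<le> w (?z(i := t * a + s * b))"
        by (simp only:)
    qed (rule su(2) sv(2) sw(2); (assumption | rule xy z))+
  qed (unfold UVW; (rule su sv sw; assumption))+
  then show ?case
    unfolding UVW using insert.hyps int by (simp add: lborel_product.product_integral_insert)
qed

lemma integral_truncation_tendsto:
  fixes u :: "('i \<Rightarrow> real) \<Rightarrow> real"
  assumes "finite I" and u: "integrable (Pi\<^sub>M I (\<lambda>_. lborel)) u" "\<And>x. 0 \<le> u x"
  shows "(\<lambda>n. \<integral>x. (if \<forall>i\<in>I. \<bar>x i\<bar> \<le> real n then min (u x) (real n) else 0) \<partial>Pi\<^sub>M I (\<lambda>_. lborel))
    \<longlonglongrightarrow> (\<integral>x. u x \<partial>Pi\<^sub>M I (\<lambda>_. lborel))"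
proof (rule integral_dominated_convergence)
  have [measurable]: "u \<in> borel_measurable (Pi\<^sub>M I (\<lambda>_. lborel))" using u by auto
  show "u \<in> borel_measurable (Pi\<^sub>M I (\<lambda>_. lborel))" by measurable
  show "(\<lambda>x. if \<forall>i\<in>I. \<bar>x i\<bar> \<le> real n then min (u x) (real n) else 0) \<in> borel_measurable (Pi\<^sub>M I (\<lambda>_. lborel))" for n
    using \<open>finite I\<close> by measurable
  show "integrable (Pi\<^sub>M I (\<lambda>_. lborel)) u" by fact
  show "AE x in Pi\<^sub>M I (\<lambda>_. lborel). norm (if \<forall>i\<in>I. \<bar>x i\<bar> \<le> real n then min (u x) (real n) else 0) \<le> u x" for n
    using u(2) by (intro AE_I2) auto
  show "AE x in Pi\<^sub>M I (\<lambda>_. lborel).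
      (\<lambda>n. if \<forall>i\<in>I. \<bar>x i\<bar> \<le> real n then min (u x) (real n) else 0) \<longlonglongrightarrow> u x"
  proof (rule AE_I2)
    fix x
    obtain N where N: "max (u x) (\<Sum>i\<in>I. \<bar>x i\<bar>) \<le> real N" using real_arch_simple by blast
    have "(if \<forall>i\<in>I. \<bar>x i\<bar> \<le> real n then min (u x) (real n) else 0) = u x" if "N \<le> n" for n
    proof -
      have "max (u x) (\<Sum>i\<in>I. \<bar>x i\<bar>) \<le> real n" using N that by linarith
      moreover have "\<bar>x i\<bar> \<le> (\<Sum>i\<in>I. \<bar>x i\<bar>)" if "i \<in> I" for i
        using \<open>finite I\<close> that by (intro member_le_sum) auto
      ultimately show ?thesis by fastforce
    qed
    then show "(\<lambda>n. if \<forall>i\<in>I. \<bar>x i\<bar> \<le> real n then min (u x) (real n) else 0) \<longlonglongrightarrow> u x"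
      by (intro tendsto_eventually eventually_sequentiallyI[of N])
  qed
qed

text \<open>
The general case follows by truncation. Cutting off at height \<open>n\<close> and outside the box of
side \<open>2 n\<close> preserves the hypothesis, because \<open>n\<^sup>t n\<^sup>s = n\<close> and the box is convex.
\<close>

theorem prekopa_leindler:
  fixes u v w :: "('i \<Rightarrow> real) \<Rightarrow> real"
  assumes I: "finite I" and ts: "0 < t" "0 < s" "t + s = 1"
    and u: "integrable (Pi\<^sub>M I (\<lambda>_. lborel)) u" "\<And>x. 0 \<le> u x"
    and v: "integrable (Pi\<^sub>M I (\<lambda>_. lborel)) v" "\<And>x. 0 \<le> v x"
    and w: "integrable (Pi\<^sub>M I (\<lambda>_. lborel)) w" "\<And>x. 0 \<le> w x"
    and le: "\<And>x y. u x powr t * v y powr s \<le> w (\<lambda>i\<in>I. t * x i + s * y i)"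
  shows "(\<integral>x. u x \<partial>Pi\<^sub>M I (\<lambda>_. lborel)) powr t * (\<integral>x. v x \<partial>Pi\<^sub>M I (\<lambda>_. lborel)) powr s
    \<le> (\<integral>x. w x \<partial>Pi\<^sub>M I (\<lambda>_. lborel))"
proof -
  let ?P = "Pi\<^sub>M I (\<lambda>_. lborel) :: ('i \<Rightarrow> real) measure"
  define T where "T n f x = (if \<forall>i\<in>I. \<bar>x i\<bar> \<le> real n then min (f x) (real n) else 0)"
    for n and f :: "('i \<Rightarrow> real) \<Rightarrow> real" and x
  have [measurable]: "u \<in> borel_measurable ?P" "v \<in> borel_measurable ?P" "w \<in> borel_measurable ?P"
    using u v w by auto
  have meas: "T n f \<in> borel_measurable ?P" if [measurable]: "f \<in> borel_measurable ?P" for f n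
    unfolding T_def[abs_def] using I by measurable
  have "(\<integral>x. T n u x \<partial>?P) powr t * (\<integral>x. T n v x \<partial>?P) powr s \<le> (\<integral>x. T n w x \<partial>?P)" for n
  proof (rule prekopa_leindler_box[OF I ts, where R = "real n" and M = "real n"])
    fix x y :: "'i \<Rightarrow> real"
    let ?z = "\<lambda>i\<in>I. t * x i + s * y i"
    show "T n u x powr t * T n v y powr s \<le> T n w ?z"
    proof (cases "(\<forall>i\<in>I. \<bar>x i\<bar> \<le> real n) \<and> (\<forall>i\<in>I. \<bar>y i\<bar> \<le> real n)")
      case True
      have "\<bar>t * x i + s * y i\<bar> \<le> real n" if "i \<in> I" for i
      proof -
        have "\<bar>t * x i + s * y i\<bar> \<le> t * \<bar>x i\<bar> + s * \<bar>y i\<bar>"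
          using ts abs_triangle_ineq[of "t * x i" "s * y i"] by (simp add: abs_mult)
        also have "\<dots> \<le> t * real n + s * real n"
          using True that ts by (intro add_mono mult_left_mono) auto
        also have "\<dots> = (t + s) * real n" by (simp add: algebra_simps)
        finally show ?thesis using ts by simp
      qed
      moreover have "min (u x) (real n) powr t * min (v y) (real n) powr s \<le> u x powr t * v y powr s"
        using u v ts by (intro mult_mono powr_mono2) auto
      moreover have "min (u x) (real n) powr t * min (v y) (real n) powr s \<le> real n powr t * real n powr s"
        using u v ts by (intro mult_mono powr_mono2) auto
      moreover have "real n powr t * real n powr s = real n"
        using ts by (simp flip: powr_add)
      ultimately show ?thesis
        using True le[of x y] by (auto simp: T_def)
    next
      case False
      then have "T n u x powr t * T n v y powr s = 0" unfolding T_def by auto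
      also have "0 \<le> T n w ?z" unfolding T_def using w by simp
      finally show ?thesis .
    qed
  next
    show "T n u \<in> borel_measurable ?P" "T n v \<in> borel_measurable ?P" "T n w \<in> borel_measurable ?P"
      using u(1) v(1) w(1) by (blast intro: meas borel_measurable_integrable)+
  qed (use u v w in \<open>auto simp: T_def split: if_splits\<close>)
  moreover have "(\<lambda>n. \<integral>x. T n f x \<partial>?P) \<longlonglongrightarrow> (\<integral>x. f x \<partial>?P)" if "integrable ?P f" "\<And>x. 0 \<le> f x" for f
    unfolding T_def using integral_truncation_tendsto[OF I that] .
  ultimately show ?thesis
    using u v w ts
    by (intro LIMSEQ_le[of "\<lambda>n. (\<integral>x. T n u x \<partial>?P) powr t * (\<integral>x. T n v x \<partial>?P) powr s" _ "\<lambda>n. \<integral>x. T n w x \<partial>?P"])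
       (auto intro!: tendsto_mult tendsto_powr' simp: T_def integral_nonneg)
qed

section \<open>Coordinates on the span of a finite orthonormal set\<close>

locale orthonormal_frame =
  fixes B :: "'h::{real_inner, second_countable_topology} set"
  assumes finite_frame: "finite B"
    and orthonormal: "\<And>b c. b \<in> B \<Longrightarrow> c \<in> B \<Longrightarrow> inner b c = (if b = c then 1 else 0)"
begin

text \<open>
The coordinate isometry that carries the product Lebesgue measure to the Lebesgue measure of \<open>span B\<close>.
\<close>
definition comb :: "('h \<Rightarrow> real) \<Rightarrow> 'h" where
  "comb c = (\<Sum>b\<in>B. c b *\<^sub>R b)"

lemma comb_in_span: "comb c \<in> span B"
  unfolding comb_def by (intro span_sum span_scale span_base)

lemma inner_comb: "b \<in> B \<Longrightarrow> inner (comb c) b = c b"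
proof -
  assume b: "b \<in> B"
  have "inner (comb c) b = (\<Sum>x\<in>B. if x = b then c x else 0)"
    unfolding comb_def inner_sum_left using b by (intro sum.cong) (auto simp: orthonormal)
  then show ?thesis using finite_frame b by simp
qed

lemma span_eq_comb:
  assumes "x \<in> span B"
  shows "x = comb (inner x)"
proof -
  obtain c where "x = comb c"
    using assms finite_frame unfolding comb_def by (auto simp: span_finite)
  have "comb (inner (comb c)) = comb c"
    unfolding comb_def[of c] comb_def[of "inner (\<Sum>b\<in>B. c b *\<^sub>R b)"]
    by (intro sum.cong) (simp_all add: inner_comb flip: comb_def)
  with \<open>x = comb c\<close> show ?thesis by simp
qed

lemma coord_le_norm: "b \<in> B \<Longrightarrow> \<bar>c b\<bar> \<le> norm (comb c)"
  using Cauchy_Schwarz_ineq2[of "comb c" b] orthonormal[of b b]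
  by (simp add: inner_comb norm_eq_sqrt_inner)

lemma norm_comb_le: "norm (comb c) \<le> (\<Sum>b\<in>B. \<bar>c b\<bar>)"
  unfolding comb_def
  by (rule order_trans[OF norm_sum]) (auto intro!: sum_mono simp: norm_eq_sqrt_inner orthonormal)

lemma comb_restrict: "comb (\<lambda>b\<in>B. t * c b + s * d b) = t *\<^sub>R comb c + s *\<^sub>R comb d"
  unfolding comb_def
  by (simp add: scaleR_sum_right scaleR_add_left sum.distrib)

lemma comb_measurable_borel: "comb \<in> Pi\<^sub>M B (\<lambda>_. lborel) \<rightarrow>\<^sub>M borel"
  unfolding comb_def[abs_def] by measurable

lemma comb_measurable [measurable]: "comb \<in> Pi\<^sub>M B (\<lambda>_. lborel) \<rightarrow>\<^sub>M borel_span B"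
  using comb_in_span by (intro measurable_restrict_space2 comb_measurable_borel) auto

lemma lborel_span_eq: "lborel_span B = distr (Pi\<^sub>M B (\<lambda>_. lborel)) (borel_span B) comb"
  unfolding lborel_span_def comb_def[abs_def] ..

lemma sets_lborel_span [measurable_cong, simp]: "sets (lborel_span B) = sets (borel_span B)"
  by (simp add: lborel_span_eq)

lemma space_borel_span [simp]: "space (borel_span B) = span B"
  by (simp add: space_restrict_space)

lemma span_in_sets [measurable, simp]: "span B \<in> sets (borel_span B)"
  using sets.top[of "borel_span B"] by simp

lemma space_lborel_span [simp]: "space (lborel_span B) = span B"
  by (simp add: lborel_span_eq)

lemma continuous_on_measurable:
  "continuous_on (span B) u \<Longrightarrow> u \<in> borel_measurable (borel_span B)"
  for u :: "'h \<Rightarrow> 'b::topological_space"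
  by (rule borel_measurable_continuous_on_restrict)

lemma prekopa_leindler_span:
  fixes u v w :: "'h \<Rightarrow> real"
  assumes ts: "0 < t" "0 < s" "t + s = 1"
    and u: "integrable (lborel_span B) u" "\<And>x. x \<in> span B \<Longrightarrow> 0 \<le> u x"
    and v: "integrable (lborel_span B) v" "\<And>x. x \<in> span B \<Longrightarrow> 0 \<le> v x"
    and w: "integrable (lborel_span B) w" "\<And>x. x \<in> span B \<Longrightarrow> 0 \<le> w x"
    and le: "\<And>x y. x \<in> span B \<Longrightarrow> y \<in> span B \<Longrightarrow>
      u x powr t * v y powr s \<le> w (t *\<^sub>R x + s *\<^sub>R y)"
  shows "(\<integral>x. u x \<partial>lborel_span B) powr t * (\<integral>x. v x \<partial>lborel_span B) powr s \<le> (\<integral>x. w x \<partial>lborel_span B)"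
proof -
  have eq: "(\<integral>x. f x \<partial>lborel_span B) = (\<integral>c. f (comb c) \<partial>Pi\<^sub>M B (\<lambda>_. lborel))"
    and int: "integrable (Pi\<^sub>M B (\<lambda>_. lborel)) (\<lambda>c. f (comb c))"
    if "integrable (lborel_span B) f" for f :: "'h \<Rightarrow> real"
  proof -
    have [measurable]: "f \<in> borel_measurable (borel_span B)"
      using borel_measurable_integrable[OF that] by (simp cong: measurable_cong_sets)
    show "(\<integral>x. f x \<partial>lborel_span B) = (\<integral>c. f (comb c) \<partial>Pi\<^sub>M B (\<lambda>_. lborel))"
      unfolding lborel_span_eq by (rule integral_distr) measurable
    show "integrable (Pi\<^sub>M B (\<lambda>_. lborel)) (\<lambda>c. f (comb c))"
      using that unfolding lborel_span_eq by (subst (asm) integrable_distr_eq) auto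
  qed
  show ?thesis
    unfolding eq[OF u(1)] eq[OF v(1)] eq[OF w(1)]
    using u(2) v(2) w(2) le
    by (intro prekopa_leindler[OF finite_frame ts] int u v w)
       (auto simp: comb_restrict comb_in_span)
qed

text \<open>
The ambient space is infinite-dimensional, so compactness has to come from the coordinates: the
combinations with coefficients bounded by \<open>R\<close> are a finite sum of compact segments.
\<close>

lemma compact_closure_bounded_subset_span:
  assumes "A \<subseteq> span B" "\<And>x. x \<in> A \<Longrightarrow> norm x \<le> R"
  shows "compact (closure A)"
proof -
  have cpt: "compact {\<Sum>b\<in>C. c b *\<^sub>R b | c. \<forall>b\<in>C. \<bar>c b\<bar> \<le> R}" if "finite C" for C :: "'h set"
    using that
  proof induction
    case empty
    then show ?case by simp
  next
    case (insert a C)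
    let ?S = "\<lambda>C. {\<Sum>b\<in>C. c b *\<^sub>R b | c. \<forall>b\<in>C. \<bar>c b\<bar> \<le> R}"
    have "compact ((\<lambda>r. r *\<^sub>R a) ` {-R..R})"
      by (intro compact_continuous_image continuous_intros) auto
    then have "compact {x + y | x y. x \<in> (\<lambda>r. r *\<^sub>R a) ` {-R..R} \<and> y \<in> ?S C}"
      by (rule compact_sums) (rule insert.IH)
    also have "{x + y | x y. x \<in> (\<lambda>r. r *\<^sub>R a) ` {-R..R} \<and> y \<in> ?S C} = ?S (insert a C)"
    proof (intro equalityI subsetI)
      fix z assume "z \<in> {x + y | x y. x \<in> (\<lambda>r. r *\<^sub>R a) ` {-R..R} \<and> y \<in> ?S C}"
      then obtain r c where rc: "z = r *\<^sub>R a + (\<Sum>b\<in>C. c b *\<^sub>R b)" "\<bar>r\<bar> \<le> R" "\<forall>b\<in>C. \<bar>c b\<bar> \<le> R"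
        by (force simp: abs_le_iff)
      have "z = (\<Sum>b\<in>insert a C. (c(a := r)) b *\<^sub>R b)"
        unfolding rc(1) sum.insert[OF insert.hyps]
        using insert.hyps by (auto intro!: arg_cong2[where f="(+)"] sum.cong)
      moreover have "\<forall>b\<in>insert a C. \<bar>(c(a := r)) b\<bar> \<le> R"
        using rc by auto
      ultimately show "z \<in> ?S (insert a C)" by blast
    next
      fix z assume "z \<in> ?S (insert a C)"
      then obtain c where c: "z = (\<Sum>b\<in>insert a C. c b *\<^sub>R b)" "\<forall>b\<in>insert a C. \<bar>c b\<bar> \<le> R"
        by blast
      have "z = c a *\<^sub>R a + (\<Sum>b\<in>C. c b *\<^sub>R b)"
        using c(1) insert.hyps by simp
      moreover have "c a *\<^sub>R a \<in> (\<lambda>r. r *\<^sub>R a) ` {-R..R}"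
        using c(2) by (auto simp: abs_le_iff)
      moreover have "(\<Sum>b\<in>C. c b *\<^sub>R b) \<in> ?S C" using c(2) by blast
      ultimately show "z \<in> {x + y | x y. x \<in> (\<lambda>r. r *\<^sub>R a) ` {-R..R} \<and> y \<in> ?S C}" by blast
    qed
    finally show ?case .
  qed
  let ?S = "{\<Sum>b\<in>B. c b *\<^sub>R b | c. \<forall>b\<in>B. \<bar>c b\<bar> \<le> R}"
  have "A \<subseteq> ?S"
  proof
    fix x assume "x \<in> A"
    then have x: "x = comb (inner x)" "norm x \<le> R"
      using assms span_eq_comb by auto
    then have "\<forall>b\<in>B. \<bar>inner x b\<bar> \<le> R"
      by (metis coord_le_norm order_trans)
    then show "x \<in> ?S" using x(1) unfolding comb_def by blast
  qed
  then have "closure A \<subseteq> ?S"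
    using cpt[OF finite_frame] by (intro closure_minimal compact_imp_closed)
  then have eq: "closure A = ?S \<inter> closure A" by (simp only: Int_absorb1)
  show ?thesis
    by (subst eq) (rule compact_Int_closed[OF cpt[OF finite_frame] closed_closure])
qed

end

section \<open>Mollifying log-concave measures\<close>

text \<open>
The positive part of a concave function is log-concave: where it is positive, the arithmetic mean
dominates the geometric mean, and elsewhere the geometric mean vanishes.
\<close>

lemma log_concave_fun_on_max_0:
  assumes F: "\<And>x y s t. x \<in> F \<Longrightarrow> y \<in> F \<Longrightarrow> 0 \<le> s \<Longrightarrow> 0 \<le> t \<Longrightarrow> s + t = 1 \<Longrightarrow>
      s * h x + t * h y \<le> h (s *\<^sub>R x + t *\<^sub>R y)"
  shows "log_concave_fun_on F (\<lambda>x. max 0 (h x :: real))"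
  unfolding log_concave_fun_on_def
proof (intro conjI ballI allI impI)
  fix x y s t assume A: "x \<in> F" "y \<in> F" "(0::real) \<le> s" "(0::real) \<le> t" "s + t = 1"
  show "max 0 (h x) powr s * max 0 (h y) powr t \<le> max 0 (h (s *\<^sub>R x + t *\<^sub>R y))"
  proof (cases "0 < h x \<and> 0 < h y")
    case True
    then have "h x powr s * h y powr t \<le> s * h x + t * h y"
      using A by (intro Youngs_inequality_0) auto
    with F[OF A] True show ?thesis by simp
  next
    case False
    then have "max 0 (h x) = 0 \<or> max 0 (h y) = 0" by auto
    then show ?thesis by auto
  qed
qed simp

text \<open>
Serves both as mollifier (small radius) and as cutoff (large radius), since it is continuous,
log-concave and of bounded support.
\<close>
definition tent :: "real \<Rightarrow> 'a::real_normed_vector \<Rightarrow> real" where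
  "tent \<epsilon> x = max 0 (1 - norm x / \<epsilon>)"

lemma tent_bounds: "0 < \<epsilon> \<Longrightarrow> 0 \<le> tent \<epsilon> x \<and> tent \<epsilon> x \<le> 1"
  by (auto simp: tent_def)

lemma tent_eq_0: "0 < \<epsilon> \<Longrightarrow> \<epsilon> \<le> norm x \<Longrightarrow> tent \<epsilon> x = 0"
  by (auto simp: tent_def field_simps)

lemma continuous_on_tent: "continuous_on S (tent \<epsilon>)"
  unfolding tent_def[abs_def] divide_inverse by (intro continuous_intros)

lemma tent_concave:
  assumes "0 < \<epsilon>" "0 \<le> s" "0 \<le> t" "s + t = 1"
  shows "s * (1 - norm x / \<epsilon>) + t * (1 - norm y / \<epsilon>) \<le> 1 - norm (s *\<^sub>R x + t *\<^sub>R y) / \<epsilon>"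
proof -
  have "norm (s *\<^sub>R x + t *\<^sub>R y) \<le> s * norm x + t * norm y"
    using assms by (intro order_trans[OF norm_triangle_ineq]) simp
  then have "norm (s *\<^sub>R x + t *\<^sub>R y) / \<epsilon> \<le> (s * norm x + t * norm y) / \<epsilon>"
    using assms by (intro divide_right_mono) auto
  moreover have "s * (1 - norm x / \<epsilon>) + t * (1 - norm y / \<epsilon>) = (s + t) - (s * norm x + t * norm y) / \<epsilon>"
    by (simp add: algebra_simps add_divide_distrib)
  ultimately show ?thesis using assms by simp
qed

text \<open>
This identity turns the Gaussian factor of a super log-concave measure into the gain
\<open>t s |x - y|\<^sup>2\<close>.
\<close>

lemma convex_combination_norm_sq:
  fixes x y :: "'a::real_inner"
  assumes "t + s = 1"
  shows "t * (norm x)\<^sup>2 + s * (norm y)\<^sup>2 = (norm (t *\<^sub>R x + s *\<^sub>R y))\<^sup>2 + t * s * (norm (x - y))\<^sup>2"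
proof -
  have s: "s = 1 - t" using assms by simp
  show ?thesis
    unfolding s power2_norm_eq_inner
    by (simp add: inner_simps inner_commute[of y x] algebra_simps power2_eq_square)
qed

context orthonormal_frame
begin

text \<open>
A tent of radius \<open>\<epsilon>\<close>, normalized to integral 1. Its integral is positive because the tent is at least
\<open>1/2\<close> on a small cube around the origin.
\<close>

lemma log_concave_mollifier:
  assumes "0 < \<epsilon>"
  obtains \<theta> where "log_concave_fun_on (span B) \<theta>" "continuous_on (span B) \<theta>"
    "compact (closure {x \<in> span B. \<theta> x \<noteq> 0})"
    "prob_space (density (lborel_span B) (\<lambda>x. ennreal (\<theta> x)))"
    "\<And>x. \<theta> x \<noteq> 0 \<Longrightarrow> norm x \<le> \<epsilon>"
proof -
  let ?P = "Pi\<^sub>M B (\<lambda>_. lborel) :: ('h \<Rightarrow> real) measure"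
  have bounds: "0 \<le> tent \<epsilon> x \<and> tent \<epsilon> x \<le> 1" for x :: 'h
    by (rule tent_bounds) fact
  have [measurable]: "tent \<epsilon> \<in> borel_measurable (borel_span B)"
    by (intro continuous_on_measurable continuous_on_tent)
  have int: "integrable ?P (\<lambda>c. tent \<epsilon> (comb c))"
  proof (rule integrable_box_supported[OF finite_frame])
    show "\<bar>tent \<epsilon> (comb c)\<bar> \<le> 1" for c using bounds by (auto simp: abs_le_iff intro: order_trans[of _ 0])
    show "\<forall>b\<in>B. \<bar>c b\<bar> \<le> \<epsilon>" if "tent \<epsilon> (comb c) \<noteq> 0" for c
      using that tent_eq_0[OF assms, of "comb c"] coord_le_norm by (meson le_cases order_trans)
  qed measurable
  \<comment> \<open>Half the side of a cube contained in the ball of radius \<open>\<epsilon> / 2\<close>; the summand 2 covers the case of empty \<open>B\<close>.\<close>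
  define r where "r = \<epsilon> / (2 * real (card B) + 2)"
  have "0 < r" using assms by (simp add: r_def)
  let ?Q = "Pi\<^sub>E B (\<lambda>_. {-r..r})"
  have "emeasure ?P ?Q = (\<Prod>i\<in>B. emeasure lborel {-r..r})"
    using finite_frame by (intro lborel_product.emeasure_PiM) auto
  also have "\<dots> = ennreal (2 * r) ^ card B" using \<open>0 < r\<close> by (simp add: emeasure_lborel_Icc_eq)
  finally have Q: "emeasure ?P ?Q = ennreal (2 * r) ^ card B" .
  have "ennreal (1/2) * emeasure ?P ?Q = (\<integral>\<^sup>+c. ennreal (1/2) * indicator ?Q c \<partial>?P)"
    using finite_frame by (subst nn_integral_cmult_indicator) (auto intro!: sets_PiM_I_finite)
  also have "\<dots> \<le> (\<integral>\<^sup>+c. ennreal (tent \<epsilon> (comb c)) \<partial>?P)"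
  proof (rule nn_integral_mono)
    fix c
    show "ennreal (1/2) * indicator ?Q c \<le> ennreal (tent \<epsilon> (comb c))"
    proof (cases "c \<in> ?Q")
      case True
      have "norm (comb c) \<le> (\<Sum>b\<in>B. \<bar>c b\<bar>)" by (rule norm_comb_le)
      also have "\<dots> \<le> (\<Sum>b\<in>B. r)" using True by (intro sum_mono) (auto simp: PiE_iff abs_le_iff minus_le_iff)
      also have "\<dots> = real (card B) * r" by simp
      also have "\<dots> \<le> \<epsilon> / 2"
        using assms unfolding r_def by (simp add: field_simps)
      finally have "1/2 \<le> tent \<epsilon> (comb c)" using assms by (simp add: tent_def field_simps)
      then show ?thesis using True ennreal_leI[of "1/2" "tent \<epsilon> (comb c)"] by simp
    qed simp
  qed
  also have "\<dots> = ennreal (\<integral>c. tent \<epsilon> (comb c) \<partial>?P)"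
    using bounds by (intro nn_integral_eq_integral int) auto
  finally have le: "ennreal (1/2) * emeasure ?P ?Q \<le> ennreal (\<integral>c. tent \<epsilon> (comb c) \<partial>?P)" .
  have "ennreal (1/2) * emeasure ?P ?Q = ennreal (1/2 * (2 * r) ^ card B)"
    unfolding Q using \<open>0 < r\<close> by (subst ennreal_power, simp, subst ennreal_mult'[symmetric]) simp_all
  moreover have "0 \<le> (\<integral>c. tent \<epsilon> (comb c) \<partial>?P)"
    using bounds by (intro Bochner_Integration.integral_nonneg) auto
  ultimately have "1/2 * (2 * r) ^ card B \<le> (\<integral>c. tent \<epsilon> (comb c) \<partial>?P)"
    using le by (simp only: ennreal_le_iff)
  moreover have "0 < 1/2 * (2 * r) ^ card B" using \<open>0 < r\<close> by simp
  ultimately have pos: "0 < (\<integral>c. tent \<epsilon> (comb c) \<partial>?P)" by linarith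
  define a where "a = 1 / (\<integral>c. tent \<epsilon> (comb c) \<partial>?P)"
  have "0 < a" using pos by (simp add: a_def)
  define \<theta> where "\<theta> x = max 0 (a * (1 - norm x / \<epsilon>))" for x :: 'h
  have \<theta>: "\<theta> x = a * tent \<epsilon> x" for x
    using \<open>0 < a\<close> by (auto simp: \<theta>_def tent_def max_def zero_le_mult_iff)
  show thesis
  proof (rule that)
    show "log_concave_fun_on (span B) \<theta>"
      unfolding \<theta>_def[abs_def]
    proof (rule log_concave_fun_on_max_0)
      fix x y :: 'h and s t :: real assume "0 \<le> s" "0 \<le> t" "s + t = 1"
      from mult_left_mono[OF tent_concave[OF assms this, of x y], of a] \<open>0 < a\<close>
      show "s * (a * (1 - norm x / \<epsilon>)) + t * (a * (1 - norm y / \<epsilon>)) \<le> a * (1 - norm (s *\<^sub>R x + t *\<^sub>R y) / \<epsilon>)"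
        by (simp add: algebra_simps)
    qed
    show "continuous_on (span B) \<theta>"
      unfolding \<theta> by (intro continuous_intros continuous_on_tent)
    show nz: "norm x \<le> \<epsilon>" if "\<theta> x \<noteq> 0" for x
      using that tent_eq_0[OF assms, of x] unfolding \<theta> by (cases "norm x \<le> \<epsilon>") auto
    show "compact (closure {x \<in> span B. \<theta> x \<noteq> 0})"
      using nz by (intro compact_closure_bounded_subset_span[of _ \<epsilon>]) auto
    show "prob_space (density (lborel_span B) (\<lambda>x. ennreal (\<theta> x)))"
    proof (rule prob_spaceI)
      have "emeasure (density (lborel_span B) (\<lambda>x. ennreal (\<theta> x))) (space (lborel_span B))
          = (\<integral>\<^sup>+x. ennreal (\<theta> x) \<partial>lborel_span B)"
        unfolding \<theta> by (subst emeasure_density) (auto intro!: nn_integral_cong)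
      also have "\<dots> = (\<integral>\<^sup>+c. ennreal (a * tent \<epsilon> (comb c)) \<partial>?P)"
        unfolding \<theta> lborel_span_eq by (subst nn_integral_distr) auto
      also have "\<dots> = ennreal (\<integral>c. a * tent \<epsilon> (comb c) \<partial>?P)"
        using bounds \<open>0 < a\<close> by (intro nn_integral_eq_integral integrable_mult_right int) auto
      also have "\<dots> = 1" using pos by (simp add: a_def)
      finally show "emeasure (density (lborel_span B) (\<lambda>x. ennreal (\<theta> x)))
          (space (density (lborel_span B) (\<lambda>x. ennreal (\<theta> x)))) = 1" by simp
    qed
  qed
qed


lemma add_measurable_span:
  "(\<lambda>(x, y). x + y) \<in> borel_span B \<Otimes>\<^sub>M borel_span B \<rightarrow>\<^sub>M borel_span B"
proof (rule measurable_restrict_space2)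
  show "(\<lambda>(x, y). x + y) \<in> space (borel_span B \<Otimes>\<^sub>M borel_span B) \<rightarrow> span B"
    by (auto simp: space_pair_measure space_restrict_space intro: span_add)
  have [measurable]: "(\<lambda>x. x) \<in> borel_span B \<rightarrow>\<^sub>M borel"
    by (rule measurable_restrict_space1) simp
  have [measurable]: "fst \<in> borel_span B \<Otimes>\<^sub>M borel_span B \<rightarrow>\<^sub>M borel" 
    "snd \<in> borel_span B \<Otimes>\<^sub>M borel_span B \<rightarrow>\<^sub>M borel"
    using measurable_comp[OF measurable_fst \<open>(\<lambda>x. x) \<in> borel_span B \<rightarrow>\<^sub>M borel\<close>]
      measurable_comp[OF measurable_snd \<open>(\<lambda>x. x) \<in> borel_span B \<rightarrow>\<^sub>M borel\<close>]
    by (auto simp: comp_def)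
  show "(\<lambda>(x, y). x + y) \<in> borel_span B \<Otimes>\<^sub>M borel_span B \<rightarrow>\<^sub>M borel"
    by (simp add: split_beta')
qed

text \<open>
Mollifying the measure amounts to averaging the integrand. The averaged integrand is dominated by a
multiple of the indicator of a ball, uniformly over all mollifiers supported in the unit ball, which
is the bound that dominated convergence needs when the mollification is removed.
\<close>
lemma integral_convolution:
  fixes u :: "'h \<Rightarrow> real"
  assumes "prob_space N" and sets_N: "sets N = sets (borel_span B)"
    and sets_L: "sets \<Lambda> = sets (borel_span B)"
    and N: "AE y in N. norm y \<le> 1"
    and fin: "\<And>R. emeasure \<Lambda> {x \<in> span B. norm x \<le> R} < \<infinity>"
    and [measurable]: "u \<in> borel_measurable (borel_span B)"
    and u: "\<And>x. x \<in> span B \<Longrightarrow> 0 \<le> u x \<and> u x \<le> M" "\<And>x. x \<in> span B \<Longrightarrow> R < norm x \<Longrightarrow> u x = 0"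
  shows "integrable (convolution_span B \<Lambda> N) u"
    and "(\<integral>x. u x \<partial>convolution_span B \<Lambda> N) = (\<integral>x. (\<integral>y. u (x + y) \<partial>N) \<partial>\<Lambda>)"
    and "\<And>x. x \<in> span B \<Longrightarrow> (\<integral>y. u (x + y) \<partial>N) \<le> M * indicator {x \<in> span B. norm x \<le> R + 1} x"
    and "(\<lambda>x. \<integral>y. u (x + y) \<partial>N) \<in> borel_measurable \<Lambda>"
    and "integrable \<Lambda> (\<lambda>x. M * indicator {x \<in> span B. norm x \<le> R + 1} x :: real)"
proof -
  interpret N: prob_space N by fact
  note [measurable_cong] = sets_N sets_L
  have sp: "space N = span B" "space \<Lambda> = span B"
    using sets_eq_imp_space_eq[OF sets_N] sets_eq_imp_space_eq[OF sets_L] by simp_all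
  have plus[measurable]: "(\<lambda>(x, y). x + y) \<in> \<Lambda> \<Otimes>\<^sub>M N \<rightarrow>\<^sub>M borel_span B"
    using add_measurable_span by (simp cong: measurable_cong_sets sets_pair_measure_cong add: sets_N sets_L)
  have plus'[measurable]: "(\<lambda>y. x + y) \<in> N \<rightarrow>\<^sub>M borel_span B" if "x \<in> span B" for x
    using measurable_compose[OF measurable_Pair1'[of x \<Lambda> N] plus] that sp by simp
  have [measurable]: "(\<lambda>p. u (fst p + snd p)) \<in> borel_measurable (\<Lambda> \<Otimes>\<^sub>M N)"
    using measurable_compose[OF plus assms(6)] by (simp add: split_beta')
  show meas: "(\<lambda>x. \<integral>y. u (x + y) \<partial>N) \<in> borel_measurable \<Lambda>"
    by (rule N.borel_measurable_lebesgue_integral) (simp add: split_beta')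
  have "0 \<le> M" using u(1)[OF span_zero] by linarith
  have xy: "x + y \<in> span B" if "x \<in> span B" "y \<in> space N" for x y
    using that sp by (auto intro: span_add)
  have intN: "integrable N (\<lambda>y. u (x + y))" if "x \<in> span B" for x
    using that u(1)[OF xy[OF that]] \<open>0 \<le> M\<close> measurable_compose[OF plus'[OF that] assms(6)]
    by (intro N.integrable_const_bound[of _ M] AE_I2) auto
  have nn: "(\<integral>\<^sup>+y. ennreal (u (x + y)) \<partial>N) = ennreal (\<integral>y. u (x + y) \<partial>N)" if "x \<in> span B" for x
    using u(1)[OF xy[OF that]] by (intro nn_integral_eq_integral intN that AE_I2) auto
  have A0: "0 \<le> (\<integral>y. u (x + y) \<partial>N)" if "x \<in> span B" for x
    using u(1)[OF xy[OF that]] by (intro Bochner_Integration.integral_nonneg) auto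
  have [measurable]: "{x \<in> span B. norm x \<le> R + 1} \<in> sets (borel_span B)"
    by (auto simp: sets_restrict_space intro!: image_eqI[of _ _ "{x. norm x \<le> R + 1}"])
  show le: "(\<integral>y. u (x + y) \<partial>N) \<le> M * indicator {x \<in> span B. norm x \<le> R + 1} x" if x: "x \<in> span B" for x
  proof (cases "norm x \<le> R + 1")
    case True
    have "(\<integral>y. u (x + y) \<partial>N) \<le> (\<integral>y. M \<partial>N)"
      using u(1)[OF xy[OF x]] by (intro integral_mono intN x) auto
    then show ?thesis using True x N.prob_space by simp
  next
    case False
    have "(\<integral>y. u (x + y) \<partial>N) = (\<integral>y. 0 \<partial>N)"
    proof (rule integral_cong_AE)
      show "AE y in N. u (x + y) = 0"
        using N
      proof (rule AE_mp, intro AE_I2 impI)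
        fix y assume "y \<in> space N" "norm y \<le> 1"
        have "norm x \<le> norm (x + y) + norm y"
          using norm_triangle_ineq4[of "x + y" y] by simp
        then show "u (x + y) = 0"
          using False \<open>norm y \<le> 1\<close> by (intro u(2) xy x \<open>y \<in> space N\<close>) auto
      qed
    qed (use borel_measurable_integrable[OF intN[OF x]] in auto)
    then show ?thesis using False by simp
  qed
  show int: "integrable \<Lambda> (\<lambda>x. M * indicator {x \<in> span B. norm x \<le> R + 1} x :: real)"
    using fin[of "R + 1"] by (intro integrable_mult_right integrable_real_indicator) (auto simp: sets_L)
  have intA: "integrable \<Lambda> (\<lambda>x. \<integral>y. u (x + y) \<partial>N)"
    using le A0 sp by (intro Bochner_Integration.integrable_bound[OF int meas] AE_I2) (auto intro: order_trans[OF le abs_ge_self])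
  have "(\<integral>\<^sup>+x. ennreal (u x) \<partial>convolution_span B \<Lambda> N) = (\<integral>\<^sup>+p. ennreal (u (fst p + snd p)) \<partial>(\<Lambda> \<Otimes>\<^sub>M N))"
    unfolding convolution_span_def by (subst nn_integral_distr) (auto simp: split_beta')
  also have "\<dots> = (\<integral>\<^sup>+x. \<integral>\<^sup>+y. ennreal (u (x + y)) \<partial>N \<partial>\<Lambda>)"
    by (subst N.nn_integral_fst[symmetric]) auto
  also have "\<dots> = (\<integral>\<^sup>+x. ennreal (\<integral>y. u (x + y) \<partial>N) \<partial>\<Lambda>)"
    using nn sp by (intro nn_integral_cong) auto
  also have "\<dots> = ennreal (\<integral>x. (\<integral>y. u (x + y) \<partial>N) \<partial>\<Lambda>)"
    using A0 sp by (intro nn_integral_eq_integral intA AE_I2) auto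
  finally have eq: "(\<integral>\<^sup>+x. ennreal (u x) \<partial>convolution_span B \<Lambda> N) = ennreal (\<integral>x. (\<integral>y. u (x + y) \<partial>N) \<partial>\<Lambda>)" .
  have [measurable]: "u \<in> borel_measurable (convolution_span B \<Lambda> N)"
    by (simp add: convolution_span_def)
  have u0: "AE x in convolution_span B \<Lambda> N. 0 \<le> u x"
    using u(1) by (intro AE_I2) (simp add: convolution_span_def)
  show "integrable (convolution_span B \<Lambda> N) u"
    using eq u0 by (intro integrableI_nonneg) auto
  show "(\<integral>x. u x \<partial>convolution_span B \<Lambda> N) = (\<integral>x. (\<integral>y. u (x + y) \<partial>N) \<partial>\<Lambda>)"
  proof -
    have "0 \<le> (\<integral>x. (\<integral>y. u (x + y) \<partial>N) \<partial>\<Lambda>)"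
      by (rule Bochner_Integration.integral_nonneg) (use A0 sp in auto)
    then show ?thesis
      using integral_eq_nn_integral[OF \<open>u \<in> borel_measurable (convolution_span B \<Lambda> N)\<close> u0] eq by simp
  qed
qed

text \<open>
The convolution with a mollifier has a log-concave density \<open>g\<close>, and \<open>g u\<close>, \<open>g v\<close>, \<open>g w\<close> again satisfy
the hypothesis of the Prekopa--Leindler inequality for Lebesgue measure. As the radius of the mollifier
tends to 0, the integrals of continuous functions of bounded support converge.
\<close>

lemma prekopa_leindler_log_concave_measure:
  fixes u v w :: "'h \<Rightarrow> real"
  assumes lc: "log_concave_measure B \<Lambda>"
    and fin: "\<And>R. emeasure \<Lambda> {x \<in> span B. norm x \<le> R} < \<infinity>"
    and ts: "0 < t" "0 < s" "t + s = 1"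
    and u: "continuous_on (span B) u" "\<And>x. x \<in> span B \<Longrightarrow> 0 \<le> u x \<and> u x \<le> M"
      "\<And>x. x \<in> span B \<Longrightarrow> R < norm x \<Longrightarrow> u x = 0"
    and v: "continuous_on (span B) v" "\<And>x. x \<in> span B \<Longrightarrow> 0 \<le> v x \<and> v x \<le> M"
      "\<And>x. x \<in> span B \<Longrightarrow> R < norm x \<Longrightarrow> v x = 0"
    and w: "continuous_on (span B) w" "\<And>x. x \<in> span B \<Longrightarrow> 0 \<le> w x \<and> w x \<le> M"
      "\<And>x. x \<in> span B \<Longrightarrow> R < norm x \<Longrightarrow> w x = 0"
    and le: "\<And>x y. x \<in> span B \<Longrightarrow> y \<in> span B \<Longrightarrow> u x powr t * v y powr s \<le> w (t *\<^sub>R x + s *\<^sub>R y)"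
  shows "(\<integral>x. u x \<partial>\<Lambda>) powr t * (\<integral>x. v x \<partial>\<Lambda>) powr s \<le> (\<integral>x. w x \<partial>\<Lambda>)"
proof -
  have sets_L: "sets \<Lambda> = sets (borel_span B)" using lc by (simp add: log_concave_measure_def)
  have "\<exists>N. prob_space N \<and> sets N = sets (borel_span B) \<and> (AE y in N. norm y \<le> inverse (real (Suc n))) \<and>
      (\<exists>g. log_concave_fun_on (span B) g \<and> g \<in> borel_measurable (borel_span B) \<and>
           convolution_span B \<Lambda> N = density (lborel_span B) (\<lambda>x. ennreal (g x)))" for n
  proof -
    obtain \<theta> where \<theta>: "log_concave_fun_on (span B) \<theta>" "continuous_on (span B) \<theta>"
      "compact (closure {x \<in> span B. \<theta> x \<noteq> 0})"
      "prob_space (density (lborel_span B) (\<lambda>x. ennreal (\<theta> x)))"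
      "\<And>x. \<theta> x \<noteq> 0 \<Longrightarrow> norm x \<le> inverse (real (Suc n))"
      using log_concave_mollifier[of "inverse (real (Suc n))"] by auto
    then obtain g where g: "log_concave_fun_on (span B) g \<and> g \<in> borel_measurable (borel_span B) \<and>
        convolution_span B \<Lambda> (density (lborel_span B) (\<lambda>x. ennreal (\<theta> x)))
          = density (lborel_span B) (\<lambda>x. ennreal (g x))"
      using lc unfolding log_concave_measure_def by blast
    have [measurable]: "\<theta> \<in> borel_measurable (borel_span B)"
      using \<theta>(2) by (rule continuous_on_measurable)
    have "(\<lambda>x. ennreal (\<theta> x)) \<in> borel_measurable (lborel_span B)"
      by measurable
    then have "AE y in density (lborel_span B) (\<lambda>x. ennreal (\<theta> x)). norm y \<le> inverse (real (Suc n))"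
      using \<theta>(5) by (subst AE_density) (auto simp: ennreal_eq_0_iff intro!: AE_I2)
    then show ?thesis
      using \<theta>(4) g by (intro exI[of _ "density (lborel_span B) (\<lambda>x. ennreal (\<theta> x))"]) auto
  qed
  then obtain N g where N: "\<And>n. prob_space (N n)" "\<And>n. sets (N n) = sets (borel_span B)"
      "\<And>n. AE y in N n. norm y \<le> inverse (real (Suc n))"
    and g: "\<And>n. log_concave_fun_on (span B) (g n)" "\<And>n. g n \<in> borel_measurable (borel_span B)"
      "\<And>n. convolution_span B \<Lambda> (N n) = density (lborel_span B) (\<lambda>x. ennreal (g n x))"
    by metis
  have N1: "AE y in N n. norm y \<le> 1" for n
    using N(3)[of n] by eventually_elim (auto elim!: order_trans simp: inverse_le_1_iff)
  note conv = integral_convolution[OF N(1) N(2) sets_L N1 fin continuous_on_measurable]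
  have g0: "0 \<le> g n x" if "x \<in> span B" for n x
    using g(1) that by (auto simp: log_concave_fun_on_def)
  have dens: "(\<integral>x. f x \<partial>convolution_span B \<Lambda> (N n)) = (\<integral>x. g n x * f x \<partial>lborel_span B)"
    and densi: "integrable (lborel_span B) (\<lambda>x. g n x * f x)"
    if f: "continuous_on (span B) f" "\<And>x. x \<in> span B \<Longrightarrow> 0 \<le> f x \<and> f x \<le> M"
      "\<And>x. x \<in> span B \<Longrightarrow> R < norm x \<Longrightarrow> f x = 0" for n and f :: "'h \<Rightarrow> real"
  proof -
    have [measurable]: "f \<in> borel_measurable (borel_span B)" by (rule continuous_on_measurable) fact
    note [measurable] = g(2)
    show "(\<integral>x. f x \<partial>convolution_span B \<Lambda> (N n)) = (\<integral>x. g n x * f x \<partial>lborel_span B)"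
      unfolding g(3) using g0 by (subst integral_density) auto
    have "integrable (convolution_span B \<Lambda> (N n)) f" by (rule conv(1)[OF f(1)]) (use f in auto)
    then show "integrable (lborel_span B) (\<lambda>x. g n x * f x)"
      unfolding g(3) using g0 by (subst (asm) integrable_density) auto
  qed
  have conv_le: "(\<integral>x. u x \<partial>convolution_span B \<Lambda> (N n)) powr t * (\<integral>x. v x \<partial>convolution_span B \<Lambda> (N n)) powr s
      \<le> (\<integral>x. w x \<partial>convolution_span B \<Lambda> (N n))" for n
  proof -
    have eq: "(\<integral>x. u x \<partial>convolution_span B \<Lambda> (N n)) = (\<integral>x. g n x * u x \<partial>lborel_span B)"
        "(\<integral>x. v x \<partial>convolution_span B \<Lambda> (N n)) = (\<integral>x. g n x * v x \<partial>lborel_span B)"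
        "(\<integral>x. w x \<partial>convolution_span B \<Lambda> (N n)) = (\<integral>x. g n x * w x \<partial>lborel_span B)"
      by (rule dens; use u v w in auto)+
    have int: "integrable (lborel_span B) (\<lambda>x. g n x * u x)" "integrable (lborel_span B) (\<lambda>x. g n x * v x)"
        "integrable (lborel_span B) (\<lambda>x. g n x * w x)"
      by (rule densi; use u v w in auto)+
    show ?thesis
      unfolding eq
    proof (rule prekopa_leindler_span[OF ts int(1) _ int(2) _ int(3)])
      fix x y assume xy: "x \<in> span B" "y \<in> span B"
      let ?z = "t *\<^sub>R x + s *\<^sub>R y"
      have z: "?z \<in> span B" using xy by (intro span_add span_scale)
      have "g n x powr t * g n y powr s \<le> g n ?z"
        using g(1)[of n] xy ts unfolding log_concave_fun_on_def by auto
      then have "(g n x powr t * g n y powr s) * (u x powr t * v y powr s) \<le> g n ?z * w ?z"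
        using le[OF xy] g0[OF z] by (intro mult_mono) auto
      then show "(g n x * u x) powr t * (g n y * v y) powr s \<le> g n ?z * w ?z"
        using g0 u(2) v(2) xy by (simp add: powr_mult mult.assoc mult.left_commute)
    qed (use g0 u(2) v(2) w(2) in auto)
  qed
  have lim: "(\<lambda>n. \<integral>x. f x \<partial>convolution_span B \<Lambda> (N n)) \<longlonglongrightarrow> (\<integral>x. f x \<partial>\<Lambda>)"
    if f: "continuous_on (span B) f" "\<And>x. x \<in> span B \<Longrightarrow> 0 \<le> f x \<and> f x \<le> M"
      "\<And>x. x \<in> span B \<Longrightarrow> R < norm x \<Longrightarrow> f x = 0" for f :: "'h \<Rightarrow> real"
  proof -
    have eq: "(\<integral>x. f x \<partial>convolution_span B \<Lambda> (N n)) = (\<integral>x. (\<integral>y. f (x + y) \<partial>N n) \<partial>\<Lambda>)" for n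
      by (rule conv(2)[OF f(1)]) (use f in auto)
    have sp: "space \<Lambda> = span B" "space (N n) = span B" for n
      using sets_eq_imp_space_eq[OF sets_L] sets_eq_imp_space_eq[OF N(2)] by simp_all
    have "0 \<le> M" using f(2)[OF span_zero] by linarith
    show ?thesis
      unfolding eq
    proof (rule integral_dominated_convergence)
      show "f \<in> borel_measurable \<Lambda>"
        using continuous_on_measurable[OF f(1)] by (simp cong: measurable_cong_sets add: sets_L)
      show "(\<lambda>x. \<integral>y. f (x + y) \<partial>N n) \<in> borel_measurable \<Lambda>" for n
        by (rule conv(4)[OF f(1)]) (use f in auto)
      show "integrable \<Lambda> (\<lambda>x. M * indicator {x \<in> span B. norm x \<le> R + 1} x :: real)"
        by (rule conv(5)[OF f(1)]) (use f in auto)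
      show "AE x in \<Lambda>. norm (\<integral>y. f (x + y) \<partial>N n) \<le> M * indicator {x \<in> span B. norm x \<le> R + 1} x" for n
      proof (rule AE_I2)
        fix x assume "x \<in> space \<Lambda>"
        then have x: "x \<in> span B" using sp by simp
        have "(\<integral>y. f (x + y) \<partial>N n) \<le> M * indicator {x \<in> span B. norm x \<le> R + 1} x"
          by (rule conv(3)[OF f(1) _ _ x]) (use f in auto)
        moreover have "0 \<le> (\<integral>y. f (x + y) \<partial>N n)"
          using f(2) x sp by (intro Bochner_Integration.integral_nonneg) (auto intro: span_add)
        ultimately show "norm (\<integral>y. f (x + y) \<partial>N n) \<le> M * indicator {x \<in> span B. norm x \<le> R + 1} x"
          by simp
      qed
      show "AE x in \<Lambda>. (\<lambda>n. \<integral>y. f (x + y) \<partial>N n) \<longlonglongrightarrow> f x"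
      proof (rule AE_I2, rule LIMSEQ_I)
        fix x and e :: real assume "x \<in> space \<Lambda>" "0 < e"
        then have x: "x \<in> span B" using sp by simp
        obtain d where d: "0 < d" "\<And>y. y \<in> span B \<Longrightarrow> dist y x < d \<Longrightarrow> dist (f y) (f x) < e / 2"
          using f(1) x \<open>0 < e\<close> unfolding continuous_on_iff by (metis half_gt_zero)
        obtain n0 where n0: "inverse (real (Suc n0)) < d" using reals_Archimedean[OF d(1)] by blast
        have "norm ((\<integral>y. f (x + y) \<partial>N n) - f x) < e" if "n0 \<le> n" for n
        proof -
          interpret N: prob_space "N n" by (rule N)
          have "inverse (real (Suc n)) \<le> inverse (real (Suc n0))" using that by (simp add: field_simps)
          with n0 have n: "inverse (real (Suc n)) < d" by linarith
          have "(\<lambda>y. x + y) \<in> N n \<rightarrow>\<^sub>M borel_span B"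
            using measurable_compose[OF measurable_Pair1'[of x "borel_span B" "borel_span B"] add_measurable_span] x
            by (simp cong: measurable_cong_sets add: N(2))
          from measurable_compose[OF this continuous_on_measurable[OF f(1)]]
          have [measurable]: "(\<lambda>y. f (x + y)) \<in> borel_measurable (N n)" .
          have int: "integrable (N n) (\<lambda>y. f (x + y))"
            using f(2)[OF span_add[OF x]] sp \<open>0 \<le> M\<close> by (intro N.integrable_const_bound[of _ M] AE_I2) auto
          have "(\<integral>y. f (x + y) \<partial>N n) - f x = (\<integral>y. f (x + y) - f x \<partial>N n)"
            using int by (simp add: N.prob_space)
          also have "norm \<dots> \<le> (\<integral>y. norm (f (x + y) - f x) \<partial>N n)"
            by (rule integral_norm_bound)
          also have "\<dots> \<le> (\<integral>y. e / 2 \<partial>N n)"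
          proof (rule integral_mono_AE)
            show "AE y in N n. norm (f (x + y) - f x) \<le> e / 2"
              using N(3)[of n] AE_space
            proof eventually_elim
              case (elim y)
              then have "x + y \<in> span B" "dist (x + y) x < d" using x n sp by (auto intro: span_add simp: dist_norm)
              from d(2)[OF this] show ?case by (simp add: dist_real_def)
            qed
          qed (use int in auto)
          also have "\<dots> < e" using \<open>0 < e\<close> by (simp add: N.prob_space)
          finally show ?thesis .
        qed
        then show "\<exists>n0. \<forall>n\<ge>n0. norm ((\<integral>y. f (x + y) \<partial>N n) - f x) < e" by blast
      qed
    qed
  qed
  show ?thesis
  proof (rule LIMSEQ_le)
    show "(\<lambda>n. \<integral>x. w x \<partial>convolution_span B \<Lambda> (N n)) \<longlonglongrightarrow> (\<integral>x. w x \<partial>\<Lambda>)" by (rule lim[OF w])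
    have nonneg: "0 \<le> (\<integral>x. f x \<partial>convolution_span B \<Lambda> (N n))" if "\<And>x. x \<in> span B \<Longrightarrow> 0 \<le> f x" for f :: "'h \<Rightarrow> real" and n
      using that by (intro Bochner_Integration.integral_nonneg) (simp add: convolution_span_def)
    show "(\<lambda>n. (\<integral>x. u x \<partial>convolution_span B \<Lambda> (N n)) powr t * (\<integral>x. v x \<partial>convolution_span B \<Lambda> (N n)) powr s)
        \<longlonglongrightarrow> (\<integral>x. u x \<partial>\<Lambda>) powr t * (\<integral>x. v x \<partial>\<Lambda>) powr s"
      using ts u(2) v(2) by (intro tendsto_mult tendsto_powr' lim[OF u] lim[OF v] tendsto_const) (auto intro!: always_eventually nonneg)
  qed (use conv_le in auto)
qed

section \<open>Super log-concave measures and sup-convolutions\<close>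

text \<open>
The previous lemma is applied to \<open>exp (\<alpha>|x|\<^sup>2/2) \<nu>\<close> and to \<open>u\<close>, \<open>v\<close>, \<open>w\<close> multiplied by
\<open>exp (- \<alpha>|x|\<^sup>2/2)\<close> and by a tent of radius \<open>n + 1\<close>. The tent provides the bounded support, and being
log-concave it preserves the hypothesis; it disappears in the limit of large \<open>n\<close>.
\<close>

lemma prekopa_leindler_super_log_concave:
  fixes u v w :: "'h \<Rightarrow> real"
  assumes slc: "super_log_concave_span \<alpha> B \<nu>" and "finite_measure \<nu>" and \<alpha>: "0 \<le> \<alpha>"
    and ts: "0 < t" "0 < s" "t + s = 1"
    and u: "continuous_on (span B) u" "\<And>x. x \<in> span B \<Longrightarrow> 0 \<le> u x \<and> u x \<le> M"
    and v: "continuous_on (span B) v" "\<And>x. x \<in> span B \<Longrightarrow> 0 \<le> v x \<and> v x \<le> M"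
    and w: "continuous_on (span B) w" "\<And>x. x \<in> span B \<Longrightarrow> 0 \<le> w x \<and> w x \<le> M"
    and le: "\<And>x y. x \<in> span B \<Longrightarrow> y \<in> span B \<Longrightarrow>
      u x powr t * v y powr s * exp (- (\<alpha> / 2 * (t * s * (norm (x - y))\<^sup>2))) \<le> w (t *\<^sub>R x + s *\<^sub>R y)"
  shows "(\<integral>x. u x \<partial>\<nu>) powr t * (\<integral>x. v x \<partial>\<nu>) powr s \<le> (\<integral>x. w x \<partial>\<nu>)"
proof -
  interpret finite_measure \<nu> by fact
  define E where "E x = exp (\<alpha> / 2 * (norm x)\<^sup>2)" for x :: 'h
  define E' where "E' x = exp (- (\<alpha> / 2 * (norm x)\<^sup>2))" for x :: 'h
  have EE': "E x * E' x = 1" for x by (simp add: E_def E'_def flip: exp_add)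
  have E_nonneg: "0 \<le> E x" for x by (simp add: E_def)
  have E'_le: "0 < E' x" "E' x \<le> 1" for x using \<alpha> by (auto simp: E'_def)
  have contE: "continuous_on (span B) E" "continuous_on (span B) E'"
    unfolding E_def[abs_def] E'_def[abs_def] by (intro continuous_intros; simp)+
  have sets_nu [measurable_cong]: "sets \<nu> = sets (borel_span B)"
    and lc: "log_concave_measure B (density \<nu> (\<lambda>x. ennreal (E x)))"
    using slc by (auto simp: super_log_concave_span_def E_def)
  have sp: "space \<nu> = span B" using sets_eq_imp_space_eq[OF sets_nu] by simp
  have [measurable]: "E \<in> borel_measurable (borel_span B)" "E' \<in> borel_measurable (borel_span B)"
    by (intro continuous_on_measurable contE)+
  let ?L = "density \<nu> (\<lambda>x. ennreal (E x))"
  have fin: "emeasure ?L {x \<in> span B. norm x \<le> R} < \<infinity>" for R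
  proof -
    have [measurable]: "{x \<in> span B. norm x \<le> R} \<in> sets (borel_span B)"
      by (auto simp: sets_restrict_space intro!: image_eqI[of _ _ "{x. norm x \<le> R}"])
    have "emeasure ?L {x \<in> span B. norm x \<le> R} = (\<integral>\<^sup>+x. ennreal (E x) * indicator {x \<in> span B. norm x \<le> R} x \<partial>\<nu>)"
      by (intro emeasure_density) (auto simp: sets_nu)
    also have "\<dots> \<le> (\<integral>\<^sup>+x. ennreal (exp (\<alpha> / 2 * R\<^sup>2)) \<partial>\<nu>)"
      using \<alpha> by (intro nn_integral_mono)
        (auto simp: E_def indicator_def intro!: ennreal_leI mult_left_mono power_mono)
    also have "\<dots> < \<infinity>"
      using emeasure_finite[of "space \<nu>"]
      by (simp add: ennreal_mult_eq_top_iff less_top[symmetric])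
    finally show ?thesis .
  qed
  have "0 \<le> M" using u(2)[OF span_zero] by linarith
  define \<kappa> where "\<kappa> n x = tent (real (Suc n)) x" for n and x :: 'h
  have \<kappa>: "0 \<le> \<kappa> n x" "\<kappa> n x \<le> 1" for n x
    using tent_bounds[of "real (Suc n)" x] by (auto simp: \<kappa>_def)
  have eq: "(\<integral>x. f x * \<kappa> n x * E' x \<partial>?L) = (\<integral>x. f x * \<kappa> n x \<partial>\<nu>)"
    if "continuous_on (span B) f" for f n
  proof -
    have [measurable]: "f \<in> borel_measurable (borel_span B)" "\<kappa> n \<in> borel_measurable (borel_span B)"
      unfolding \<kappa>_def[abs_def] by (intro continuous_on_measurable continuous_on_tent that)+
    have "(\<integral>x. f x * \<kappa> n x * E' x \<partial>?L) = (\<integral>x. E x *\<^sub>R (f x * \<kappa> n x * E' x) \<partial>\<nu>)"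
      using E_nonneg by (intro integral_density) auto
    also have "(\<lambda>x. E x *\<^sub>R (f x * \<kappa> n x * E' x)) = (\<lambda>x. f x * \<kappa> n x * (E x * E' x))"
      by (simp add: fun_eq_iff)
    finally show ?thesis by (simp add: EE')
  qed
  have cut: "(\<integral>x. u x * \<kappa> n x \<partial>\<nu>) powr t * (\<integral>x. v x * \<kappa> n x \<partial>\<nu>) powr s \<le> (\<integral>x. w x * \<kappa> n x \<partial>\<nu>)" for n
    unfolding eq[OF u(1), symmetric] eq[OF v(1), symmetric] eq[OF w(1), symmetric]
  proof (rule prekopa_leindler_log_concave_measure[OF lc fin ts, where R = "real (Suc n)" and M = M])
    have cont: "continuous_on (span B) (\<lambda>x. f x * \<kappa> n x * E' x)" if "continuous_on (span B) f" for f
      unfolding \<kappa>_def by (intro continuous_on_mult that continuous_on_tent contE)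
    show "continuous_on (span B) (\<lambda>x. u x * \<kappa> n x * E' x)" "continuous_on (span B) (\<lambda>x. v x * \<kappa> n x * E' x)"
      "continuous_on (span B) (\<lambda>x. w x * \<kappa> n x * E' x)"
      by (intro cont u v w)+
    have bd: "0 \<le> f x * \<kappa> n x * E' x \<and> f x * \<kappa> n x * E' x \<le> M" if "0 \<le> f x \<and> f x \<le> M" for f x
      using that \<kappa>[of n x] E'_le[of x] mult_mono[of "f x * \<kappa> n x" M "E' x" 1] mult_mono[of "f x" M "\<kappa> n x" 1] \<open>0 \<le> M\<close>
      by auto
    show "0 \<le> u x * \<kappa> n x * E' x \<and> u x * \<kappa> n x * E' x \<le> M" "0 \<le> v x * \<kappa> n x * E' x \<and> v x * \<kappa> n x * E' x \<le> M"
      "0 \<le> w x * \<kappa> n x * E' x \<and> w x * \<kappa> n x * E' x \<le> M" if "x \<in> span B" for x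
      using bd[of u x, OF u(2)[OF that]] bd[of v x, OF v(2)[OF that]] bd[of w x, OF w(2)[OF that]] by blast+
    have z: "\<kappa> n x = 0" if "real (Suc n) < norm x" for x
      using that tent_eq_0[of "real (Suc n)" x] by (simp add: \<kappa>_def)
    show "u x * \<kappa> n x * E' x = 0" "v x * \<kappa> n x * E' x = 0" "w x * \<kappa> n x * E' x = 0" if "real (Suc n) < norm x" for x
      using z[OF that] by simp_all
    fix x y assume xy: "x \<in> span B" "y \<in> span B"
    let ?z = "t *\<^sub>R x + s *\<^sub>R y"
    have z: "?z \<in> span B" using xy by (intro span_add span_scale)
    have \<kappa>_lc: "\<kappa> n x powr t * \<kappa> n y powr s \<le> \<kappa> n ?z"
    proof -
      have "log_concave_fun_on UNIV (\<kappa> n)"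
        unfolding \<kappa>_def[abs_def] tent_def[abs_def] using tent_concave[of "real (Suc n)"] by (intro log_concave_fun_on_max_0) auto
      then show ?thesis using ts unfolding log_concave_fun_on_def by auto
    qed
    have "E' x powr t * E' y powr s = exp (- (\<alpha> / 2 * (t * (norm x)\<^sup>2 + s * (norm y)\<^sup>2)))"
      by (simp add: E'_def powr_def algebra_simps flip: exp_add)
    also have "\<dots> = E' ?z * exp (- (\<alpha> / 2 * (t * s * (norm (x - y))\<^sup>2)))"
      unfolding convex_combination_norm_sq[OF ts(3)] E'_def exp_add[symmetric]
      by (simp add: algebra_simps)
    finally have E'_eq: "E' x powr t * E' y powr s = E' ?z * exp (- (\<alpha> / 2 * (t * s * (norm (x - y))\<^sup>2)))" .
    have "(u x * \<kappa> n x * E' x) powr t * (v y * \<kappa> n y * E' y) powr s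
        = (u x powr t * v y powr s) * (\<kappa> n x powr t * \<kappa> n y powr s) * (E' x powr t * E' y powr s)"
      using u(2)[OF xy(1)] v(2)[OF xy(2)] \<kappa> E'_le(1)[THEN less_imp_le] by (simp add: powr_mult)
    also have "\<dots> = (u x powr t * v y powr s * exp (- (\<alpha> / 2 * (t * s * (norm (x - y))\<^sup>2)))) * (\<kappa> n x powr t * \<kappa> n y powr s) * E' ?z"
      unfolding E'_eq by simp
    also have "\<dots> \<le> w ?z * \<kappa> n ?z * E' ?z"
      using le[OF xy] \<kappa>_lc w(2)[OF z] E'_le(1)[of ?z] by (intro mult_right_mono mult_mono) auto
    finally show "(u x * \<kappa> n x * E' x) powr t * (v y * \<kappa> n y * E' y) powr s \<le> w ?z * \<kappa> n ?z * E' ?z" .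
  qed
  have lim: "(\<lambda>n. \<integral>x. f x * \<kappa> n x \<partial>\<nu>) \<longlonglongrightarrow> (\<integral>x. f x \<partial>\<nu>)"
    if f: "continuous_on (span B) f" "\<And>x. x \<in> span B \<Longrightarrow> 0 \<le> f x \<and> f x \<le> M" for f
  proof (rule integral_dominated_convergence)
    have [measurable]: "f \<in> borel_measurable (borel_span B)" "\<kappa> n \<in> borel_measurable (borel_span B)" for n
      unfolding \<kappa>_def[abs_def] by (intro continuous_on_measurable continuous_on_tent f)+
    show "f \<in> borel_measurable \<nu>" "(\<lambda>x. f x * \<kappa> n x) \<in> borel_measurable \<nu>" for n
      by measurable
    show "integrable \<nu> (\<lambda>_. M)" by simp
    show "AE x in \<nu>. norm (f x * \<kappa> n x) \<le> M" for n
    proof (rule AE_I2)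
      fix x assume "x \<in> space \<nu>"
      then show "norm (f x * \<kappa> n x) \<le> M"
        using f(2)[of x] sp \<kappa>[of n x] mult_mono[of "f x" M "\<kappa> n x" 1] \<open>0 \<le> M\<close> by (simp add: abs_mult)
    qed
    have "(\<lambda>n. \<kappa> n x) \<longlonglongrightarrow> 1" for x
    proof -
      have "(\<lambda>n. max 0 (1 - norm x * inverse (real (Suc n)))) \<longlonglongrightarrow> max 0 (1 - norm x * 0)"
        by (intro tendsto_intros LIMSEQ_inverse_real_of_nat)
      then show ?thesis unfolding \<kappa>_def tent_def divide_inverse by simp
    qed
    then show "AE x in \<nu>. (\<lambda>n. f x * \<kappa> n x) \<longlonglongrightarrow> f x"
      by (intro AE_I2) (metis mult.right_neutral tendsto_mult_left)
  qed
  show ?thesis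
  proof (rule LIMSEQ_le)
    show "(\<lambda>n. \<integral>x. w x * \<kappa> n x \<partial>\<nu>) \<longlonglongrightarrow> (\<integral>x. w x \<partial>\<nu>)" by (rule lim; use w in auto)
    have nonneg: "0 \<le> (\<integral>x. f x * \<kappa> n x \<partial>\<nu>)" if "\<And>x. x \<in> span B \<Longrightarrow> 0 \<le> f x \<and> f x \<le> M" for f n
      using that sp \<kappa> by (intro Bochner_Integration.integral_nonneg) simp
    have l: "(\<lambda>n. \<integral>x. u x * \<kappa> n x \<partial>\<nu>) \<longlonglongrightarrow> (\<integral>x. u x \<partial>\<nu>)" "(\<lambda>n. \<integral>x. v x * \<kappa> n x \<partial>\<nu>) \<longlonglongrightarrow> (\<integral>x. v x \<partial>\<nu>)"
      by (rule lim; use u v in auto)+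
    show "(\<lambda>n. (\<integral>x. u x * \<kappa> n x \<partial>\<nu>) powr t * (\<integral>x. v x * \<kappa> n x \<partial>\<nu>) powr s)
        \<longlonglongrightarrow> (\<integral>x. u x \<partial>\<nu>) powr t * (\<integral>x. v x \<partial>\<nu>) powr s"
      using ts u(2) v(2) by (intro tendsto_mult tendsto_powr' l tendsto_const) (auto intro!: always_eventually nonneg)
  qed (use cut in auto)
qed

text \<open>
The case \<open>u = exp (g / t)\<close>, \<open>v = 1\<close>, \<open>w = exp (g + q)\<close>: the point \<open>x\<close> is \<open>z + s (x - y)\<close> when
\<open>z = t x + s y\<close>, so the hypothesis of Prekopa--Leindler is a bound on increments of \<open>g\<close>.
\<close>

lemma exp_prekopa_leindler:
  fixes g q :: "'h \<Rightarrow> real"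
  assumes slc: "super_log_concave_span \<alpha> B \<nu>" and "prob_space \<nu>" and \<alpha>: "0 \<le> \<alpha>"
    and ts: "0 < t" "0 < s" "t + s = 1"
    and g: "continuous_on UNIV g" "\<And>x. \<bar>g x\<bar> \<le> K"
    and q: "continuous_on UNIV q" "\<And>x. \<bar>q x\<bar> \<le> K"
    and gq: "\<And>z h. g (z + s *\<^sub>R h) \<le> g z + q z + \<alpha> / 2 * (t * s * (norm h)\<^sup>2)"
  shows "(\<integral>x. exp (g x / t) \<partial>\<nu>) powr t \<le> (\<integral>x. exp (g x + q x) \<partial>\<nu>)"
proof -
  interpret prob_space \<nu> by fact
  have "0 \<le> K" using g(2)[of 0] by linarith
  define M where "M = max (exp (K / t)) (exp (2 * K))"
  have cont: "continuous_on (span B) g" "continuous_on (span B) q" using g q by (auto intro: continuous_on_subset)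
  have "(\<integral>x. exp (g x / t) \<partial>\<nu>) powr t * (\<integral>x. 1 \<partial>\<nu>) powr s \<le> (\<integral>x. exp (g x + q x) \<partial>\<nu>)"
  proof (rule prekopa_leindler_super_log_concave[OF slc finite_measure_axioms \<alpha> ts, where M = M])
    show "continuous_on (span B) (\<lambda>x. exp (g x / t))" "continuous_on (span B) (\<lambda>x. exp (g x + q x))"
      using ts by (intro continuous_intros cont; simp)+
    have gt: "g x / t \<le> K / t" for x using g(2)[of x] ts by (intro divide_right_mono) auto
    show "0 \<le> exp (g x / t) \<and> exp (g x / t) \<le> M" for x using gt[of x] by (auto simp: M_def le_max_iff_disj)
    show "0 \<le> (1::real) \<and> 1 \<le> M" using \<open>0 \<le> K\<close> by (auto simp: M_def le_max_iff_disj)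
    have "g x + q x \<le> 2 * K" for x using g(2)[of x] q(2)[of x] by linarith
    then show "0 \<le> exp (g x + q x) \<and> exp (g x + q x) \<le> M" for x by (auto simp: M_def le_max_iff_disj)
    fix x y :: 'h
    let ?z = "t *\<^sub>R x + s *\<^sub>R y"
    have x: "?z + s *\<^sub>R (x - y) = x"
    proof -
      have "?z + s *\<^sub>R (x - y) = (t + s) *\<^sub>R x" by (simp add: algebra_simps)
      then show ?thesis using ts by simp
    qed
    have "exp (g x / t) powr t * 1 powr s * exp (- (\<alpha> / 2 * (t * s * (norm (x - y))\<^sup>2)))
        = exp (g x - \<alpha> / 2 * (t * s * (norm (x - y))\<^sup>2))"
      using ts by (simp add: powr_def flip: exp_add)
    also have "\<dots> \<le> exp (g ?z + q ?z)"
      using gq[of ?z "x - y"] unfolding x by simp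
    finally show "exp (g x / t) powr t * 1 powr s * exp (- (\<alpha> / 2 * (t * s * (norm (x - y))\<^sup>2))) \<le> exp (g ?z + q ?z)" .
  qed auto
  then show ?thesis by (simp add: prob_space)
qed

end

text \<open>
By the mean value theorem the increment of \<open>g\<close> is \<open>s\<close> times the inner product of \<open>h\<close> with the gradient
at an intermediate point. For large \<open>h\<close> the bound \<open>C\<close> on the gradient suffices, as the quadratic
penalty wins. For bounded \<open>h\<close> and small \<open>s\<close> the intermediate point is close to \<open>z\<close>, so that uniform
continuity replaces the gradient there by that at \<open>z\<close>, with an error absorbed in \<open>\<delta>\<close>; it remains to
complete the square. That \<open>s0\<close> depends on \<open>g\<close> only and not on a finite-dimensional subspace is what
makes the limit in the dimension possible.
\<close>
lemma sup_convolution_bound: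
  fixes g :: "'h::real_inner \<Rightarrow> real" and D :: "'h \<Rightarrow> 'h"
  assumes deriv: "\<And>z. (g has_derivative (\<lambda>h. inner (D z) h)) (at z)"
    and C: "\<And>z. norm (D z) \<le> C"
    and unif: "uniformly_continuous_on UNIV D"
    and \<alpha>: "0 < \<alpha>" and \<delta>: "0 < \<delta>"
  obtains s0 where "0 < s0" "s0 \<le> 1/2"
    "\<And>s z h. 0 < s \<Longrightarrow> s < s0 \<Longrightarrow>
       g (z + s *\<^sub>R h) \<le> g z + s * ((norm (D z))\<^sup>2 / (2 * \<alpha> * (1 - s)) + \<delta>) + \<alpha> / 2 * ((1 - s) * s * (norm h)\<^sup>2)"
proof -
  have "0 \<le> C" using C[of 0] norm_ge_zero by (rule order_trans[rotated])
  \<comment> \<open>Beyond the radius \<open>4 C / \<alpha>\<close> the penalty wins, as \<open>1 - s \<ge> 1/2\<close>; the summand 1 makes \<open>M\<close> positive.\<close>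
  define M where "M = 4 * C / \<alpha> + 1"
  have "0 < M" using \<open>0 \<le> C\<close> \<alpha> by (auto simp: M_def intro!: add_nonneg_pos)
  obtain \<eta> where \<eta>: "0 < \<eta>" "\<And>z z'. dist z' z < \<eta> \<Longrightarrow> dist (D z') (D z) < \<delta> / M"
    using unif \<delta> \<open>0 < M\<close> unfolding uniformly_continuous_on_def by (metis UNIV_I divide_pos_pos)
  show thesis
  proof (rule that[of "min (1/2) (\<eta> / M)"])
    show "0 < min (1/2) (\<eta> / M)" using \<eta> \<open>0 < M\<close> by simp
    show "min (1/2) (\<eta> / M) \<le> 1/2" by (rule min.cobounded1)
    fix s z h assume s: "0 < s" "s < min (1/2) (\<eta> / M)"
    define t where "t = 1 - s"
    have t: "1/2 \<le> t" "0 < t" using s by (auto simp: t_def)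
    have "\<exists>x\<in>{0..1}. g (z + 1 *\<^sub>R (s *\<^sub>R h)) - g (z + 0 *\<^sub>R (s *\<^sub>R h)) = (\<lambda>r. inner (D (z + x *\<^sub>R (s *\<^sub>R h))) (r *\<^sub>R (s *\<^sub>R h))) (1 - 0)"
    proof (rule mvt_very_simple)
      fix x :: real
      have "((\<lambda>x. g (z + x *\<^sub>R (s *\<^sub>R h))) has_derivative (\<lambda>r. inner (D (z + x *\<^sub>R (s *\<^sub>R h))) (r *\<^sub>R (s *\<^sub>R h)))) (at x)"
        by (rule has_derivative_compose[OF _ deriv]) (auto intro!: derivative_eq_intros)
      then show "((\<lambda>x. g (z + x *\<^sub>R (s *\<^sub>R h))) has_derivative (\<lambda>r. inner (D (z + x *\<^sub>R (s *\<^sub>R h))) (r *\<^sub>R (s *\<^sub>R h)))) (at x within {0..1})"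
        by (rule has_derivative_at_withinI)
    qed simp
    then obtain x where x: "0 \<le> x" "x \<le> 1" "g (z + s *\<^sub>R h) - g z = s * inner (D (z + (x * s) *\<^sub>R h)) h"
      by auto
    let ?\<zeta> = "z + (x * s) *\<^sub>R h"
    have nonneg: "0 \<le> (norm (D z))\<^sup>2 / (2 * \<alpha> * t)" using \<alpha> t by simp
    have "inner (D ?\<zeta>) h \<le> (norm (D z))\<^sup>2 / (2 * \<alpha> * t) + \<delta> + \<alpha> / 2 * (t * (norm h)\<^sup>2)"
    proof (cases "M \<le> norm h")
      case True
      have "inner (D ?\<zeta>) h \<le> norm (D ?\<zeta>) * norm h" by (rule norm_cauchy_schwarz)
      also have "\<dots> \<le> C * norm h" by (intro mult_right_mono C) auto
      also have "\<dots> \<le> (\<alpha> / 4 * norm h) * norm h"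
      proof (rule mult_right_mono)
        have "4 * C / \<alpha> \<le> norm h" using True by (simp add: M_def)
        then show "C \<le> \<alpha> / 4 * norm h" using \<alpha> by (simp add: field_simps)
      qed simp
      also have "\<dots> = \<alpha> / 2 * (1/2 * (norm h)\<^sup>2)" by (simp add: power2_eq_square)
      also have "\<dots> \<le> \<alpha> / 2 * (t * (norm h)\<^sup>2)"
        using t \<alpha> by (intro mult_left_mono mult_right_mono) auto
      finally show ?thesis using nonneg \<delta> by linarith
    next
      case False
      have "x * s * norm h \<le> s * M"
        using x s False \<open>0 < M\<close> mult_mono[of "x * s" s "norm h" M] mult_left_le_one_le[of s x] by auto
      also have "\<dots> < \<eta>" using s \<open>0 < M\<close> by (simp add: field_simps)
      finally have "dist ?\<zeta> z < \<eta>" using x s by (simp add: dist_norm)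
      then have d: "norm (D ?\<zeta> - D z) < \<delta> / M" using \<eta>(2) by (simp add: dist_norm)
      have "inner (D ?\<zeta>) h = inner (D z) h + inner (D ?\<zeta> - D z) h" by (simp add: inner_diff_left)
      also have "\<dots> \<le> norm (D z) * norm h + norm (D ?\<zeta> - D z) * norm h"
        by (intro add_mono norm_cauchy_schwarz)
      also have "norm (D ?\<zeta> - D z) * norm h \<le> \<delta> / M * M"
        using d False \<delta> \<open>0 < M\<close> by (intro mult_mono) auto
      also have "norm (D z) * norm h \<le> (norm (D z))\<^sup>2 / (2 * \<alpha> * t) + \<alpha> / 2 * (t * (norm h)\<^sup>2)"
      proof -
        have "0 \<le> (norm (D z) - \<alpha> * t * norm h)\<^sup>2 / (2 * \<alpha> * t)" using \<alpha> t by simp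
        also have "\<dots> = (norm (D z))\<^sup>2 / (2 * \<alpha> * t) + \<alpha> / 2 * (t * (norm h)\<^sup>2) - norm (D z) * norm h"
          using \<alpha> t by (simp add: field_simps power2_eq_square)
        finally show ?thesis by simp
      qed
      finally show ?thesis using \<open>0 < M\<close> by simp
    qed
    then have "s * inner (D ?\<zeta>) h \<le> s * ((norm (D z))\<^sup>2 / (2 * \<alpha> * t) + \<delta> + \<alpha> / 2 * (t * (norm h)\<^sup>2))"
      using s by (intro mult_left_mono) auto
    then show "g (z + s *\<^sub>R h) \<le> g z + s * ((norm (D z))\<^sup>2 / (2 * \<alpha> * (1 - s)) + \<delta>) + \<alpha> / 2 * ((1 - s) * s * (norm h)\<^sup>2)"
      using x(3) unfolding t_def[symmetric] by (simp add: algebra_simps)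
  qed
qed

section \<open>Riesz representation\<close>

lemma continuous_linear_imp_bounded_linear:
  fixes L :: "'a::real_normed_vector \<Rightarrow> real"
  assumes "linear L" "continuous_on UNIV L"
  shows "bounded_linear L"
proof -
  interpret linear L by fact
  obtain d where d: "0 < d" "\<And>v. dist v 0 < d \<Longrightarrow> dist (L v) (L 0) < 1"
    using assms(2) unfolding continuous_on_iff by (metis UNIV_I zero_less_one)
  have "norm (L v) \<le> norm v * (2 / d)" for v
  proof (cases "v = 0")
    case True
    then show ?thesis by (simp add: zero)
  next
    case False
    define c where "c = d / (2 * norm v)"
    have "0 < c" using False d by (simp add: c_def)
    have "dist (c *\<^sub>R v) 0 < d" using False d by (simp add: c_def)
    from d(2)[OF this] have "c * norm (L v) < 1" using \<open>0 < c\<close> by (simp add: zero scale abs_mult)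
    then show ?thesis using False d by (simp add: c_def field_simps)
  qed
  then show ?thesis by unfold_locales blast
qed

text \<open>
The representing vector is the orthonormal series with coefficients \<open>L (e i)\<close>. Its partial sums are
bounded by the norm of \<open>L\<close>, since their squared norm is their image under \<open>L\<close>; hence the coefficients
are square summable and the series converges. Both functionals agree on the \<open>e i\<close>, so by density
everywhere.
\<close>

lemma riesz_representation:
  fixes e :: "nat \<Rightarrow> 'h::{real_inner, banach}" and L :: "'h \<Rightarrow> real"
  assumes e: "complete_orthonormal e" and L: "bounded_linear L"
  shows "\<exists>h. \<forall>v. L v = inner h v"
proof -
  interpret L: bounded_linear L by fact
  have on: "inner (e i) (e k) = (if i = k then 1 else 0)" for i k
    using e by (simp add: complete_orthonormal_def)
  define a where "a i = L (e i)" for i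
  have pyth: "(norm (\<Sum>i\<in>I. a i *\<^sub>R e i))\<^sup>2 = (\<Sum>i\<in>I. (a i)\<^sup>2)" if "finite I" for I
    using that by (subst norm_sum_Pythagorean)
      (auto simp: pairwise_def orthogonal_def on norm_eq_sqrt_inner power_mult_distrib)
  obtain K where K: "0 < K" "\<And>v. norm (L v) \<le> norm v * K" using L.pos_bounded by blast
  have "(\<Sum>i<n. (a i)\<^sup>2) \<le> K\<^sup>2" for n
  proof -
    let ?h = "\<Sum>i<n. a i *\<^sub>R e i"
    have "(norm ?h)\<^sup>2 = L ?h"
      by (subst pyth) (simp_all add: L.sum L.scale a_def power2_eq_square)
    also have "\<dots> \<le> norm ?h * K" using K(2)[of ?h] by simp
    finally have "norm ?h * norm ?h \<le> norm ?h * K" by (simp only: power2_eq_square)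
    then have "norm ?h \<le> K" using K(1) by (metis less_imp_le mult_le_cancel_left_pos norm_ge_zero order_le_less)
    then have "(norm ?h)\<^sup>2 \<le> K\<^sup>2" by (intro power_mono) auto
    then show ?thesis by (subst (asm) pyth) auto
  qed
  then have sq: "summable (\<lambda>i. (a i)\<^sup>2)" by (intro summableI_nonneg_bounded) auto
  have "summable (\<lambda>i. a i *\<^sub>R e i)"
    unfolding summable_Cauchy
  proof (intro allI impI)
    fix r :: real assume "0 < r"
    then obtain N where N: "\<And>m n. N \<le> m \<Longrightarrow> norm (\<Sum>i\<in>{m..<n}. (a i)\<^sup>2) < r\<^sup>2"
      using sq unfolding summable_Cauchy by (metis zero_less_power)
    have "norm (\<Sum>i\<in>{m..<n}. a i *\<^sub>R e i) < r" if "N \<le> m" for m n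
      using N[OF that, of n] \<open>0 < r\<close> pyth[of "{m..<n}"]
      by (intro power_less_imp_less_base[of _ 2 r]) (simp_all only: pyth finite_atLeastLessThan, auto)
    then show "\<exists>N. \<forall>m\<ge>N. \<forall>n. norm (\<Sum>i\<in>{m..<n}. a i *\<^sub>R e i) < r" by blast
  qed
  then have lim: "(\<lambda>n. \<Sum>i<n. a i *\<^sub>R e i) \<longlonglongrightarrow> (\<Sum>i. a i *\<^sub>R e i)" by (rule summable_LIMSEQ)
  define h where "h = (\<Sum>i. a i *\<^sub>R e i)"
  have coord: "inner h (e j) = a j" for j
  proof (rule LIMSEQ_unique)
    show "(\<lambda>n. inner (\<Sum>i<n. a i *\<^sub>R e i) (e j)) \<longlonglongrightarrow> inner h (e j)"
      unfolding h_def by (intro tendsto_inner lim tendsto_const)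
    have "inner (\<Sum>i<n. a i *\<^sub>R e i) (e j) = a j" if "Suc j \<le> n" for n
    proof -
      have "inner (\<Sum>i<n. a i *\<^sub>R e i) (e j) = (\<Sum>i<n. if i = j then a i else 0)"
        unfolding inner_sum_left by (intro sum.cong) (auto simp: on)
      then show ?thesis using that by simp
    qed
    then show "(\<lambda>n. inner (\<Sum>i<n. a i *\<^sub>R e i) (e j)) \<longlonglongrightarrow> a j"
      by (intro tendsto_eventually eventually_sequentiallyI[of "Suc j"])
  qed
  have "L v = inner h v" if "v \<in> span (range e)" for v
    using that
  proof (induction rule: span_induct_alt)
    case base
    then show ?case by (simp add: L.zero)
  next
    case (step c x y)
    then show ?case using coord by (auto simp: L.add L.scale inner_add_right a_def)
  qed
  then have "span (range e) \<subseteq> {v. L v = inner h v}" by blast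
  moreover have "closed {v. L v = inner h v}"
    by (intro closed_Collect_eq L.continuous_on continuous_intros)
  ultimately have "closure (span (range e)) \<subseteq> {v. L v = inner h v}" by (rule closure_minimal)
  then show ?thesis using e by (auto simp: complete_orthonormal_def)
qed

text \<open>
The definite description in the definition of \<open>dual_to_H\<close> denotes: a representing vector exists by
Riesz, and the difference of two of them is orthogonal to itself.
\<close>

lemma dual_to_H_eq:
  fixes \<iota> :: "'h::{real_inner, banach} \<Rightarrow> 'e::frechet_space"
    and e :: "nat \<Rightarrow> 'h"
  assumes "complete_orthonormal e" and \<iota>: "dense_injection \<iota>" and l: "l \<in> continuous_dual"
  shows "l (\<iota> v) = inner (dual_to_H \<iota> l) v"
proof -
  have "linear (l \<circ> \<iota>)"
    using \<iota> l by (auto simp: dense_injection_def continuous_dual_def intro!: linear_compose)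
  moreover have "continuous_on UNIV (l \<circ> \<iota>)"
    using \<iota> l unfolding dense_injection_def continuous_dual_def comp_def
    by (auto intro: continuous_on_compose2[of UNIV l UNIV \<iota>])
  ultimately have "bounded_linear (l \<circ> \<iota>)" by (rule continuous_linear_imp_bounded_linear)
  from riesz_representation[OF assms(1) this] obtain h where h: "\<And>v. l (\<iota> v) = inner h v"
    by auto
  have "dual_to_H \<iota> l = h"
    unfolding dual_to_H_def
  proof (rule the_equality)
    show "\<forall>v. l (\<iota> v) = inner h v" using h by simp
    fix h' assume "\<forall>v. l (\<iota> v) = inner h' v"
    then have "inner (h' - h) (h' - h) = 0" using h by (simp add: inner_diff_left)
    then show "h' = h" by simp
  qed
  then show ?thesis using h by simp
qed

section \<open>Entropy as a derivative\<close>

text \<open>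
The right-hand side minus the left-hand side of the assumed inequality vanishes at \<open>s = 0\<close> and is
nonnegative for small \<open>s > 0\<close>, so its derivative at 0, which is the difference of the two sides of the
claim up to \<open>\<delta>\<close>, is nonnegative. To avoid differentiating under the integral, both sides are first
replaced by elementary functions of \<open>s\<close> with the same derivative at 0, using \<open>1 + r \<le> exp r\<close> on the
left and \<open>exp r \<le> 1 + r + r\<^sup>2\<close> for \<open>0 \<le> r \<le> 1\<close> on the right.
\<close>

lemma entropy_le_of_power_means:
  fixes g q :: "'a \<Rightarrow> real"
  assumes "prob_space M" and [measurable]: "g \<in> borel_measurable M" "q \<in> borel_measurable M"
    and g: "\<And>x. \<bar>g x\<bar> \<le> K" and q: "\<And>x. 0 \<le> q x \<and> q x \<le> K"
    and le: "\<And>\<delta>. 0 < \<delta> \<Longrightarrow> \<exists>s0>0. \<forall>s. 0 < s \<and> s < s0 \<longrightarrow>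
      (\<integral>x. exp (g x / (1 - s)) \<partial>M) powr (1 - s) \<le> (\<integral>x. exp (g x + s * (q x / (1 - s) + \<delta>)) \<partial>M)"
  shows "(\<integral>x. g x * exp (g x) \<partial>M) - (\<integral>x. exp (g x) \<partial>M) * ln (\<integral>x. exp (g x) \<partial>M) \<le> (\<integral>x. q x * exp (g x) \<partial>M)"
proof -
  interpret prob_space M by fact
  define Z where "Z = (\<integral>x. exp (g x) \<partial>M)"
  define A where "A = (\<integral>x. g x * exp (g x) \<partial>M)"
  define Q where "Q = (\<integral>x. q x * exp (g x) \<partial>M)"
  have "0 \<le> K" using g[of undefined] by linarith
  have eK: "exp (- K) \<le> exp (g x)" "exp (g x) \<le> exp K" for x using g[of x] by auto
  have int: "integrable M (\<lambda>x. exp (g x))" "integrable M (\<lambda>x. g x * exp (g x))" "integrable M (\<lambda>x. q x * exp (g x))"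
    using eK(2) g q \<open>0 \<le> K\<close>
    by (intro integrable_const_bound[of _ "exp K"] integrable_const_bound[of _ "K * exp K"] AE_I2;
        auto simp: abs_mult intro!: mult_mono)+
  have "0 < exp (- K)" by simp
  also have "\<dots> = (\<integral>x. exp (- K) \<partial>M)" by (simp add: prob_space)
  also have "\<dots> \<le> Z" unfolding Z_def using eK int by (intro integral_mono) auto
  finally have "0 < Z" .
  have *: "A - Z * ln Z \<le> Q + \<delta> * Z" if "0 < \<delta>" "\<delta> \<le> 1" for \<delta>
  proof (rule ccontr)
    assume neg: "\<not> A - Z * ln Z \<le> Q + \<delta> * Z"
    \<comment> \<open>A bound for \<open>q / (1 - s) + \<delta>\<close> when \<open>s \<le> 1/2\<close> and \<open>\<delta> \<le> 1\<close>.\<close>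
    define P where "P = 2 * K + 1"
    define F where "F s = Z + s / (1 - s) * Q + s * \<delta> * Z + s\<^sup>2 * P\<^sup>2 * Z - (Z + s / (1 - s) * A) powr (1 - s)" for s :: real
    have deriv: "(F has_real_derivative (Q + \<delta> * Z - (A - Z * ln Z))) (at 0)"
    proof -
      have "((\<lambda>s. Z + s / (1 - s) * A) has_real_derivative A) (at 0)"
        "((\<lambda>s. 1 - s) has_real_derivative (- 1)) (at 0)"
        by (auto intro!: derivative_eq_intros)
      from DERIV_powr[OF this(1) _ this(2)] \<open>0 < Z\<close>
      have "((\<lambda>s. (Z + s / (1 - s) * A) powr (1 - s)) has_real_derivative (A - Z * ln Z)) (at 0)"
        by (simp add: algebra_simps)
      moreover have "((\<lambda>s. Z + s / (1 - s) * Q + s * \<delta> * Z + s\<^sup>2 * P\<^sup>2 * Z) has_real_derivative (Q + \<delta> * Z)) (at 0)"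
        by (auto intro!: derivative_eq_intros)
      ultimately show ?thesis
        unfolding F_def[abs_def] by (rule DERIV_diff[rotated])
    qed
    have "Q + \<delta> * Z - (A - Z * ln Z) < 0" using neg by linarith
    from DERIV_neg_dec_right[OF deriv this]
    obtain d where d: "0 < d" "\<And>h. 0 < h \<Longrightarrow> h < d \<Longrightarrow> F (0 + h) < F 0"
      by blast
    have F0: "F 0 = 0" using \<open>0 < Z\<close> by (simp add: F_def)
    obtain s0 where s0: "0 < s0" "\<And>s. 0 < s \<Longrightarrow> s < s0 \<Longrightarrow>
      (\<integral>x. exp (g x / (1 - s)) \<partial>M) powr (1 - s) \<le> (\<integral>x. exp (g x + s * (q x / (1 - s) + \<delta>)) \<partial>M)"
      using le[OF \<open>0 < \<delta>\<close>] by blast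
    have "((\<lambda>s. Z + s / (1 - s) * A) \<longlongrightarrow> Z) (at_right 0)"
      by (auto intro!: tendsto_eq_intros)
    then have "eventually (\<lambda>s. 0 < Z + s / (1 - s) * A) (at_right 0)"
      using \<open>0 < Z\<close> by (rule order_tendstoD)
    moreover have "eventually (\<lambda>s. s \<in> {0<..<min (min d s0) (min (1/2) (1 / P))}) (at_right 0)"
      using d(1) s0(1) \<open>0 \<le> K\<close> by (intro eventually_at_right_real) (simp add: P_def)
    ultimately have "eventually (\<lambda>s. 0 < Z + s / (1 - s) * A \<and> s \<in> {0<..<min (min d s0) (min (1/2) (1 / P))}) (at_right (0::real))"
      by (rule eventually_conj)
    from eventually_happens[OF this] obtain s where s: "0 < Z + s / (1 - s) * A" "0 < s" "s < d" "s < s0" "s < 1/2" "s < 1 / P"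
      by (auto simp: trivial_limit_at_right_real)
    have "0 < P" using \<open>0 \<le> K\<close> by (simp add: P_def)
    then have sP: "s * P \<le> 1" using s by (simp add: field_simps)
    define p where "p x = q x / (1 - s) + \<delta>" for x
    have p: "0 \<le> p x" "p x \<le> P" for x
    proof -
      have "q x / (1 - s) \<le> q x / (1/2)" using q[of x] s by (intro divide_left_mono) auto
      then show "p x \<le> P" using q[of x] that by (simp add: p_def P_def)
      show "0 \<le> p x" using q[of x] that s by (simp add: p_def)
    qed
    have "Z + s / (1 - s) * A = (\<integral>x. exp (g x) + s / (1 - s) * (g x * exp (g x)) \<partial>M)"
      unfolding Z_def A_def using int by simp
    also have "\<dots> \<le> (\<integral>x. exp (g x / (1 - s)) \<partial>M)"
    proof (rule integral_mono)
      have "\<bar>g x / (1 - s)\<bar> \<le> K / (1 - s)" for x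
        using g[of x] s by (simp add: divide_right_mono)
      then have "g x / (1 - s) \<le> K / (1 - s)" for x by (meson abs_le_D1)
      then show "integrable M (\<lambda>x. exp (g x / (1 - s)))"
        by (intro integrable_const_bound[of _ "exp (K / (1 - s))"] AE_I2) auto
      show "exp (g x) + s / (1 - s) * (g x * exp (g x)) \<le> exp (g x / (1 - s))" for x
      proof -
        have "g x / (1 - s) = g x + s / (1 - s) * g x" using s by (simp add: field_simps)
        then have "exp (g x / (1 - s)) = exp (g x) * exp (s / (1 - s) * g x)" by (simp add: exp_add)
        moreover have "exp (g x) * (1 + s / (1 - s) * g x) \<le> exp (g x) * exp (s / (1 - s) * g x)"
          by (intro mult_left_mono exp_ge_add_one_self) auto
        ultimately show ?thesis by (simp add: algebra_simps)
      qed
    qed (use int in auto)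
    finally have "(Z + s / (1 - s) * A) powr (1 - s) \<le> (\<integral>x. exp (g x / (1 - s)) \<partial>M) powr (1 - s)"
      using s by (intro powr_mono2) auto
    also have "\<dots> \<le> (\<integral>x. exp (g x + s * p x) \<partial>M)"
      unfolding p_def by (rule s0(2)) (use s in auto)
    also have "\<dots> \<le> (\<integral>x. exp (g x) + s / (1 - s) * (q x * exp (g x)) + (s * \<delta> + s\<^sup>2 * P\<^sup>2) * exp (g x) \<partial>M)"
    proof (rule integral_mono)
      have sp: "0 \<le> s * p x" "s * p x \<le> s * P" for x using p s by auto
      have "g x + s * p x \<le> K + 1" for x using g[of x] sp(2)[of x] sP by linarith
      moreover have [measurable]: "p \<in> borel_measurable M" unfolding p_def[abs_def] by measurable
      ultimately show "integrable M (\<lambda>x. exp (g x + s * p x))"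
        by (intro integrable_const_bound[of _ "exp (K + 1)"] AE_I2) auto
      show "exp (g x + s * p x) \<le> exp (g x) + s / (1 - s) * (q x * exp (g x)) + (s * \<delta> + s\<^sup>2 * P\<^sup>2) * exp (g x)" for x
      proof -
        have "exp (s * p x) \<le> 1 + s * p x + (s * p x)\<^sup>2"
          using sp[of x] sP by (intro exp_bound) auto
        also have "(s * p x)\<^sup>2 \<le> (s * P)\<^sup>2" using sp[of x] by (intro power_mono)
        finally have "exp (g x) * exp (s * p x) \<le> exp (g x) * (1 + s * p x + (s * P)\<^sup>2)"
          by (intro mult_left_mono) auto
        also have "\<dots> = exp (g x) + s / (1 - s) * (q x * exp (g x)) + (s * \<delta> + s\<^sup>2 * P\<^sup>2) * exp (g x)"
          by (simp add: p_def algebra_simps power_mult_distrib)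
        finally show ?thesis by (simp add: exp_add)
      qed
    qed (use int in auto)
    also have "\<dots> = Z + s / (1 - s) * Q + (s * \<delta> + s\<^sup>2 * P\<^sup>2) * Z"
      unfolding Z_def Q_def using int by simp
    finally have "0 \<le> F s" unfolding F_def by (simp add: algebra_simps)
    with d(2)[of s] s F0 show False by simp
  qed
  have "A - Z * ln Z \<le> Q"
  proof (rule field_le_epsilon)
    fix e :: real assume "0 < e"
    define \<delta> where "\<delta> = min 1 (e / Z)"
    have \<delta>: "0 < \<delta>" "\<delta> \<le> 1" "\<delta> \<le> e / Z" using \<open>0 < e\<close> \<open>0 < Z\<close> by (auto simp: \<delta>_def)
    have "\<delta> * Z \<le> e" using \<delta>(3) \<open>0 < Z\<close> by (simp add: field_simps)
    with *[OF \<delta>(1,2)] show "A - Z * ln Z \<le> Q + e" by linarith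
  qed
  then show ?thesis unfolding A_def Z_def Q_def .
qed

section \<open>Cutoffs and elementary calculus\<close>

lemma uniformly_continuous_of_compact_support:
  fixes V :: "'a::{real_normed_vector, heine_borel} \<Rightarrow> 'b::real_normed_vector"
  assumes V: "continuous_on UNIV V" "\<And>y. R \<le> norm y \<Longrightarrow> V y = 0"
  shows "uniformly_continuous_on UNIV V" "\<exists>C. \<forall>y. norm (V y) \<le> C"
proof -
  have cont: "continuous_on (cball 0 (R + 1)) V" using V(1) by (rule continuous_on_subset) simp
  have unif: "uniformly_continuous_on (cball 0 (R + 1)) V"
    by (intro compact_uniformly_continuous cont compact_cball)
  show "uniformly_continuous_on UNIV V"
    unfolding uniformly_continuous_on_def
  proof (intro allI impI)
    fix e :: real assume "0 < e"
    then obtain d where d: "0 < d" "\<And>x y. x \<in> cball 0 (R + 1) \<Longrightarrow> y \<in> cball 0 (R + 1) \<Longrightarrow> dist y x < d \<Longrightarrow> dist (V y) (V x) < e"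
      using unif unfolding uniformly_continuous_on_def by metis
    have "dist (V y) (V x) < e" if "dist y x < min d 1" for x y
    proof (cases "norm x \<le> R \<or> norm y \<le> R")
      case True
      have "norm x \<le> norm y + dist y x" "norm y \<le> norm x + dist y x"
        using norm_triangle_sub[of x y] norm_triangle_sub[of y x] by (auto simp: dist_norm norm_minus_commute)
      with True that show ?thesis by (intro d) (auto simp: dist_norm)
    next
      case False
      then show ?thesis using V(2)[of x] V(2)[of y] \<open>0 < e\<close> by simp
    qed
    then show "\<exists>d>0. \<forall>x\<in>UNIV. \<forall>y\<in>UNIV. dist y x < d \<longrightarrow> dist (V y) (V x) < e"
      using \<open>0 < d\<close> by (intro exI[of _ "min d 1"]) auto
  qed
  have "bounded (V ` cball 0 (R + 1))"
    by (intro compact_imp_bounded compact_continuous_image cont compact_cball)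
  then obtain C where C: "\<And>y. y \<in> cball 0 (R + 1) \<Longrightarrow> norm (V y) \<le> C"
    unfolding bounded_iff by blast
  have "norm (V y) \<le> max C 0" for y
    using C[of y] V(2)[of y] by (cases "norm y \<le> R + 1") (auto simp: le_max_iff_disj)
  then show "\<exists>C. \<forall>y. norm (V y) \<le> C" by blast
qed

text \<open>
The difference quotient differs from the derivative by at most \<open>|h|\<close>, on either side of the kink at 0.
\<close>

lemma DERIV_positive_part_square:
  "((\<lambda>r::real. (max 0 r)\<^sup>2) has_real_derivative 2 * max 0 x) (at x)"
proof -
  have "\<bar>((max 0 (x + h))\<^sup>2 - (max 0 x)\<^sup>2) / h - 2 * max 0 x\<bar> \<le> \<bar>h\<bar>" if "h \<noteq> 0" for h
  proof -
    have *: "0 \<le> (max 0 (x + h))\<^sup>2 - (max 0 x)\<^sup>2 - 2 * max 0 x * h \<and>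
        (max 0 (x + h))\<^sup>2 - (max 0 x)\<^sup>2 - 2 * max 0 x * h \<le> h\<^sup>2"
    proof (cases "0 \<le> x")
      case True
      note x = this
      show ?thesis
      proof (cases "0 \<le> x + h")
        case True
        with x show ?thesis by (simp add: power2_eq_square algebra_simps)
      next
        case False
        have "0 \<le> x * (- x - 2 * h)" using False x by (intro mult_nonneg_nonneg) auto
        moreover have "0 \<le> (x + h)\<^sup>2" by simp
        ultimately show ?thesis using False x by (simp add: power2_eq_square algebra_simps)
      qed
    next
      case False
      then have "(max 0 (x + h))\<^sup>2 \<le> \<bar>h\<bar>\<^sup>2" by (intro power_mono) auto
      with False show ?thesis by simp
    qed
    have "((max 0 (x + h))\<^sup>2 - (max 0 x)\<^sup>2) / h - 2 * max 0 x = ((max 0 (x + h))\<^sup>2 - (max 0 x)\<^sup>2 - 2 * max 0 x * h) / h"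
      using that by (simp add: field_simps)
    also have "\<bar>\<dots>\<bar> \<le> h\<^sup>2 / \<bar>h\<bar>"
      unfolding abs_divide using * by (intro divide_right_mono) auto
    also have "\<dots> = \<bar>h\<bar>" using that by (simp add: power2_eq_square field_simps flip: abs_mult)
    finally show ?thesis .
  qed
  then have "eventually (\<lambda>h. norm (((max 0 (x + h))\<^sup>2 - (max 0 x)\<^sup>2) / h - 2 * max 0 x) \<le> \<bar>h\<bar>) (at 0)"
    unfolding eventually_at by (intro exI[of _ 1]) auto
  moreover have "((\<lambda>h::real. \<bar>h\<bar>) \<longlongrightarrow> 0) (at 0)" by (auto intro!: tendsto_eq_intros)
  ultimately have "((\<lambda>h. ((max 0 (x + h))\<^sup>2 - (max 0 x)\<^sup>2) / h - 2 * max 0 x) \<longlongrightarrow> 0) (at 0)"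
    by (rule Lim_null_comparison)
  then show ?thesis
    unfolding DERIV_def by (rule LIM_zero_cancel)
qed

text \<open>
A continuously differentiable cutoff: the square removes the corner of the positive part. Its gradient
is of order \<open>1 / R\<close>, so cutting off changes the energy by a negligible amount.
\<close>
definition bump :: "real \<Rightarrow> 'a::real_inner \<Rightarrow> real" where
  "bump R y = (max 0 (1 - inner y y / R\<^sup>2))\<^sup>2"

definition bump_grad :: "real \<Rightarrow> 'a::real_inner \<Rightarrow> 'a" where
  "bump_grad R y = (- (4 / R\<^sup>2) * max 0 (1 - inner y y / R\<^sup>2)) *\<^sub>R y"

lemma bump_has_derivative:
  "(bump R has_derivative (\<lambda>k. inner (bump_grad R y) k)) (at y)"
proof -
  have 1: "((\<lambda>y::'a. 1 - inner y y / R\<^sup>2) has_derivative (\<lambda>k. - (2 / R\<^sup>2 * inner y k))) (at y)"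
    by (auto intro!: derivative_eq_intros simp: fun_eq_iff inner_commute divide_inverse algebra_simps)
  have "(bump R has_derivative (\<lambda>k. - (2 / R\<^sup>2 * inner y k) * (2 * max 0 (1 - inner y y / R\<^sup>2)))) (at y)"
    unfolding bump_def[abs_def]
    using has_derivative_compose[OF 1 DERIV_positive_part_square[unfolded has_field_derivative_def]]
    by (simp add: mult_ac)
  also have "(\<lambda>k. - (2 / R\<^sup>2 * inner y k) * (2 * max 0 (1 - inner y y / R\<^sup>2))) = (\<lambda>k. inner (bump_grad R y) k)"
    by (simp add: bump_grad_def fun_eq_iff)
  finally show ?thesis .
qed

lemma bump_bounds: "0 < R \<Longrightarrow> 0 \<le> bump R y \<and> bump R y \<le> 1"
  by (auto simp: bump_def intro!: power_le_one)

lemma bump_eq_0: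
  assumes "0 < R" "R \<le> norm y"
  shows "bump R y = 0" "bump_grad R y = 0"
proof -
  have "R\<^sup>2 \<le> (norm y)\<^sup>2" using assms by (intro power_mono) auto
  then have "1 - inner y y / R\<^sup>2 \<le> 0" using assms by (simp add: field_simps power2_norm_eq_inner)
  then show "bump R y = 0" "bump_grad R y = 0" by (auto simp: bump_def bump_grad_def max_def)
qed

lemma norm_bump_grad_le:
  assumes "0 < R"
  shows "norm (bump_grad R y) \<le> 4 / R"
proof (cases "R \<le> norm y")
  case True
  then show ?thesis using bump_eq_0[OF assms True] assms by simp
next
  case False
  have "norm (bump_grad R y) = 4 / R\<^sup>2 * max 0 (1 - inner y y / R\<^sup>2) * norm y"
    using assms by (simp add: bump_grad_def abs_mult)
  also have "\<dots> \<le> 4 / R\<^sup>2 * 1 * R"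
    using False assms by (intro mult_mono) auto
  also have "\<dots> = 4 / R" using assms by (simp add: power2_eq_square)
  finally show ?thesis .
qed

lemma bump_tendsto: "(\<lambda>n. bump (real (Suc n)) y) \<longlonglongrightarrow> 1"
proof -
  have "(\<lambda>n. (max 0 (1 - inner y y * (inverse (real (Suc n)))\<^sup>2))\<^sup>2) \<longlonglongrightarrow> (max 0 (1 - inner y y * 0\<^sup>2))\<^sup>2"
    by (intro tendsto_intros LIMSEQ_inverse_real_of_nat)
  then show ?thesis by (simp add: bump_def divide_inverse power_inverse)
qed

lemma continuous_on_bump: "continuous_on UNIV (bump R)"
  unfolding bump_def[abs_def] divide_inverse by (intro continuous_intros)

lemma continuous_on_bump_grad: "continuous_on UNIV (bump_grad R)"
  unfolding bump_grad_def[abs_def] divide_inverse by (intro continuous_intros)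

lemma mult_ln_ge: "-1 \<le> x * ln x" if "0 \<le> x" for x :: real
proof (cases "x = 0")
  case False
  then have x: "0 < x" using that by simp
  have "ln (1 / x) \<le> 1 / x - 1" using x by (intro ln_le_minus_one) simp
  then have "x * (- ln x) \<le> x * (1 / x - 1)" using x by (intro mult_left_mono) (simp_all add: ln_div)
  then show ?thesis using x by (simp add: algebra_simps)
qed simp

text \<open>
Continuity of \<open>r ln r\<close> at \<open>a = 0\<close> as well, where \<open>ln 0 = 0\<close> in HOL gives the conventional value 0. Near
0 it follows from \<open>- r ln r = 2 r ln (1 / sqrt r) \<le> 2 sqrt r\<close>.
\<close>

lemma tendsto_mult_ln:
  fixes F :: "nat \<Rightarrow> real"
  assumes F: "F \<longlonglongrightarrow> a" "\<And>n. 0 < F n"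
  shows "(\<lambda>n. F n * ln (F n)) \<longlonglongrightarrow> a * ln a"
proof (cases "a = 0")
  case False
  then show ?thesis by (intro tendsto_mult tendsto_ln F)
next
  case True
  have bound: "norm (F n * ln (F n)) \<le> 2 * sqrt (F n) + \<bar>F n\<bar> * \<bar>F n\<bar>" for n
  proof (cases "F n \<le> 1")
    case True
    let ?r = "sqrt (F n)"
    have r: "0 < ?r" "F n = ?r * ?r" using F(2)[of n] by simp_all
    have "- ln (F n) = 2 * ln (1 / ?r)"
      using r(1) F(2)[of n] by (simp add: ln_div ln_sqrt)
    also have "\<dots> \<le> 2 * (1 / ?r - 1)" using r(1) by (intro mult_left_mono ln_le_minus_one) auto
    also have "\<dots> \<le> 2 / ?r" by simp
    finally have "F n * (- ln (F n)) \<le> F n * (2 / ?r)" using F(2)[of n] by (intro mult_left_mono) auto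
    also have "\<dots> = 2 * (F n / ?r)" by simp
    also have "\<dots> = 2 * ?r" using F(2)[of n] by (subst real_div_sqrt) auto
    finally have "F n * (- ln (F n)) \<le> 2 * ?r" .
    moreover have "ln (F n) \<le> 0" using True F(2)[of n] by simp
    then have "norm (F n * ln (F n)) = F n * (- ln (F n))" using F(2)[of n] by (simp add: abs_mult)
    moreover have "0 \<le> \<bar>F n\<bar> * \<bar>F n\<bar>" by simp
    ultimately show ?thesis by linarith
  next
    case False
    then have "0 \<le> ln (F n)" by simp
    moreover have "ln (F n) \<le> F n" using ln_le_minus_one[OF F(2)[of n]] by simp
    ultimately have "norm (F n * ln (F n)) \<le> \<bar>F n\<bar> * \<bar>F n\<bar>"
      using F(2)[of n] by (simp add: abs_mult)
    moreover have "0 \<le> sqrt (F n)" using F(2)[of n] by simp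
    ultimately show ?thesis by linarith
  qed
  have "(\<lambda>n. 2 * sqrt (F n) + \<bar>F n\<bar> * \<bar>F n\<bar>) \<longlonglongrightarrow> 2 * sqrt 0 + \<bar>0\<bar> * \<bar>0\<bar>"
    using F(1) True by (intro tendsto_intros) auto
  then have "(\<lambda>n. F n * ln (F n)) \<longlonglongrightarrow> 0"
    using bound by (intro Lim_null_comparison[of "\<lambda>n. F n * ln (F n)" "\<lambda>n. 2 * sqrt (F n) + \<bar>F n\<bar> * \<bar>F n\<bar>"]) auto
  then show ?thesis using True by simp
qed

lemma ext_integral_eq_integral:
  assumes "integrable M h"
  shows "ext_integral M h = ereal (\<integral>x. h x \<partial>M)"
proof -
  have fin: "(\<integral>\<^sup>+x. ennreal (h x) \<partial>M) < \<infinity>" "(\<integral>\<^sup>+x. ennreal (- h x) \<partial>M) < \<infinity>"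
    using assms by (auto simp: real_integrable_def less_top)
  have "enn2ereal x = ereal (enn2real x)" if "x < \<infinity>" for x
    using that by (cases x) auto
  then show ?thesis
    unfolding ext_integral_def real_lebesgue_integral_def[OF assms] using fin by simp
qed

lemma smooth_gradient_field:
  fixes \<phi> :: "real ^ 'k::finite \<Rightarrow> real"
  assumes "smooth \<phi>"
  defines "V \<equiv> \<lambda>y. \<chi> i. frechet_derivative \<phi> (at y) (axis i 1)"
  shows "(\<phi> has_derivative (\<lambda>k. inner (V y) k)) (at y)" "continuous_on UNIV V"
proof -
  have "times_cont_differentiable (Suc 0) \<phi>" using assms by (simp only: smooth_def)
  then have d: "\<And>y. \<phi> differentiable at y" and c: "\<And>v. continuous_on UNIV (\<lambda>y. frechet_derivative \<phi> (at y) v)"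
    by auto
  show "continuous_on UNIV V" unfolding V_def by (intro continuous_on_vec_lambda c)
  have der: "(\<phi> has_derivative frechet_derivative \<phi> (at y)) (at y)"
    using d by (simp add: frechet_derivative_works)
  then have lin: "linear (frechet_derivative \<phi> (at y))" by (rule has_derivative_linear)
  have "frechet_derivative \<phi> (at y) k = inner (V y) k" for k
  proof -
    have "frechet_derivative \<phi> (at y) k = frechet_derivative \<phi> (at y) (\<Sum>i\<in>UNIV. (k $ i) *\<^sub>R axis i 1)"
      by (simp add: basis_expansion flip: scalar_mult_eq_scaleR)
    also have "\<dots> = inner (V y) k"
      by (simp add: linear_sum[OF lin] linear_cmul[OF lin] V_def inner_vec_def mult.commute)
    finally show ?thesis .
  qed
  then have "frechet_derivative \<phi> (at y) = (\<lambda>k. inner (V y) k)" by blast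
  with der show "(\<phi> has_derivative (\<lambda>k. inner (V y) k)) (at y)" by simp
qed

section \<open>From finite-dimensional projections to the Frechet space\<close>

locale super_log_concave_setting =
  fixes \<iota> :: "'h::{real_inner,banach,polish_space} \<Rightarrow> 'e::{frechet_space,polish_space}"
    and et :: "nat \<Rightarrow> 'e \<Rightarrow> real"
    and \<alpha> :: real
    and \<rho> :: "'e measure"
    and l :: "'k::finite \<Rightarrow> 'e \<Rightarrow> real"
  assumes injection: "dense_injection \<iota>"
    and et_dual: "\<And>i. et i \<in> continuous_dual"
    and complete: "complete_orthonormal (\<lambda>i. dual_to_H \<iota> (et i))"
    and \<alpha>_pos: "0 < \<alpha>"
    and prob: "prob_space \<rho>"
    and slc: "super_log_concave \<iota> et \<alpha> \<rho>"
    and l_dual: "\<And>i. l i \<in> continuous_dual"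
begin

interpretation prob_space \<rho> by (rule prob)

definition L :: "'e \<Rightarrow> real ^ 'k" where
  "L x = (\<chi> i. l i x)"

text \<open>
The adjoint of \<open>L \<circ> \<iota>\<close>: it maps the Euclidean gradient of a function of \<open>L x\<close> to the gradient along \<open>H\<close>.
\<close>
definition grad :: "real ^ 'k \<Rightarrow> 'h" where
  "grad y = (\<Sum>i\<in>UNIV. (y $ i) *\<^sub>R dual_to_H \<iota> (l i))"

lemma sets_\<rho> [measurable_cong]: "sets \<rho> = sets borel"
  using slc by (simp add: super_log_concave_def radon_measure_def)

lemma continuous_L: "continuous_on UNIV L"
  unfolding L_def[abs_def] using l_dual
  by (intro continuous_on_vec_lambda) (auto simp: continuous_dual_def)

lemma L_measurable [measurable]: "L \<in> borel_measurable \<rho>"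
  using borel_measurable_continuous_onI[OF continuous_L] by (simp cong: measurable_cong_sets add: sets_\<rho>)

lemma bounded_linear_grad: "bounded_linear grad"
  unfolding grad_def[abs_def]
  by (intro bounded_linear_sum bounded_linear_scaleR_const[OF bounded_linear_vec_nth] )

lemma inner_grad: "inner (grad y) h = inner y (L (\<iota> h))"
  unfolding grad_def L_def inner_vec_def
  by (simp add: inner_sum_left dual_to_H_eq[OF complete injection l_dual])

lemma bounded_linear_L_iota: "bounded_linear (\<lambda>z. L (\<iota> z))"
proof -
  have eq: "(\<lambda>z. L (\<iota> z)) = (\<lambda>z. \<Sum>i\<in>UNIV. inner (dual_to_H \<iota> (l i)) z *\<^sub>R (axis i 1 :: real ^ 'k))"
    by (simp add: fun_eq_iff vec_eq_iff L_def axis_def dual_to_H_eq[OF complete injection l_dual]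
        if_distrib[of "(*) _"] cong: if_cong)
  show ?thesis
    unfolding eq by (intro bounded_linear_sum bounded_linear_scaleR_const bounded_linear_inner_right)
qed

text \<open>
On the span of the first \<open>n\<close> basis vectors, \<open>exp_prekopa_leindler\<close> applies to the image of \<open>\<rho>\<close> under
\<open>\<pi>\<^sub>n\<close>. Its hypothesis concerns increments along all of \<open>H\<close> and hence holds for every \<open>n\<close> at once, and
\<open>L (\<pi>\<^sub>n x) \<longlonglongrightarrow> L x\<close> almost everywhere since \<open>L\<close> is continuous on \<open>E\<close>.
\<close>

lemma exp_prekopa_leindler_cylindrical:
  fixes G Q :: "real ^ 'k \<Rightarrow> real"
  assumes ts: "0 < t" "0 < s" "t + s = 1"
    and G: "continuous_on UNIV G" "\<And>y. \<bar>G y\<bar> \<le> K"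
    and Q: "continuous_on UNIV Q" "\<And>y. \<bar>Q y\<bar> \<le> K"
    and GQ: "\<And>z h. G (L (\<iota> (z + s *\<^sub>R h))) \<le> G (L (\<iota> z)) + Q (L (\<iota> z)) + \<alpha> / 2 * (t * s * (norm h)\<^sup>2)"
  shows "(\<integral>x. exp (G (L x) / t) \<partial>\<rho>) powr t \<le> (\<integral>x. exp (G (L x) + Q (L x)) \<partial>\<rho>)"
proof -
  let ?e = "\<lambda>i. dual_to_H \<iota> (et i)"
  let ?B = "\<lambda>n. ?e ` {..<n}"
  let ?p = "proj_H \<iota> et"
  have contL: "continuous_on UNIV (\<lambda>z. L (\<iota> z))"
    by (rule linear_continuous_on[OF bounded_linear_L_iota])
  have cont_proj: "continuous_on UNIV (?p n)" for n
    unfolding proj_H_def[abs_def] using et_dual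
    by (intro continuous_intros) (auto simp: continuous_dual_def)
  have [measurable]: "?p n \<in> borel_measurable \<rho>" for n
    using borel_measurable_continuous_onI[OF cont_proj] by (simp cong: measurable_cong_sets add: sets_\<rho>)
  have proj_meas: "?p n \<in> \<rho> \<rightarrow>\<^sub>M borel_span (?B n)" for n
  proof (rule measurable_restrict_space2)
    show "?p n \<in> space \<rho> \<rightarrow> span (?B n)"
    proof
      fix x show "?p n x \<in> span (?B n)"
        unfolding proj_H_def by (intro span_sum span_scale span_base) auto
    qed
  qed measurable
  have cont: "continuous_on UNIV (\<lambda>z. F (L (\<iota> z)))" if "continuous_on UNIV F" for F :: "real ^ 'k \<Rightarrow> real"
    using continuous_on_compose2[OF that contL] by simp
  have fin_dim: "(\<integral>x. exp (G (L (\<iota> (?p n x))) / t) \<partial>\<rho>) powr t \<le> (\<integral>x. exp (G (L (\<iota> (?p n x))) + Q (L (\<iota> (?p n x)))) \<partial>\<rho>)"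
    if "1 \<le> n" for n
  proof -
    interpret frame: orthonormal_frame "?B n"
      using complete by unfold_locales (auto simp: complete_orthonormal_def)
    have eq: "(\<integral>z. F z \<partial>distr \<rho> (borel_span (?B n)) (?p n)) = (\<integral>x. F (?p n x) \<partial>\<rho>)"
      if "continuous_on UNIV F" for F :: "'h \<Rightarrow> real"
      using that by (intro integral_distr proj_meas frame.continuous_on_measurable) (rule continuous_on_subset, auto)
    have "(\<integral>z. exp (G (L (\<iota> z)) / t) \<partial>distr \<rho> (borel_span (?B n)) (?p n)) powr t
        \<le> (\<integral>z. exp (G (L (\<iota> z)) + Q (L (\<iota> z))) \<partial>distr \<rho> (borel_span (?B n)) (?p n))"
    proof (rule frame.exp_prekopa_leindler[OF _ _ _ ts, where K = K])
      show "super_log_concave_span \<alpha> (?B n) (distr \<rho> (borel_span (?B n)) (?p n))"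
        using slc that unfolding super_log_concave_def Let_def by blast
      show "prob_space (distr \<rho> (borel_span (?B n)) (?p n))"
        by (rule prob_space_distr[OF proj_meas])
    qed (use \<alpha>_pos G Q GQ cont in auto)
    moreover have "continuous_on UNIV (\<lambda>z. exp (G (L (\<iota> z)) / t))" "continuous_on UNIV (\<lambda>z. exp (G (L (\<iota> z)) + Q (L (\<iota> z))))"
      using ts by (intro continuous_intros cont G Q; simp)+
    ultimately show ?thesis by (simp only: eq)
  qed
  have lim: "(\<lambda>n. \<integral>x. F (L (\<iota> (?p n x))) \<partial>\<rho>) \<longlonglongrightarrow> (\<integral>x. F (L x) \<partial>\<rho>)"
    if F: "continuous_on UNIV F" "\<And>y. \<bar>F y\<bar> \<le> C" for F :: "real ^ 'k \<Rightarrow> real" and C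
  proof (rule integral_dominated_convergence)
    have [measurable]: "F \<in> borel_measurable borel" by (rule borel_measurable_continuous_onI) fact
    show "(\<lambda>x. F (L x)) \<in> borel_measurable \<rho>" by measurable
    have [measurable]: "(\<lambda>z. F (L (\<iota> z))) \<in> borel_measurable borel" 
      by (rule borel_measurable_continuous_onI[OF cont[OF F(1)]])
    show "(\<lambda>x. F (L (\<iota> (?p n x)))) \<in> borel_measurable \<rho>" for n
      by (rule measurable_compose[of "?p n" \<rho> borel]) measurable
    show "integrable \<rho> (\<lambda>_. C)" by simp
    show "AE x in \<rho>. norm (F (L (\<iota> (?p n x)))) \<le> C" for n using F(2) by simp
    have "AE x in \<rho>. (\<lambda>n. \<iota> (?p n x)) \<longlonglongrightarrow> x"
      using slc by (simp add: super_log_concave_def)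
    then show "AE x in \<rho>. (\<lambda>n. F (L (\<iota> (?p n x)))) \<longlonglongrightarrow> F (L x)"
    proof eventually_elim
      case (elim x)
      have "continuous_on UNIV (\<lambda>x. F (L x))" using continuous_on_compose2[OF F(1) continuous_L] by simp
      then show ?case using elim by (rule continuous_on_tendsto_compose) auto
    qed
  qed
  show ?thesis
  proof (rule LIMSEQ_le)
    have "\<bar>exp (G y + Q y)\<bar> \<le> exp (2 * K)" for y using G(2)[of y] Q(2)[of y] by (simp add: abs_le_iff)
    then show "(\<lambda>n. \<integral>x. exp (G (L (\<iota> (?p n x))) + Q (L (\<iota> (?p n x)))) \<partial>\<rho>) \<longlonglongrightarrow> (\<integral>x. exp (G (L x) + Q (L x)) \<partial>\<rho>)"
      by (intro lim[of "\<lambda>y. exp (G y + Q y)"] continuous_intros G Q)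
    have "\<bar>exp (G y / t)\<bar> \<le> exp (K / t)" for y using G(2)[of y] ts by (simp add: abs_le_iff divide_right_mono)
    then have "(\<lambda>n. \<integral>x. exp (G (L (\<iota> (?p n x))) / t) \<partial>\<rho>) \<longlonglongrightarrow> (\<integral>x. exp (G (L x) / t) \<partial>\<rho>)"
      using ts by (intro lim[of "\<lambda>y. exp (G y / t)"] continuous_intros G) auto
    then show "(\<lambda>n. (\<integral>x. exp (G (L (\<iota> (?p n x))) / t) \<partial>\<rho>) powr t) \<longlonglongrightarrow> (\<integral>x. exp (G (L x) / t) \<partial>\<rho>) powr t"
      using ts by (intro tendsto_powr' tendsto_const) auto
    show "\<exists>N. \<forall>n\<ge>N. (\<integral>x. exp (G (L (\<iota> (?p n x))) / t) \<partial>\<rho>) powr t \<le> (\<integral>x. exp (G (L (\<iota> (?p n x))) + Q (L (\<iota> (?p n x)))) \<partial>\<rho>)"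
      using fin_dim by blast
  qed
qed

text \<open>
The logarithmic Sobolev inequality for \<open>f\<^sup>2 = exp G\<close>, where \<open>V\<close> is the gradient of \<open>G\<close>.
\<close>

lemma entropy_cylindrical:
  fixes G :: "real ^ 'k \<Rightarrow> real" and V :: "real ^ 'k \<Rightarrow> real ^ 'k"
  assumes deriv: "\<And>y. (G has_derivative (\<lambda>k. inner (V y) k)) (at y)"
    and V: "uniformly_continuous_on UNIV V" "\<And>y. norm (V y) \<le> C"
    and G: "\<And>y. \<bar>G y\<bar> \<le> K"
  shows "(\<integral>x. G (L x) * exp (G (L x)) \<partial>\<rho>) - (\<integral>x. exp (G (L x)) \<partial>\<rho>) * ln (\<integral>x. exp (G (L x)) \<partial>\<rho>)
    \<le> (\<integral>x. (norm (grad (V (L x))))\<^sup>2 / (2 * \<alpha>) * exp (G (L x)) \<partial>\<rho>)"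
proof -
  have contG: "continuous_on UNIV G"
    using deriv by (intro has_derivative_continuous_on) (auto intro: has_derivative_at_withinI)
  have contV: "continuous_on UNIV V" using V(1) by (rule uniformly_continuous_imp_continuous)
  have cont_grad: "continuous_on UNIV (\<lambda>y. grad (V y))"
    by (rule bounded_linear.continuous_on[OF bounded_linear_grad contV])
  obtain c where c: "0 < c" "\<And>y. norm (grad y) \<le> norm y * c"
    using bounded_linear.pos_bounded[OF bounded_linear_grad] by blast
  define q where "q y = (norm (grad (V y)))\<^sup>2 / (2 * \<alpha>)" for y
  have "0 \<le> C" using V(2)[of 0] norm_ge_zero by (rule order_trans[rotated])
  have grad_le: "norm (grad (V y)) \<le> C * c" for y
    using c(2)[of "V y"] mult_right_mono[OF V(2)[of y], of c] c(1) by linarith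
  define K' where "K' = max K ((C * c)\<^sup>2 / (2 * \<alpha>))"
  have qK: "0 \<le> q y \<and> q y \<le> K'" for y
    using \<alpha>_pos grad_le[of y] by (auto simp: q_def K'_def le_max_iff_disj intro!: divide_right_mono power_mono)
  have GK: "\<bar>G y\<bar> \<le> K'" for y using G[of y] by (simp add: K'_def)
  have contq: "continuous_on UNIV q"
    unfolding q_def[abs_def] using \<alpha>_pos by (intro continuous_intros cont_grad) auto
  have [measurable]: "G \<in> borel_measurable borel" "q \<in> borel_measurable borel"
    by (intro borel_measurable_continuous_onI contG contq)+
  have "uniformly_continuous_on (range (\<lambda>z. L (\<iota> z))) V"
    using V(1) unfolding uniformly_continuous_on_def by blast
  then have unif: "uniformly_continuous_on UNIV (\<lambda>z. grad (V (L (\<iota> z))))"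
    by (intro bounded_linear.uniformly_continuous_on[OF bounded_linear_grad]
        uniformly_continuous_on_compose[of UNIV "\<lambda>z. L (\<iota> z)" V, unfolded comp_def]
        bounded_linear.uniformly_continuous_on[OF bounded_linear_L_iota] uniformly_continuous_on_id)
  have der: "((\<lambda>z. G (L (\<iota> z))) has_derivative (\<lambda>h. inner (grad (V (L (\<iota> z)))) h)) (at z)" for z
    unfolding inner_grad
    by (rule has_derivative_compose[OF bounded_linear_imp_has_derivative[OF bounded_linear_L_iota] deriv])
  have "(\<integral>x. G (L x) * exp (G (L x)) \<partial>\<rho>) - (\<integral>x. exp (G (L x)) \<partial>\<rho>) * ln (\<integral>x. exp (G (L x)) \<partial>\<rho>)
    \<le> (\<integral>x. q (L x) * exp (G (L x)) \<partial>\<rho>)"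
  proof (rule entropy_le_of_power_means[OF prob, where K = K'])
    fix \<delta> :: real assume "0 < \<delta>"
    obtain s0 where s0: "0 < s0" "s0 \<le> 1/2"
      "\<And>s z h. 0 < s \<Longrightarrow> s < s0 \<Longrightarrow>
       G (L (\<iota> (z + s *\<^sub>R h))) \<le> G (L (\<iota> z)) + s * ((norm (grad (V (L (\<iota> z)))))\<^sup>2 / (2 * \<alpha> * (1 - s)) + \<delta>) + \<alpha> / 2 * ((1 - s) * s * (norm h)\<^sup>2)"
      using sup_convolution_bound[OF der grad_le unif \<alpha>_pos \<open>0 < \<delta>\<close>] by blast
    show "\<exists>s0>0. \<forall>s. 0 < s \<and> s < s0 \<longrightarrow>
      (\<integral>x. exp (G (L x) / (1 - s)) \<partial>\<rho>) powr (1 - s) \<le> (\<integral>x. exp (G (L x) + s * (q (L x) / (1 - s) + \<delta>)) \<partial>\<rho>)"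
    proof (intro exI[of _ s0] conjI allI impI s0(1))
      fix s assume s: "0 < s \<and> s < s0"
      then have s': "s < 1/2" using s0 by linarith
      show "(\<integral>x. exp (G (L x) / (1 - s)) \<partial>\<rho>) powr (1 - s) \<le> (\<integral>x. exp (G (L x) + s * (q (L x) / (1 - s) + \<delta>)) \<partial>\<rho>)"
      proof (rule exp_prekopa_leindler_cylindrical[where s = s and K = "K' + (2 * K' + \<delta>)" and Q = "\<lambda>y. s * (q y / (1 - s) + \<delta>)"])
        show "continuous_on UNIV (\<lambda>y. s * (q y / (1 - s) + \<delta>))"
          using s' by (intro continuous_intros contq) auto
        have "0 \<le> K'" using qK[of 0] by linarith
        fix y
        show "\<bar>G y\<bar> \<le> K' + (2 * K' + \<delta>)" using GK[of y] \<open>0 \<le> K'\<close> \<open>0 < \<delta>\<close> by linarith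
        have "0 \<le> q y / (1 - s)" using qK[of y] s' by simp
        have "q y / (1 - s) \<le> q y / (1/2)" using qK[of y] s' s by (intro divide_left_mono) auto
        then have "q y / (1 - s) + \<delta> \<le> 2 * K' + \<delta>" using qK[of y] by simp
        then have "s * (q y / (1 - s) + \<delta>) \<le> 1 * (2 * K' + \<delta>)"
          using s s' \<open>0 \<le> q y / (1 - s)\<close> \<open>0 < \<delta>\<close> by (intro mult_mono) auto
        moreover have "0 \<le> s * (q y / (1 - s) + \<delta>)"
          using s \<open>0 \<le> q y / (1 - s)\<close> \<open>0 < \<delta>\<close> by simp
        ultimately show "\<bar>s * (q y / (1 - s) + \<delta>)\<bar> \<le> K' + (2 * K' + \<delta>)" using \<open>0 \<le> K'\<close> by simp
      next
        fix z h
        have "q y / (1 - s) = (norm (grad (V y)))\<^sup>2 / (2 * \<alpha> * (1 - s))" for y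
          by (simp add: q_def)
        then show "G (L (\<iota> (z + s *\<^sub>R h))) \<le> G (L (\<iota> z)) + s * (q (L (\<iota> z)) / (1 - s) + \<delta>) + \<alpha> / 2 * ((1 - s) * s * (norm h)\<^sup>2)"
          using s0(3)[of s z h] s by simp
      qed (use s s' contG in auto)
    qed
  qed (use GK qK in \<open>auto\<close>)
  then show ?thesis unfolding q_def .
qed

section \<open>The logarithmic Sobolev inequality\<close>

text \<open>
With \<open>G = ln (u\<^sup>2 + \<epsilon>)\<close> one has \<open>|\<nabla>G|\<^sup>2 exp G = 4 u\<^sup>2 |\<nabla>u|\<^sup>2 / (u\<^sup>2 + \<epsilon>) \<le> 4 |\<nabla>u|\<^sup>2\<close>. The compact support of
\<open>u\<close> makes the gradient of \<open>G\<close> bounded and uniformly continuous, and \<open>\<epsilon>\<close> keeps \<open>G\<close> bounded below.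
\<close>

lemma entropy_regularized_square:
  fixes u :: "real ^ 'k \<Rightarrow> real" and U :: "real ^ 'k \<Rightarrow> real ^ 'k"
  assumes u: "\<And>y. (u has_derivative (\<lambda>k. inner (U y) k)) (at y)"
    and U: "continuous_on UNIV U"
    and supp: "\<And>y. R \<le> norm y \<Longrightarrow> u y = 0" "\<And>y. R \<le> norm y \<Longrightarrow> U y = 0"
    and \<epsilon>: "0 < \<epsilon>"
  defines "F \<equiv> \<lambda>x. (u (L x))\<^sup>2 + \<epsilon>"
  shows "integrable \<rho> F" "integrable \<rho> (\<lambda>x. F x * ln (F x))"
    and "(\<integral>x. F x * ln (F x) \<partial>\<rho>) - (\<integral>x. F x \<partial>\<rho>) * ln (\<integral>x. F x \<partial>\<rho>)
      \<le> 2 / \<alpha> * (\<integral>x. (norm (grad (U (L x))))\<^sup>2 \<partial>\<rho>)"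
proof -
  have contu: "continuous_on UNIV u"
    using u by (intro has_derivative_continuous_on) (auto intro: has_derivative_at_withinI)
  obtain C where C: "\<And>y. norm (u y) \<le> C"
    using uniformly_continuous_of_compact_support(2)[OF contu supp(1)] by blast
  define \<Phi> where "\<Phi> y = (u y)\<^sup>2 + \<epsilon>" for y
  have pos: "0 < \<Phi> y" for y using \<epsilon> by (simp add: \<Phi>_def add_nonneg_pos)
  have \<Phi>_bounds: "\<epsilon> \<le> \<Phi> y" "\<Phi> y \<le> C\<^sup>2 + \<epsilon>" for y
    using power_mono[OF C[of y], of 2] by (auto simp: \<Phi>_def)
  have cont\<Phi>: "continuous_on UNIV \<Phi>" unfolding \<Phi>_def[abs_def] by (intro continuous_intros contu)
  define G where "G y = ln (\<Phi> y)" for y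
  have expG: "exp (G y) = \<Phi> y" for y using pos by (simp add: G_def)
  have contG: "continuous_on UNIV G" unfolding G_def[abs_def] using pos by (intro continuous_intros cont\<Phi>) (metis less_irrefl)
  define K where "K = \<bar>ln \<epsilon>\<bar> + \<bar>ln (C\<^sup>2 + \<epsilon>)\<bar>"
  have GK: "\<bar>G y\<bar> \<le> K" for y
  proof -
    have "ln \<epsilon> \<le> G y" "G y \<le> ln (C\<^sup>2 + \<epsilon>)"
      unfolding G_def using \<Phi>_bounds[of y] pos[of y] \<epsilon> by (auto intro!: ln_mono simp: add_nonneg_pos)
    then show ?thesis unfolding K_def by linarith
  qed
  have [measurable]: "\<Phi> \<in> borel_measurable borel" "G \<in> borel_measurable borel"
    by (intro borel_measurable_continuous_onI cont\<Phi> contG)+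
  have F: "F = (\<lambda>x. \<Phi> (L x))" by (simp add: F_def \<Phi>_def)
  have FlnF: "(\<lambda>x. F x * ln (F x)) = (\<lambda>x. G (L x) * exp (G (L x)))"
    by (simp add: F expG) (simp add: G_def mult.commute)
  have abs\<Phi>: "\<bar>\<Phi> y\<bar> \<le> C\<^sup>2 + \<epsilon>" for y using \<Phi>_bounds(2)[of y] pos[of y] by simp
  show int: "integrable \<rho> F"
    unfolding F using abs\<Phi> by (intro integrable_const_bound[of _ "C\<^sup>2 + \<epsilon>"] AE_I2) auto
  have "\<bar>G y * exp (G y)\<bar> \<le> K * (C\<^sup>2 + \<epsilon>)" for y
    unfolding abs_mult expG using GK abs\<Phi> by (intro mult_mono) (auto intro: order_trans[OF abs_ge_zero])
  then show "integrable \<rho> (\<lambda>x. F x * ln (F x))"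
    unfolding FlnF by (intro integrable_const_bound[of _ "K * (C\<^sup>2 + \<epsilon>)"] AE_I2) auto
  define V where "V y = (2 * u y / \<Phi> y) *\<^sub>R U y" for y
  have contV: "continuous_on UNIV V"
    unfolding V_def[abs_def] using pos by (intro continuous_intros contu cont\<Phi> U) (metis less_irrefl)
  have V0: "V y = 0" if "R \<le> norm y" for y using supp(1)[OF that] by (simp add: V_def)
  note unifV = uniformly_continuous_of_compact_support[OF contV V0]
  obtain C' where C': "\<And>y. norm (V y) \<le> C'" using unifV(2) by blast
  have deriv: "(G has_derivative (\<lambda>k. inner (V y) k)) (at y)" for y
  proof -
    have "(\<Phi> has_derivative (\<lambda>k. 2 * u y * inner (U y) k)) (at y)"
      unfolding \<Phi>_def[abs_def] by (auto intro!: derivative_eq_intros u simp: fun_eq_iff)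
    from has_derivative_ln[OF pos this]
    have "((\<lambda>x. ln (\<Phi> x)) has_derivative (\<lambda>k. 2 * u y * inner (U y) k * inverse (\<Phi> y))) (at y)" .
    moreover have "(\<lambda>k. 2 * u y * inner (U y) k * inverse (\<Phi> y)) = (\<lambda>k. inner (V y) k)"
      by (simp add: V_def fun_eq_iff divide_inverse)
    ultimately show ?thesis by (simp add: G_def[abs_def])
  qed
  have cgU: "continuous_on UNIV (\<lambda>y. (norm (grad (U y)))\<^sup>2)"
    by (intro continuous_intros bounded_linear.continuous_on[OF bounded_linear_grad U])
  have gU0: "(norm (grad (U y)))\<^sup>2 = 0" if "R \<le> norm y" for y
    using supp(2)[OF that] bounded_linear.linear[OF bounded_linear_grad] by (simp add: linear_0)
  obtain C'' where C'': "\<And>y. norm ((norm (grad (U y)))\<^sup>2) \<le> C''"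
    using uniformly_continuous_of_compact_support(2)[OF cgU gU0] by blast
  have cgV: "continuous_on UNIV (\<lambda>y. (norm (grad (V y)))\<^sup>2)"
    by (intro continuous_intros bounded_linear.continuous_on[OF bounded_linear_grad contV])
  have [measurable]: "(\<lambda>y. (norm (grad (U y)))\<^sup>2) \<in> borel_measurable borel" "(\<lambda>y. (norm (grad (V y)))\<^sup>2) \<in> borel_measurable borel"
    by (intro borel_measurable_continuous_onI cgU cgV)+
  have int2: "integrable \<rho> (\<lambda>x. 2 / \<alpha> * (norm (grad (U (L x))))\<^sup>2)"
  proof (intro integrable_mult_right integrable_const_bound[of _ C''] AE_I2)
    show "(\<lambda>x. (norm (grad (U (L x))))\<^sup>2) \<in> borel_measurable \<rho>"
      by (rule measurable_compose[OF L_measurable]) measurable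
  qed (use C'' in auto)
  have le: "(norm (grad (V y)))\<^sup>2 / (2 * \<alpha>) * exp (G y) \<le> 2 / \<alpha> * (norm (grad (U y)))\<^sup>2" for y
  proof -
    have "grad (V y) = (2 * u y / \<Phi> y) *\<^sub>R grad (U y)"
      unfolding V_def using bounded_linear.linear[OF bounded_linear_grad] by (simp add: linear_cmul)
    then have "(norm (grad (V y)))\<^sup>2 / (2 * \<alpha>) * exp (G y) = ((u y)\<^sup>2 / \<Phi> y) * (2 / \<alpha> * (norm (grad (U y)))\<^sup>2)"
      using pos[of y] \<alpha>_pos by (simp add: expG power_mult_distrib power_divide) (simp add: field_simps power2_eq_square)
    also have "\<dots> \<le> 1 * (2 / \<alpha> * (norm (grad (U y)))\<^sup>2)"
      using \<epsilon> \<alpha>_pos pos[of y] by (intro mult_right_mono) (auto simp: \<Phi>_def field_simps)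
    finally show ?thesis by simp
  qed
  have "(\<integral>x. G (L x) * exp (G (L x)) \<partial>\<rho>) - (\<integral>x. exp (G (L x)) \<partial>\<rho>) * ln (\<integral>x. exp (G (L x)) \<partial>\<rho>)
      \<le> (\<integral>x. (norm (grad (V (L x))))\<^sup>2 / (2 * \<alpha>) * exp (G (L x)) \<partial>\<rho>)"
    by (rule entropy_cylindrical[OF deriv unifV(1) C' GK])
  also have "\<dots> \<le> (\<integral>x. 2 / \<alpha> * (norm (grad (U (L x))))\<^sup>2 \<partial>\<rho>)"
  proof (rule integral_mono)
    have [measurable]: "(\<lambda>x. (norm (grad (V (L x))))\<^sup>2) \<in> borel_measurable \<rho>"
      by (rule measurable_compose[OF L_measurable]) measurable
    show "integrable \<rho> (\<lambda>x. (norm (grad (V (L x))))\<^sup>2 / (2 * \<alpha>) * exp (G (L x)))"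
    proof (rule Bochner_Integration.integrable_bound[OF int2])
      show "AE x in \<rho>. norm ((norm (grad (V (L x))))\<^sup>2 / (2 * \<alpha>) * exp (G (L x))) \<le> norm (2 / \<alpha> * (norm (grad (U (L x))))\<^sup>2)"
        using le \<alpha>_pos by (intro AE_I2) (simp add: abs_mult)
    qed measurable
  qed (use le int2 in auto)
  also have "\<dots> = 2 / \<alpha> * (\<integral>x. (norm (grad (U (L x))))\<^sup>2 \<partial>\<rho>)" by simp
  finally show "(\<integral>x. F x * ln (F x) \<partial>\<rho>) - (\<integral>x. F x \<partial>\<rho>) * ln (\<integral>x. F x \<partial>\<rho>)
      \<le> 2 / \<alpha> * (\<integral>x. (norm (grad (U (L x))))\<^sup>2 \<partial>\<rho>)"
    unfolding FlnF unfolding F expG .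
qed

text \<open>
Approximation by \<open>\<phi> \<chi>\<close> with a cutoff \<open>\<chi>\<close> of radius \<open>n + 1\<close>, and \<open>\<epsilon> = 1 / (n + 1)\<close>. The energies
converge by domination, as the gradient of \<open>\<phi> \<chi>\<close> is at most \<open>|\<nabla>\<phi>|\<close> plus a multiple of \<open>|\<phi>|\<close>, both
square integrable. The entropies are only lower semicontinuous, by Fatou's lemma, applicable because
\<open>r ln r \<ge> - 1\<close>; this is the right direction, and it also yields integrability of the entropy.
\<close>

lemma log_sobolev_finite_energy:
  fixes \<phi> :: "real ^ 'k \<Rightarrow> real" and V :: "real ^ 'k \<Rightarrow> real ^ 'k"
  assumes deriv: "\<And>y. (\<phi> has_derivative (\<lambda>k. inner (V y) k)) (at y)"
    and V: "continuous_on UNIV V"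
    and sq: "integrable \<rho> (\<lambda>x. (\<phi> (L x))\<^sup>2)" "(\<integral>x. (\<phi> (L x))\<^sup>2 \<partial>\<rho>) = 1"
    and en: "integrable \<rho> (\<lambda>x. (norm (grad (V (L x))))\<^sup>2)"
  shows "integrable \<rho> (\<lambda>x. (\<phi> (L x))\<^sup>2 * ln ((\<phi> (L x))\<^sup>2))"
    and "(\<integral>x. (\<phi> (L x))\<^sup>2 * ln ((\<phi> (L x))\<^sup>2) \<partial>\<rho>) \<le> 2 / \<alpha> * (\<integral>x. (norm (grad (V (L x))))\<^sup>2 \<partial>\<rho>)"
proof -
  have cont\<phi>: "continuous_on UNIV \<phi>"
    using deriv by (intro has_derivative_continuous_on) (auto intro: has_derivative_at_withinI)
  have linear_grad: "linear grad" by (rule bounded_linear.linear[OF bounded_linear_grad])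
  obtain c where c: "0 < c" "\<And>y. norm (grad y) \<le> norm y * c"
    using bounded_linear.pos_bounded[OF bounded_linear_grad] by blast
  define R where "R n = real (Suc n)" for n
  have R: "0 < R n" "1 \<le> R n" for n by (auto simp: R_def)
  define u where "u n y = \<phi> y * bump (R n) y" for n y
  define U where "U n y = bump (R n) y *\<^sub>R V y + \<phi> y *\<^sub>R bump_grad (R n) y" for n y
  have uU: "(u n has_derivative (\<lambda>k. inner (U n y) k)) (at y)" for n y
    unfolding u_def[abs_def] U_def
    by (rule has_derivative_eq_rhs[OF has_derivative_mult[OF deriv bump_has_derivative]])
       (simp add: fun_eq_iff inner_add_left mult_ac)
  have contU: "continuous_on UNIV (U n)" for n
    unfolding U_def[abs_def] by (intro continuous_intros continuous_on_bump continuous_on_bump_grad V cont\<phi>)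
  have supp: "u n y = 0" "U n y = 0" if "R n \<le> norm y" for n y
    using bump_eq_0[OF R(1) that] by (simp_all add: u_def U_def)
  define F where "F n x = (u n (L x))\<^sup>2 + inverse (R n)" for n x
  have core: "integrable \<rho> (F n)" "integrable \<rho> (\<lambda>x. F n x * ln (F n x))"
      "(\<integral>x. F n x * ln (F n x) \<partial>\<rho>) - (\<integral>x. F n x \<partial>\<rho>) * ln (\<integral>x. F n x \<partial>\<rho>)
        \<le> 2 / \<alpha> * (\<integral>x. (norm (grad (U n (L x))))\<^sup>2 \<partial>\<rho>)" for n
    unfolding F_def[abs_def]
    by (rule entropy_regularized_square[where u = "u n" and U = "U n" and R = "R n" and \<epsilon> = "inverse (R n)",
          OF uU contU supp(1)[of n] supp(2)[of n] positive_imp_inverse_positive[OF R(1)]]; assumption)+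
  have F_meas [measurable]: "F n \<in> borel_measurable \<rho>" for n
    using core(1) by (rule borel_measurable_integrable)
  have F_pos: "0 < F n x" for n x using R(1)[of n] by (simp add: F_def add_nonneg_pos)
  have bump_lim: "(\<lambda>n. bump (R n) y) \<longlonglongrightarrow> 1" for y :: "real ^ 'k"
    unfolding R_def by (rule bump_tendsto)
  have inv_lim: "(\<lambda>n. inverse (R n)) \<longlonglongrightarrow> 0"
    unfolding R_def by (rule LIMSEQ_inverse_real_of_nat)
  have F_lim: "(\<lambda>n. F n x) \<longlonglongrightarrow> (\<phi> (L x))\<^sup>2" for x
  proof -
    have "(\<lambda>n. F n x) \<longlonglongrightarrow> (\<phi> (L x) * 1)\<^sup>2 + 0"
      unfolding F_def u_def by (intro tendsto_intros bump_lim inv_lim)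
    then show ?thesis by simp
  qed
  have F_le: "F n x \<le> (\<phi> (L x))\<^sup>2 + 1" for n x
  proof -
    have "(bump (R n) (L x))\<^sup>2 \<le> 1" using bump_bounds[OF R(1), of n "L x"] by (intro power_le_one) auto
    then have "(\<phi> (L x))\<^sup>2 * (bump (R n) (L x))\<^sup>2 \<le> (\<phi> (L x))\<^sup>2 * 1" by (intro mult_left_mono) auto
    moreover have "inverse (R n) \<le> 1" using R(2)[of n] by (simp add: inverse_le_1_iff)
    ultimately show ?thesis by (simp add: F_def u_def power_mult_distrib)
  qed
  define Z where "Z n = (\<integral>x. F n x \<partial>\<rho>)" for n
  have "Z \<longlonglongrightarrow> (\<integral>x. (\<phi> (L x))\<^sup>2 \<partial>\<rho>)"
    unfolding Z_def[abs_def]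
  proof (rule integral_dominated_convergence)
    show "integrable \<rho> (\<lambda>x. (\<phi> (L x))\<^sup>2 + 1)" using sq by simp
    show "AE x in \<rho>. norm (F n x) \<le> (\<phi> (L x))\<^sup>2 + 1" for n
      using F_le F_pos by (intro AE_I2) (simp add: less_imp_le)
    show "(\<lambda>x. (\<phi> (L x))\<^sup>2) \<in> borel_measurable \<rho>" using sq(1) by (rule borel_measurable_integrable)
    show "F n \<in> borel_measurable \<rho>" for n by (rule F_meas)
    show "AE x in \<rho>. (\<lambda>n. F n x) \<longlonglongrightarrow> (\<phi> (L x))\<^sup>2" using F_lim by (intro AE_I2)
  qed
  then have "Z \<longlonglongrightarrow> 1" using sq by simp
  then have "(\<lambda>n. Z n * ln (Z n)) \<longlonglongrightarrow> 1 * ln 1" by (intro tendsto_mult tendsto_ln) auto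
  then have Z_lim: "(\<lambda>n. Z n * ln (Z n)) \<longlonglongrightarrow> 0" by simp
  define I where "I n = (\<integral>x. (norm (grad (U n (L x))))\<^sup>2 \<partial>\<rho>)" for n
  define J where "J = (\<integral>x. (norm (grad (V (L x))))\<^sup>2 \<partial>\<rho>)"
  have I_lim: "I \<longlonglongrightarrow> J"
    unfolding I_def[abs_def] J_def
  proof (rule integral_dominated_convergence)
    show "integrable \<rho> (\<lambda>x. 2 * (norm (grad (V (L x))))\<^sup>2 + 2 * (4 * c)\<^sup>2 * (\<phi> (L x))\<^sup>2)"
      using en sq by simp
    have "continuous_on UNIV (\<lambda>y. (norm (grad (U n y)))\<^sup>2)" for n
      by (intro continuous_intros bounded_linear.continuous_on[OF bounded_linear_grad contU])
    from measurable_compose[OF L_measurable borel_measurable_continuous_onI[OF this]]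
    show "(\<lambda>x. (norm (grad (U n (L x))))\<^sup>2) \<in> borel_measurable \<rho>" for n .
    show "(\<lambda>x. (norm (grad (V (L x))))\<^sup>2) \<in> borel_measurable \<rho>" using en by auto
    have gradU: "grad (U n y) = bump (R n) y *\<^sub>R grad (V y) + \<phi> y *\<^sub>R grad (bump_grad (R n) y)" for n y
      unfolding U_def by (simp add: linear_add[OF linear_grad] linear_cmul[OF linear_grad])
    have small: "norm (grad (bump_grad (R n) y)) \<le> 4 * c * inverse (R n)" for n y
    proof -
      have "norm (grad (bump_grad (R n) y)) \<le> norm (bump_grad (R n) y) * c" by (rule c)
      also have "\<dots> \<le> 4 / R n * c" using c norm_bump_grad_le[OF R(1)] by (intro mult_right_mono) auto
      finally show ?thesis by (simp add: divide_inverse mult_ac)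
    qed
    show "AE x in \<rho>. norm ((norm (grad (U n (L x))))\<^sup>2) \<le> 2 * (norm (grad (V (L x))))\<^sup>2 + 2 * (4 * c)\<^sup>2 * (\<phi> (L x))\<^sup>2" for n
    proof (rule AE_I2)
      fix x
      let ?y = "L x"
      have "norm (grad (U n ?y)) \<le> norm (bump (R n) ?y *\<^sub>R grad (V ?y)) + norm (\<phi> ?y *\<^sub>R grad (bump_grad (R n) ?y))"
        unfolding gradU by (rule norm_triangle_ineq)
      also have "norm (bump (R n) ?y *\<^sub>R grad (V ?y)) \<le> norm (grad (V ?y))"
        using bump_bounds[OF R(1), of n ?y] by (simp add: mult_left_le_one_le)
      also have "norm (\<phi> ?y *\<^sub>R grad (bump_grad (R n) ?y)) \<le> \<bar>\<phi> ?y\<bar> * (4 * c)"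
      proof -
        have "4 * c * inverse (R n) \<le> 4 * c * 1"
          using c R(2)[of n] by (intro mult_left_mono) (auto simp: inverse_le_1_iff)
        then show ?thesis using small[of n ?y] by (auto intro!: mult_left_mono)
      qed
      finally have "(norm (grad (U n ?y)))\<^sup>2 \<le> (norm (grad (V ?y)) + \<bar>\<phi> ?y\<bar> * (4 * c))\<^sup>2"
        by (intro power_mono) auto
      also have "\<dots> \<le> 2 * (norm (grad (V ?y)))\<^sup>2 + 2 * (\<bar>\<phi> ?y\<bar> * (4 * c))\<^sup>2"
        using sum_squares_bound[of "norm (grad (V ?y))" "\<bar>\<phi> ?y\<bar> * (4 * c)"] by (simp add: power2_sum)
      finally show "norm ((norm (grad (U n ?y)))\<^sup>2) \<le> 2 * (norm (grad (V ?y)))\<^sup>2 + 2 * (4 * c)\<^sup>2 * (\<phi> ?y)\<^sup>2"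
        by (simp add: power_mult_distrib mult_ac)
    qed
    show "AE x in \<rho>. (\<lambda>n. (norm (grad (U n (L x))))\<^sup>2) \<longlonglongrightarrow> (norm (grad (V (L x))))\<^sup>2"
    proof (rule AE_I2)
      fix x
      have "(\<lambda>n. 4 * c * inverse (R n)) \<longlonglongrightarrow> 4 * c * 0" by (intro tendsto_intros inv_lim)
      then have "(\<lambda>n. 4 * c * inverse (R n)) \<longlonglongrightarrow> 0" by simp
      then have "(\<lambda>n. grad (bump_grad (R n) (L x))) \<longlonglongrightarrow> 0"
        by (rule Lim_null_comparison[rotated]) (use small in auto)
      then have "(\<lambda>n. (norm (grad (U n (L x))))\<^sup>2) \<longlonglongrightarrow> (norm (1 *\<^sub>R grad (V (L x)) + \<phi> (L x) *\<^sub>R 0))\<^sup>2"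
        unfolding gradU by (intro tendsto_intros bump_lim)
      then show "(\<lambda>n. (norm (grad (U n (L x))))\<^sup>2) \<longlonglongrightarrow> (norm (grad (V (L x))))\<^sup>2" by simp
    qed
  qed
  define b where "b n = Z n * ln (Z n) + 2 / \<alpha> * I n + 1" for n
  have "b \<longlonglongrightarrow> 0 + 2 / \<alpha> * J + 1"
    unfolding b_def[abs_def] by (intro tendsto_intros Z_lim I_lim)
  then have b_lim: "(\<lambda>n. ennreal (b n)) \<longlonglongrightarrow> ennreal (2 / \<alpha> * J + 1)"
    by (simp add: tendsto_ennrealI)
  let ?h = "\<lambda>x. (\<phi> (L x))\<^sup>2 * ln ((\<phi> (L x))\<^sup>2)"
  have h_ge: "0 \<le> ?h x + 1" for x using mult_ln_ge[of "(\<phi> (L x))\<^sup>2"] by simp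
  have Fh_ge: "0 \<le> F n x * ln (F n x) + 1" for n x
    using mult_ln_ge[of "F n x"] F_pos[of n x] by linarith
  have [measurable]: "\<phi> \<in> borel_measurable borel" by (rule borel_measurable_continuous_onI) fact
  have "(\<integral>\<^sup>+x. ennreal (?h x + 1) \<partial>\<rho>) = (\<integral>\<^sup>+x. liminf (\<lambda>n. ennreal (F n x * ln (F n x) + 1)) \<partial>\<rho>)"
  proof (rule nn_integral_cong)
    fix x
    have "(\<lambda>n. ennreal (F n x * ln (F n x) + 1)) \<longlonglongrightarrow> ennreal (?h x + 1)"
      by (intro tendsto_ennrealI tendsto_add tendsto_mult_ln F_lim F_pos tendsto_const)
    then show "ennreal (?h x + 1) = liminf (\<lambda>n. ennreal (F n x * ln (F n x) + 1))"
      by (simp add: lim_imp_Liminf)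
  qed
  also have "\<dots> \<le> liminf (\<lambda>n. \<integral>\<^sup>+x. ennreal (F n x * ln (F n x) + 1) \<partial>\<rho>)"
    by (intro nn_integral_liminf) measurable
  also have "\<dots> \<le> liminf (\<lambda>n. ennreal (b n))"
  proof (intro Liminf_mono always_eventually allI)
    fix n
    have "(\<integral>\<^sup>+x. ennreal (F n x * ln (F n x) + 1) \<partial>\<rho>) = ennreal (\<integral>x. F n x * ln (F n x) + 1 \<partial>\<rho>)"
      using core(2)[of n] Fh_ge by (intro nn_integral_eq_integral) auto
    also have "(\<integral>x. F n x * ln (F n x) + 1 \<partial>\<rho>) = (\<integral>x. F n x * ln (F n x) \<partial>\<rho>) + 1"
      using core(2)[of n] by (simp add: prob_space)
    also have "ennreal \<dots> \<le> ennreal (b n)"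
      using core(3)[of n] by (intro ennreal_leI) (simp add: b_def Z_def I_def)
    finally show "(\<integral>\<^sup>+x. ennreal (F n x * ln (F n x) + 1) \<partial>\<rho>) \<le> ennreal (b n)" .
  qed
  also have "\<dots> = ennreal (2 / \<alpha> * J + 1)"
    using b_lim by (simp add: lim_imp_Liminf)
  finally have le: "(\<integral>\<^sup>+x. ennreal (?h x + 1) \<partial>\<rho>) \<le> ennreal (2 / \<alpha> * J + 1)" .
  have int1: "integrable \<rho> (\<lambda>x. ?h x + 1)"
    using le h_ge by (intro integrableI_nonneg) (auto simp: top_unique less_top[symmetric])
  from Bochner_Integration.integrable_diff[OF this integrable_const[of 1]]
  show int: "integrable \<rho> ?h" by simp
  have "0 \<le> J" unfolding J_def by simp
  have "ennreal (\<integral>x. ?h x + 1 \<partial>\<rho>) \<le> ennreal (2 / \<alpha> * J + 1)"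
    using le h_ge by (subst (asm) nn_integral_eq_integral[OF int1]) auto
  then have "(\<integral>x. ?h x + 1 \<partial>\<rho>) \<le> 2 / \<alpha> * J + 1"
    using \<open>0 \<le> J\<close> \<alpha>_pos by (subst (asm) ennreal_le_iff) auto
  then show "(\<integral>x. ?h x \<partial>\<rho>) \<le> 2 / \<alpha> * (\<integral>x. (norm (grad (V (L x))))\<^sup>2 \<partial>\<rho>)"
    using int by (simp add: prob_space J_def)
qed

end

theorem theorem7:
  fixes \<iota> :: "'h::{real_inner,banach,polish_space} \<Rightarrow> 'e::{frechet_space,polish_space}"
    and et :: "nat \<Rightarrow> 'e \<Rightarrow> real"
    and \<alpha> :: real
    and \<rho> :: "'e measure"
    and \<phi> :: "real ^ 'k::finite \<Rightarrow> real"
    and l :: "'k \<Rightarrow> 'e \<Rightarrow> real"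
    and f :: "'e \<Rightarrow> real"
  assumes "dense_injection \<iota>"
    and "\<And>i. et i \<in> continuous_dual"
    and "complete_orthonormal (\<lambda>i. dual_to_H \<iota> (et i))"
    and "0 < \<alpha>"
    and "prob_space \<rho>"
    and "super_log_concave \<iota> et \<alpha> \<rho>"
    and "smooth \<phi>"
    and "\<And>i. l i \<in> continuous_dual"
    and "f = cylindrical \<phi> l"
    and "(\<integral>x. (f x)\<^sup>2 \<partial>\<rho>) = 1"
  shows "ext_integral \<rho> (\<lambda>x. (f x)\<^sup>2 * ln ((f x)\<^sup>2))
           \<le> ereal (2 / \<alpha>) * ext_integral \<rho> (\<lambda>x. (norm (cylindrical_gradient \<iota> \<phi> l x))\<^sup>2)"
proof -
  interpret super_log_concave_setting \<iota> et \<alpha> \<rho> l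
    by (rule super_log_concave_setting.intro) fact+
  let ?V = "\<lambda>y. \<chi> i. frechet_derivative \<phi> (at y) (axis i 1)"
  let ?E = "\<lambda>x. (norm (grad (?V (L x))))\<^sup>2"
  have f: "f x = \<phi> (L x)" for x
    by (simp add: \<open>f = cylindrical \<phi> l\<close> cylindrical_def L_def)
  have gradient: "cylindrical_gradient \<iota> \<phi> l x = grad (?V (L x))" for x
    by (simp add: cylindrical_gradient_def grad_def L_def)
  note V = smooth_gradient_field[OF \<open>smooth \<phi>\<close>]
  have contE: "continuous_on UNIV (\<lambda>y. (norm (grad (?V y)))\<^sup>2)"
    by (intro continuous_intros bounded_linear.continuous_on[OF bounded_linear_grad V(2)])
  have E_meas: "?E \<in> borel_measurable \<rho>"
    by (rule measurable_compose[OF L_measurable borel_measurable_continuous_onI[OF contE]])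
  have sq: "integrable \<rho> (\<lambda>x. (\<phi> (L x))\<^sup>2)" "(\<integral>x. (\<phi> (L x))\<^sup>2 \<partial>\<rho>) = 1"
    using \<open>(\<integral>x. (f x)\<^sup>2 \<partial>\<rho>) = 1\<close> not_integrable_integral_eq[of \<rho> "\<lambda>x. (\<phi> (L x))\<^sup>2"] unfolding f by fastforce+
  show ?thesis
  proof (cases "(\<integral>\<^sup>+x. ennreal (?E x) \<partial>\<rho>) = \<infinity>")
    case True
    have "(\<lambda>x. ennreal (- ?E x)) = (\<lambda>x. 0)" by (simp add: ennreal_neg)
    then have "ext_integral \<rho> ?E = \<infinity>" using True by (simp add: ext_integral_def)
    then show ?thesis unfolding gradient using \<open>0 < \<alpha>\<close> by simp
  next
    case False
    then have en: "integrable \<rho> ?E"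
      using E_meas by (intro integrableI_nonneg) (auto simp: less_top)
    note ls = log_sobolev_finite_energy[OF V sq en]
    show ?thesis
      unfolding f gradient ext_integral_eq_integral[OF en] ext_integral_eq_integral[OF ls(1)]
      using ls(2) by simp
  qed
qed

end
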